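(* $\mathsf{CantorStoch}_{\mathsf{lc}}$ is isomorphic to $\mathsf{Free}^\infty(\Sigma,E)$, where $(\Sigma,E)$ is the symmetric monoidal theory of $\mathsf{CausCirc}$ (causal circuits).
   Context: A symmetric monoidal theory (SMT) $(\Sigma,E)$ is a signature $\Sigma$ of generators $o\colon m\to n$ ($m,n\in\mathbb{N}$) with a set $E$ of equations between $\Sigma$-terms (terms freely obtained by sequential and parallel composition from generators, identity $1\to1$, symmetry $2\to2$ and the empty diagram $0\to0$). $\mathsf{Free}(\Sigma,E)$ is the symmetric strict monoidal category with objects the natural numbers (tensor is addition) and morphisms $m\to n$ the $\Sigma$-terms of that type modulo $E$ and the laws of symmetric strict monoidal categories. $\mathsf{BinStoch}$: objects are the finite powers $2^n$ of $2=\{0,1\}$, $n\in\mathbb{N}$; morphisms $f\colon X\to Y$ are functions $(y,x)\mapsto f(y\mid x)\in\mathbb{R}^{\ge0}$ with $\sum_{y\in Y}f(y\mid x)=1$ for all $x$; composition $gf(z\mid x)=\sum_y g(z\mid y)f(y\mid x)$; tensor is the product of sets with $(f\otimes h)(y,w\mid x,z)=f(y\mid x)h(w\mid z)$; unit $I=2^0$. It is semicartesian (unit terminal, $\mathrm{del}_X\colon X\to I$ the unique morphism) with cancellative deletions ($f\otimes\mathrm{del}_X=g\otimes\mathrm{del}_X$ implies $f=g$). The theory of causal circuits: $\Sigma$ consists of generators $\mathrm{del}\colon1\to0$, $\mathrm{copy}\colon1\to2$, $\mathrm{and}\colon2\to1$, $\mathrm{not}\colon1\to1$ and $p\colon0\to1$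 for every $p\in[0,1]$; $E$ is the specific set of equations for causal circuits given by Piedeleu et al. (2025) in their complete axiomatisation of $\mathsf{BinStoch}$; and $\mathsf{CausCirc}:=\mathsf{Free}(\Sigma,E)$. It is known (Piedeleu et al.) that $\mathsf{CausCirc}\cong\mathsf{BinStoch}$, the object $n$ corresponding to $2^n$, via the standard interpretation of generators: $\mathrm{del}$ is the unique map to $2^0$, $\mathrm{copy}$ the diagonal function, $\mathrm{and}$, $\mathrm{not}$ the Boolean functions (as deterministic stochastic maps), and $p$ the distribution on $2$ giving probability $p$ to $1$. Thus two $\Sigma$-terms are equal modulo $E$ (and the laws of symmetric strict monoidal categories) if and only if they have the same interpretation in $\mathsf{BinStoch}$, and every morphism of $\mathsf{BinStoch}$ is the interpretation of a $\Sigma$-term; this determines $\mathsf{Free}(\Sigma,E)$. For a countable set $J$, $\mathsf{FinLO}(J)$ is the category whose objects are finite linearly ordered subsets of $J$, with a morphism $F\to F'$ whenever $F$ is an ordered subset of $F'$ (i.e. $F$ is contained in $F'$ and the inclusion preserves the order); such a morphism is written $F\subseteq F'$. In a semicartesian category $\mathsf{C}$ the abstract infinite tensor product of a family $(X_j)_{j\in J}$ is the functor $X\colon\mathsf{FinLO}(J)^{\mathrm{op}}\to\mathsf{C}$, $F\mapsto X_F:=\bigotimes_{j\in F}X_j$, sending $F\subseteq F'$ to the morphism $\pi_{F',F}\colon X_{F'}\to X_F$ which deletes all factors $j\in F'\setminus F$ and keeps the rest unchanged (up to permutation, $\mathrm{id}_{X_F}\otimes\mathrm{del}_{X_{F'\setminus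 F}}$); $J_X:=J$. If $\mathsf{C}$ has cancellative deletions, a finite approximation family $f\colon X\to Y$ consists of an index set $\Lambda_f\subseteq \mathsf{FinLO}(J_X)\times\mathsf{FinLO}(J_Y)$ (pairs of objects) and morphisms $(f_{F,G}\colon X_F\to Y_G)_{(F,G)\in\Lambda_f}$ such that: (Naturality) for $F'\supseteq F$, $G'\supseteq G$ with $(F,G),(F',G')\in\Lambda_f$, $\pi_{G',G}f_{F',G'}=f_{F,G}\pi_{F',F}$; (Covering) for every $G$ there is $F$ with $(F,G)\in\Lambda_f$; (Hereditariness) if $(F,G)\in\Lambda_f$ then $(F',G)\in\Lambda_f$ for every $F'\supseteq F$. Two families are equivalent if they agree on the intersection of their index sets. Composition is $(gf)_{F,H}:=g_{G,H}f_{F,G}$ whenever $(F,G)\in\Lambda_f$, $(G,H)\in\Lambda_g$ for some $G$. For $(\Sigma,E)$ with $\mathsf{Free}(\Sigma,E)$ semicartesian with cancellative deletions, $\mathsf{Free}^\infty(\Sigma,E)$ is the category whose objects are the natural numbers together with one additional object $\infty$, and whose morphisms are (equivalence classes of) finite approximation families of $\Sigma$-terms modulo $E$, where $n\in\mathbb{N}$ is regarded as the abstract infinite tensor product indexed by a one-element set $\{*\}$ with value $n$ at $*$, and $\infty$ as the abstract infinite tensor product indexed by $\mathbb{N}$ of the constant family $1$; families between natural numbers $m\to n$ are identified with the morphisms $m\to n$ of $\mathsf{Free}(\Sigma,E)$. (Its tensor product is addition on natural numbers, $\infty\otimes N=N\otimes\infty=\infty$, and pointwise tensor of families reindexed along fixed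 chosen bijections $\mathbb{N}\sqcup\{0,\dots,n-1\}\cong\mathbb{N}$, $\mathbb{N}\sqcup\mathbb{N}\cong\mathbb{N}$.) A Stone space is a compact Hausdorff space with a basis of clopen sets; $\mathsf{Clopen}(X)$ denotes its clopen sets. A locally constant Markov kernel $f$ from $X$ to $Y$ (Stone spaces) is a function $f\colon\mathsf{Clopen}(Y)\times X\to[0,1]$, $(U,x)\mapsto f(U\mid x)$, such that (i) for every $U\in\mathsf{Clopen}(Y)$, $f(U\mid-)$ is locally constant on $X$; (ii) for every $x\in X$, $f(-\mid x)$ is a finitely additive probability measure on $\mathsf{Clopen}(Y)$. $\mathsf{StoneStoch}_{\mathsf{lc}}$ is the category of Stone spaces and locally constant Markov kernels with composition $gf(V\mid x):=\int_Y g(V\mid y)f(dy\mid x)$, i.e. $\sum_i g(V\mid U_i)f(U_i\mid x)$ for any finite clopen partition $\{U_i\}$ of $Y$ on whose (nonempty) members $g(V\mid-)$ is constant. $\mathsf{CantorStoch}_{\mathsf{lc}}$ is its full subcategory on the objects $2^N=\{0,1\}^N$, where $N$ is any natural number (discrete space) or $N=\mathbb{N}$ (Cantor space).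
   Formalization: Finite linearly ordered subsets of the index set carry only the order induced from the natural numbers; with arbitrary linear orders, equivalence of finite approximation families is not transitive and their composition is not well defined. *)

theory Defs
  imports "HOL-Analysis.Analysis" "HOL-Library.Sublist" "HOL-Library.Extended_Nat"
begin

section \<open>Categories\<close>

text \<open>Composition and tensor of morphisms take the objects involved as arguments, because hom-sets
  are not required to be disjoint: \<open>Comp C X Y Z g f\<close> is \<open>g \<circ> f : X \<rightarrow> Y \<rightarrow> Z\<close>.\<close>

record ('o, 'm) category =
  Ob :: "'o set"
  Hom :: "'o \<Rightarrow> 'o \<Rightarrow> 'm set"
  Idn :: "'o \<Rightarrow> 'm"
  Comp :: "'o \<Rightarrow> 'o \<Rightarrow> 'o \<Rightarrow> 'm \<Rightarrow> 'm \<Rightarrow> 'm"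

definition category :: "('o, 'm, 'z) category_scheme \<Rightarrow> bool" where
  "category C \<longleftrightarrow>
     (\<forall>X\<in>Ob C. Idn C X \<in> Hom C X X) \<and>
     (\<forall>X\<in>Ob C. \<forall>Y\<in>Ob C. \<forall>Z\<in>Ob C. \<forall>f\<in>Hom C X Y. \<forall>g\<in>Hom C Y Z.
        Comp C X Y Z g f \<in> Hom C X Z) \<and>
     (\<forall>X\<in>Ob C. \<forall>Y\<in>Ob C. \<forall>f\<in>Hom C X Y.
        Comp C X X Y f (Idn C X) = f \<and> Comp C X Y Y (Idn C Y) f = f) \<and>
     (\<forall>W\<in>Ob C. \<forall>X\<in>Ob C. \<forall>Y\<in>Ob C. \<forall>Z\<in>Ob C.
        \<forall>f\<in>Hom C W X. \<forall>g\<in>Hom C X Y. \<forall>h\<in>Hom C Y Z.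
        Comp C W X Z (Comp C X Y Z h g) f = Comp C W Y Z h (Comp C W X Y g f))"

definition category_isomorphism ::
  "('o, 'm, 'z) category_scheme \<Rightarrow> ('p, 'n, 'w) category_scheme \<Rightarrow>
   ('o \<Rightarrow> 'p) \<Rightarrow> ('o \<Rightarrow> 'o \<Rightarrow> 'm \<Rightarrow> 'n) \<Rightarrow> bool" where
  "category_isomorphism C D \<Phi> \<phi> \<longleftrightarrow>
     bij_betw \<Phi> (Ob C) (Ob D) \<and>
     (\<forall>X\<in>Ob C. \<forall>Y\<in>Ob C. bij_betw (\<phi> X Y) (Hom C X Y) (Hom D (\<Phi> X) (\<Phi> Y))) \<and>
     (\<forall>X\<in>Ob C. \<phi> X X (Idn C X) = Idn D (\<Phi> X)) \<and>
     (\<forall>X\<in>Ob C. \<forall>Y\<in>Ob C. \<forall>Z\<in>Ob C. \<forall>f\<in>Hom C X Y. \<forall>g\<in>Hom C Y Z.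
        \<phi> X Z (Comp C X Y Z g f) = Comp D (\<Phi> X) (\<Phi> Y) (\<Phi> Z) (\<phi> Y Z g) (\<phi> X Y f))"

definition isomorphic_categories ::
  "('o, 'm, 'z) category_scheme \<Rightarrow> ('p, 'n, 'w) category_scheme \<Rightarrow> bool" where
  "isomorphic_categories C D \<longleftrightarrow>
     category C \<and> category D \<and> (\<exists>\<Phi> \<phi>. category_isomorphism C D \<Phi> \<phi>)"

definition full_subcategory ::
  "('o, 'm, 'z) category_scheme \<Rightarrow> 'o set \<Rightarrow> ('o, 'm, 'z) category_scheme" where
  "full_subcategory C S = C\<lparr>Ob := S\<rparr>"

text \<open>\<open>TensM C X X' Y Y' f f'\<close> is \<open>f \<otimes> f' : X \<otimes> Y \<rightarrow> X' \<otimes> Y'\<close>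
  for \<open>f : X \<rightarrow> X'\<close> and \<open>f' : Y \<rightarrow> Y'\<close>.\<close>

record ('o, 'm) monoidal_category = "('o, 'm) category" +
  Unt :: "'o"
  TensO :: "'o \<Rightarrow> 'o \<Rightarrow> 'o"
  TensM :: "'o \<Rightarrow> 'o \<Rightarrow> 'o \<Rightarrow> 'o \<Rightarrow> 'm \<Rightarrow> 'm \<Rightarrow> 'm"


section \<open>Symmetric monoidal theories\<close>

record 'g signature =
  gens :: "'g set"
  ar :: "'g \<Rightarrow> nat"
  coar :: "'g \<Rightarrow> nat"

text \<open>Sequential composition is in diagrammatic order.\<close>

datatype 'g smterm =
    Gen 'g
  | Wire
  | Swap
  | Void
  | Seq "'g smterm" "'g smterm" (infixl "\<^bold>;" 60)
  | Par "'g smterm" "'g smterm" (infixr "\<^bold>\<otimes>" 70)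

primrec src :: "'g signature \<Rightarrow> 'g smterm \<Rightarrow> nat" where
  "src S (Gen g) = ar S g"
| "src S Wire = 1"
| "src S Swap = 2"
| "src S Void = 0"
| "src S (s \<^bold>; t) = src S s"
| "src S (s \<^bold>\<otimes> t) = src S s + src S t"

primrec tgt :: "'g signature \<Rightarrow> 'g smterm \<Rightarrow> nat" where
  "tgt S (Gen g) = coar S g"
| "tgt S Wire = 1"
| "tgt S Swap = 2"
| "tgt S Void = 0"
| "tgt S (s \<^bold>; t) = tgt S t"
| "tgt S (s \<^bold>\<otimes> t) = tgt S s + tgt S t"

primrec well_formed :: "'g signature \<Rightarrow> 'g smterm \<Rightarrow> bool" where
  "well_formed S (Gen g) \<longleftrightarrow> g \<in> gens S"
| "well_formed S Wire \<longleftrightarrow> True"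
| "well_formed S Swap \<longleftrightarrow> True"
| "well_formed S Void \<longleftrightarrow> True"
| "well_formed S (s \<^bold>; t) \<longleftrightarrow> well_formed S s \<and> well_formed S t \<and> tgt S s = src S t"
| "well_formed S (s \<^bold>\<otimes> t) \<longleftrightarrow> well_formed S s \<and> well_formed S t"

definition typed :: "'g signature \<Rightarrow> 'g smterm \<Rightarrow> nat \<Rightarrow> nat \<Rightarrow> bool" where
  "typed S t m n \<longleftrightarrow> well_formed S t \<and> src S t = m \<and> tgt S t = n"

definition symmetric_monoidal_theory ::
  "'g signature \<Rightarrow> ('g smterm \<times> 'g smterm) set \<Rightarrow> bool" where
  "symmetric_monoidal_theory S E \<longleftrightarrow>
     (\<forall>(s, t)\<in>E. \<exists>m n. typed S s m n \<and> typed S t m n)"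

primrec id_term :: "nat \<Rightarrow> 'g smterm" where
  "id_term 0 = Void"
| "id_term (Suc n) = Wire \<^bold>\<otimes> id_term n"

text \<open>\<open>swap1_term n : 1 + n \<rightarrow> n + 1\<close> moves the first wire past the \<open>n\<close> others, and
  \<open>swap_term m n : m + n \<rightarrow> n + m\<close> is the block symmetry.\<close>

primrec swap1_term :: "nat \<Rightarrow> 'g smterm" where
  "swap1_term 0 = Wire"
| "swap1_term (Suc n) = (Swap \<^bold>\<otimes> id_term n) \<^bold>; (Wire \<^bold>\<otimes> swap1_term n)"

primrec swap_term :: "nat \<Rightarrow> nat \<Rightarrow> 'g smterm" where
  "swap_term 0 n = id_term n"
| "swap_term (Suc m) n = (Wire \<^bold>\<otimes> swap_term m n) \<^bold>; (swap1_term n \<^bold>\<otimes> id_term m)"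

text \<open>Equality of terms modulo \<open>E\<close> and the laws of symmetric strict monoidal categories.\<close>

inductive smt_eq ::
  "'g signature \<Rightarrow> ('g smterm \<times> 'g smterm) set \<Rightarrow> 'g smterm \<Rightarrow> 'g smterm \<Rightarrow> bool"
  for S E where
  axiom: "(s, t) \<in> E \<Longrightarrow> smt_eq S E s t"
| refl: "typed S t m n \<Longrightarrow> smt_eq S E t t"
| sym: "smt_eq S E s t \<Longrightarrow> smt_eq S E t s"
| trans: "smt_eq S E s t \<Longrightarrow> smt_eq S E t u \<Longrightarrow> smt_eq S E s u"
| seq_cong: "smt_eq S E s s' \<Longrightarrow> smt_eq S E t t' \<Longrightarrow> typed S s m n \<Longrightarrow> typed S t n k \<Longrightarrow>
    smt_eq S E (s \<^bold>; t) (s' \<^bold>; t')"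
| par_cong: "smt_eq S E s s' \<Longrightarrow> smt_eq S E t t' \<Longrightarrow> smt_eq S E (s \<^bold>\<otimes> t) (s' \<^bold>\<otimes> t')"
| seq_assoc: "typed S s m n \<Longrightarrow> typed S t n k \<Longrightarrow> typed S u k l \<Longrightarrow>
    smt_eq S E ((s \<^bold>; t) \<^bold>; u) (s \<^bold>; (t \<^bold>; u))"
| seq_id_left: "typed S t m n \<Longrightarrow> smt_eq S E (id_term m \<^bold>; t) t"
| seq_id_right: "typed S t m n \<Longrightarrow> smt_eq S E (t \<^bold>; id_term n) t"
| par_assoc: "typed S s m n \<Longrightarrow> typed S t m' n' \<Longrightarrow> typed S u m'' n'' \<Longrightarrow>
    smt_eq S E ((s \<^bold>\<otimes> t) \<^bold>\<otimes> u) (s \<^bold>\<otimes> (t \<^bold>\<otimes> u))"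
| par_void_left: "typed S t m n \<Longrightarrow> smt_eq S E (Void \<^bold>\<otimes> t) t"
| par_void_right: "typed S t m n \<Longrightarrow> smt_eq S E (t \<^bold>\<otimes> Void) t"
| interchange: "typed S s m n \<Longrightarrow> typed S t n k \<Longrightarrow> typed S s' m' n' \<Longrightarrow> typed S t' n' k' \<Longrightarrow>
    smt_eq S E ((s \<^bold>; t) \<^bold>\<otimes> (s' \<^bold>; t')) ((s \<^bold>\<otimes> s') \<^bold>; (t \<^bold>\<otimes> t'))"
| swap_natural: "typed S s m n \<Longrightarrow> typed S t m' n' \<Longrightarrow>
    smt_eq S E ((s \<^bold>\<otimes> t) \<^bold>; swap_term n n') (swap_term m m' \<^bold>; (t \<^bold>\<otimes> s))"
| swap_involutive: "smt_eq S E (swap_term m n \<^bold>; swap_term n m) (id_term (m + n))"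
| swap_hexagon: "smt_eq S E (swap_term (m + m') n)
    ((id_term m \<^bold>\<otimes> swap_term m' n) \<^bold>; (swap_term m n \<^bold>\<otimes> id_term m'))"

definition term_class ::
  "'g signature \<Rightarrow> ('g smterm \<times> 'g smterm) set \<Rightarrow> 'g smterm \<Rightarrow> 'g smterm set" where
  "term_class S E t = {u. smt_eq S E t u}"

definition Free ::
  "'g signature \<Rightarrow> ('g smterm \<times> 'g smterm) set \<Rightarrow> (nat, 'g smterm set) monoidal_category" where
  "Free S E =
    \<lparr> Ob = UNIV,
      Hom = (\<lambda>m n. term_class S E ` {t. typed S t m n}),
      Idn = (\<lambda>n. term_class S E (id_term n)),
      Comp = (\<lambda>m n k g f. \<Union>s\<in>f. \<Union>t\<in>g. term_class S E (s \<^bold>; t)),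
      Unt = 0,
      TensO = (+),
      TensM = (\<lambda>m n m' n' f f'. \<Union>s\<in>f. \<Union>t\<in>f'. term_class S E (s \<^bold>\<otimes> t)) \<rparr>"


section \<open>Causal circuits\<close>

text \<open>The object \<open>2\<^sup>n\<close> of BinStoch is named by \<open>n\<close>, its elements are the Boolean lists of length
  \<open>n\<close>; \<open>f y x\<close> is \<open>f(y|x)\<close>, set to \<open>0\<close> outside the domain.\<close>

definition pow2 :: "nat \<Rightarrow> bool list set" where
  "pow2 n = {x. length x = n}"

definition BinStoch :: "(nat, bool list \<Rightarrow> bool list \<Rightarrow> real) monoidal_category" where
  "BinStoch =
    \<lparr> Ob = UNIV,
      Hom = (\<lambda>m n. {f. (\<forall>y x. 0 \<le> f y x) \<and> (\<forall>x\<in>pow2 m. (\<Sum>y\<in>pow2 n. f y x) = 1) \<and>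
                       (\<forall>y x. y \<notin> pow2 n \<or> x \<notin> pow2 m \<longrightarrow> f y x = 0)}),
      Idn = (\<lambda>n y x. if x \<in> pow2 n \<and> y = x then 1 else 0),
      Comp = (\<lambda>m n k g f z x. \<Sum>y\<in>pow2 n. g z y * f y x),
      Unt = 0,
      TensO = (+),
      TensM = (\<lambda>m n m' n' f f' y x. f (take n y) (take m x) * f' (drop n y) (drop m x)) \<rparr>"

datatype causal_gen = Del | Copy | And | Not | Prob real

definition causal_sig :: "causal_gen signature" where
  "causal_sig =
    \<lparr> gens = {Del, Copy, And, Not} \<union> Prob ` {0..1},
      ar = (\<lambda>g. case g of Del \<Rightarrow> 1 | Copy \<Rightarrow> 1 | And \<Rightarrow> 2 | Not \<Rightarrow> 1 | Prob p \<Rightarrow> 0),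
      coar = (\<lambda>g. case g of Del \<Rightarrow> 0 | Copy \<Rightarrow> 2 | And \<Rightarrow> 1 | Not \<Rightarrow> 1 | Prob p \<Rightarrow> 1) \<rparr>"

definition deterministic ::
  "nat \<Rightarrow> (bool list \<Rightarrow> bool list) \<Rightarrow> bool list \<Rightarrow> bool list \<Rightarrow> real" where
  "deterministic m \<phi> y x = (if x \<in> pow2 m \<and> y = \<phi> x then 1 else 0)"

primrec interp_gen :: "causal_gen \<Rightarrow> bool list \<Rightarrow> bool list \<Rightarrow> real" where
  "interp_gen Del = deterministic 1 (\<lambda>x. [])"
| "interp_gen Copy = deterministic 1 (\<lambda>x. [x ! 0, x ! 0])"
| "interp_gen And = deterministic 2 (\<lambda>x. [x ! 0 \<and> x ! 1])"
| "interp_gen Not = deterministic 1 (\<lambda>x. [\<not> x ! 0])"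
| "interp_gen (Prob p) =
     (\<lambda>y x. if x = [] \<and> y = [True] then p else if x = [] \<and> y = [False] then 1 - p else 0)"

primrec interp :: "causal_gen smterm \<Rightarrow> bool list \<Rightarrow> bool list \<Rightarrow> real" where
  "interp (Gen g) = interp_gen g"
| "interp Wire = Idn BinStoch 1"
| "interp Swap = deterministic 2 (\<lambda>x. [x ! 1, x ! 0])"
| "interp Void = Idn BinStoch 0"
| "interp (s \<^bold>; t) = Comp BinStoch (src causal_sig s) (tgt causal_sig s) (tgt causal_sig t)
     (interp t) (interp s)"
| "interp (s \<^bold>\<otimes> t) = TensM BinStoch (src causal_sig s) (tgt causal_sig s)
     (src causal_sig t) (tgt causal_sig t) (interp s) (interp t)"

text \<open>The equations of Piedeleu et al. (2025) enter only through their soundness and completeness: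
  they present BinStoch. Any set \<open>E\<close> with this property presents the same category CausCirc.\<close>

definition causal_circuit_axioms :: "(causal_gen smterm \<times> causal_gen smterm) set \<Rightarrow> bool" where
  "causal_circuit_axioms E \<longleftrightarrow>
     symmetric_monoidal_theory causal_sig E \<and>
     (\<forall>m n s t. typed causal_sig s m n \<longrightarrow> typed causal_sig t m n \<longrightarrow>
        (smt_eq causal_sig E s t \<longleftrightarrow> interp s = interp t))"


section \<open>Finite approximation families\<close>

text \<open>The index sets \<open>J\<close> are sets of natural numbers, with the order of \<open>\<nat>\<close>; a finite linearly
  ordered subset of \<open>J\<close> is the increasing list of its elements, and an ordered subset is a
  subsequence. Pairing finite subsets with arbitrary linear orders instead would not do:
  \<open>[0, 1]\<close> and \<open>[1, 0]\<close> then have no common upper bound, so that equivalence of families is not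
  transitive and composition is not well defined.\<close>

definition FinLO :: "nat set \<Rightarrow> nat list set" where
  "FinLO J = {F. sorted_wrt (<) F \<and> set F \<subseteq> J}"

text \<open>An abstract infinite tensor product is a pair \<open>(J, X)\<close>, with only the values \<open>X j\<close> for
  \<open>j \<in> J\<close> relevant.\<close>

type_synonym 'o tensor_family = "nat set \<times> (nat \<Rightarrow> 'o)"

primrec tens_list ::
  "('o, 'm, 'z) monoidal_category_scheme \<Rightarrow> (nat \<Rightarrow> 'o) \<Rightarrow> nat list \<Rightarrow> 'o" where
  "tens_list C X [] = Unt C"
| "tens_list C X (j # F) = TensO C (X j) (tens_list C X F)"

definition del :: "('o, 'm, 'z) monoidal_category_scheme \<Rightarrow> 'o \<Rightarrow> 'm" where
  "del C A = (THE f. f \<in> Hom C A (Unt C))"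

text \<open>\<open>proj C X F' F : X\<^sub>F\<^sub>' \<rightarrow> X\<^sub>F\<close>, for \<open>F \<subseteq> F'\<close>, is the tensor product over \<open>j \<in> F'\<close> of
  \<open>id : X\<^sub>j \<rightarrow> X\<^sub>j\<close> for \<open>j \<in> F\<close> and \<open>del : X\<^sub>j \<rightarrow> I\<close> for \<open>j \<notin> F\<close>.\<close>

primrec proj ::
  "('o, 'm, 'z) monoidal_category_scheme \<Rightarrow> (nat \<Rightarrow> 'o) \<Rightarrow> nat list \<Rightarrow> nat list \<Rightarrow> 'm" where
  "proj C X [] F = Idn C (Unt C)"
| "proj C X (j # F') F =
     TensM C (X j) (if j \<in> set F then X j else Unt C)
       (tens_list C X F') (tens_list C X (filter (\<lambda>i. i \<in> set F) F'))
       (if j \<in> set F then Idn C (X j) else del C (X j))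
       (proj C X F' F)"

text \<open>A family is a pair \<open>(\<Lambda>, f)\<close>, where only the components \<open>f F G\<close> with \<open>(F, G) \<in> \<Lambda>\<close> matter.\<close>

type_synonym 'm approx_family = "(nat list \<times> nat list) set \<times> (nat list \<Rightarrow> nat list \<Rightarrow> 'm)"

definition finite_approximation_families ::
  "('o, 'm, 'z) monoidal_category_scheme \<Rightarrow> 'o tensor_family \<Rightarrow> 'o tensor_family \<Rightarrow>
   'm approx_family set" where
  "finite_approximation_families C = (\<lambda>(J, X) (K, Y). {(\<Lambda>, f).
     \<Lambda> \<subseteq> FinLO J \<times> FinLO K \<and>
     (\<forall>(F, G)\<in>\<Lambda>. f F G \<in> Hom C (tens_list C X F) (tens_list C Y G)) \<and>
     \<comment> \<open>Naturality\<close>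
     (\<forall>(F, G)\<in>\<Lambda>. \<forall>(F', G')\<in>\<Lambda>. subseq F F' \<and> subseq G G' \<longrightarrow>
        Comp C (tens_list C X F') (tens_list C Y G') (tens_list C Y G)
          (proj C Y G' G) (f F' G') =
        Comp C (tens_list C X F') (tens_list C X F) (tens_list C Y G)
          (f F G) (proj C X F' F)) \<and>
     \<comment> \<open>Covering\<close>
     (\<forall>G\<in>FinLO K. \<exists>F. (F, G) \<in> \<Lambda>) \<and>
     \<comment> \<open>Hereditariness\<close>
     (\<forall>(F, G)\<in>\<Lambda>. \<forall>F'\<in>FinLO J. subseq F F' \<longrightarrow> (F', G) \<in> \<Lambda>)})"

definition family_equiv :: "'m approx_family \<Rightarrow> 'm approx_family \<Rightarrow> bool" where
  "family_equiv = (\<lambda>(\<Lambda>, f) (\<Lambda>', f'). \<forall>(F, G)\<in>\<Lambda> \<inter> \<Lambda>'. f F G = f' F G)"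

definition family_comp ::
  "('o, 'm, 'z) monoidal_category_scheme \<Rightarrow>
   'o tensor_family \<Rightarrow> 'o tensor_family \<Rightarrow> 'o tensor_family \<Rightarrow>
   'm approx_family \<Rightarrow> 'm approx_family \<Rightarrow> 'm approx_family" where
  "family_comp C = (\<lambda>(J, X) (K, Y) (L, Z) (\<Lambda>g, g) (\<Lambda>f, f).
     ({(F, H). \<exists>G. (F, G) \<in> \<Lambda>f \<and> (G, H) \<in> \<Lambda>g},
      (\<lambda>F H. THE h. \<exists>G. (F, G) \<in> \<Lambda>f \<and> (G, H) \<in> \<Lambda>g \<and>
         h = Comp C (tens_list C X F) (tens_list C Y G) (tens_list C Z H) (g G H) (f F G))))"

definition family_id ::
  "('o, 'm, 'z) monoidal_category_scheme \<Rightarrow> 'o tensor_family \<Rightarrow> 'm approx_family" where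
  "family_id C = (\<lambda>(J, X). ({(F, G). F \<in> FinLO J \<and> G \<in> FinLO J \<and> subseq G F}, proj C X))"

definition family_class ::
  "('o, 'm, 'z) monoidal_category_scheme \<Rightarrow> 'o tensor_family \<Rightarrow> 'o tensor_family \<Rightarrow>
   'm approx_family \<Rightarrow> 'm approx_family set" where
  "family_class C X Y f = {f' \<in> finite_approximation_families C X Y. family_equiv f f'}"

text \<open>The object \<open>n\<close> is indexed by the one-element set \<open>{0}\<close>.\<close>

definition free_object :: "enat \<Rightarrow> nat tensor_family" where
  "free_object N = (case N of enat n \<Rightarrow> ({0}, \<lambda>_. n) | \<infinity> \<Rightarrow> (UNIV, \<lambda>_. 1))"

definition Free_infinity ::
  "'g signature \<Rightarrow> ('g smterm \<times> 'g smterm) set \<Rightarrow>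
   (enat, 'g smterm set approx_family set) category" where
  "Free_infinity S E =
    \<lparr> Ob = UNIV,
      Hom = (\<lambda>M N. family_class (Free S E) (free_object M) (free_object N) `
               finite_approximation_families (Free S E) (free_object M) (free_object N)),
      Idn = (\<lambda>N. family_class (Free S E) (free_object N) (free_object N)
               (family_id (Free S E) (free_object N))),
      Comp = (\<lambda>M N K \<gamma> \<phi>. \<Union>g\<in>\<gamma>. \<Union>f\<in>\<phi>.
               family_class (Free S E) (free_object M) (free_object K)
                 (family_comp (Free S E) (free_object M) (free_object N) (free_object K) g f)) \<rparr>"


section \<open>Stone spaces and locally constant Markov kernels\<close>

definition Clopen :: "'a topology \<Rightarrow> 'a set set" where
  "Clopen X = {U. openin X U \<and> closedin X U}"

definition stone_space :: "'a topology \<Rightarrow> bool" where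
  "stone_space X \<longleftrightarrow> compact_space X \<and> Hausdorff_space X \<and>
     (\<forall>U x. openin X U \<and> x \<in> U \<longrightarrow> (\<exists>V\<in>Clopen X. x \<in> V \<and> V \<subseteq> U))"

definition locally_constant :: "'a topology \<Rightarrow> ('a \<Rightarrow> 'b) \<Rightarrow> bool" where
  "locally_constant X h \<longleftrightarrow>
     (\<forall>x\<in>topspace X. \<exists>V. openin X V \<and> x \<in> V \<and> (\<forall>x'\<in>V. h x' = h x))"

definition lc_kernels :: "'a topology \<Rightarrow> 'b topology \<Rightarrow> ('b set \<times> 'a \<Rightarrow> real) set" where
  "lc_kernels X Y = {f \<in> Clopen Y \<times> topspace X \<rightarrow>\<^sub>E {0..1}.
     (\<forall>U\<in>Clopen Y. locally_constant X (\<lambda>x. f (U, x))) \<and>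
     (\<forall>x\<in>topspace X. additive (Clopen Y) (\<lambda>U. f (U, x)) \<and> f (topspace Y, x) = 1)}"

definition StoneStoch_lc :: "('a topology, 'a set \<times> 'a \<Rightarrow> real) category" where
  "StoneStoch_lc =
    \<lparr> Ob = {X. stone_space X},
      Hom = lc_kernels,
      Idn = (\<lambda>X. \<lambda>(U, x) \<in> Clopen X \<times> topspace X. if x \<in> U then 1 else 0),
      Comp = (\<lambda>X Y Z g f. \<lambda>(V, x) \<in> Clopen Z \<times> topspace X.
        THE r. \<exists>P c. finite P \<and> partition_on (topspace Y) P \<and> P \<subseteq> Clopen Y \<and>
          (\<forall>U\<in>P. \<forall>y\<in>U. g (V, y) = c U) \<and> r = (\<Sum>U\<in>P. c U * f (U, x))) \<rparr>"

text \<open>The space \<open>{0,1}\<^sup>N\<close>, for the index set \<open>{0, ..., N - 1}\<close> or \<open>\<nat>\<close>.\<close>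

definition two_pow :: "enat \<Rightarrow> (nat \<Rightarrow> bool) topology" where
  "two_pow N = product_topology (\<lambda>_. discrete_topology UNIV) {i. enat i < N}"

definition CantorStoch_lc ::
  "((nat \<Rightarrow> bool) topology, (nat \<Rightarrow> bool) set \<times> (nat \<Rightarrow> bool) \<Rightarrow> real) category" where
  "CantorStoch_lc = full_subcategory StoneStoch_lc (range two_pow)"

end

theory Submission
  imports Defs
begin

text \<open>
  A kernel between Cantor spaces and a finite approximation family carry the same data: for every
  finite set of output coordinates, the joint distribution of these coordinates, as a function of
  finitely many input coordinates.

  In one direction, let \<open>k\<close> be a locally constant kernel from \<open>2\<^sup>M\<close> to \<open>2\<^sup>N\<close> and \<open>C\<close> a cylinder of
  \<open>2\<^sup>N\<close>. As \<open>2\<^sup>M\<close> is compact, the locally constant function \<open>k(C|-)\<close> depends on finitely many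
  coordinates only (\<open>locally_constant_depends_on\<close>). So for each finite set \<open>G\<close> of output coordinates
  and each large enough finite set \<open>F\<close> of input coordinates, \<open>k\<close> restricts to a stochastic matrix
  \<open>2\<^sup>F \<rightarrow> 2\<^sup>G\<close>, and these matrices form a family (\<open>kernel_represented\<close>). In the other direction, every
  clopen set is a finite disjoint union of cylinders, so that a component of a family assigns a
  probability to it. Naturality says that this number is the same for all components that see the
  set, and the numbers define a kernel (\<open>family_represents_kernel\<close>). Two families are equivalent iff
  they come from the same kernel (\<open>family_equiv_iff_represents\<close>): any two index sets meet above every
  index, and cofinally many components determine the others. Hence sending a kernel to the set of all
  families that represent it is bijective on hom-sets. It preserves composition because
  the integral over the partition of the middle space into cylinders is a matrix product
  (\<open>sem_Comp_represents\<close>).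

  The components of a family are classes of circuits, not matrices, so the argument uses that the
  circuits modulo \<open>E\<close> are the same as the stochastic matrices between powers of two. That equal
  matrices come from equal circuits is the assumption on \<open>E\<close>. That every stochastic matrix comes from
  a circuit is \<open>BinStoch_definable\<close>: the chain rule \<open>p(y,b|x) = p(y|x) p(b|x,y)\<close> reduces it to
  matrices with one output bit, and a multiplexer controlled by the first input bit reduces those to
  biased coins.

  Associativity and the unit laws are proved for kernels, where composition is an
  integral, and carried over to families along the bijection (\<open>category_transport\<close>).
\<close>

section \<open>Stochastic matrices between powers of two\<close>

lemma finite_pow2 [simp]: "finite (pow2 n)"
  using finite_lists_length_eq[of "UNIV :: bool set" n] by (simp add: pow2_def)

lemma pow2_0 [simp]: "pow2 0 = {[]}"
  by (auto simp: pow2_def)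

lemma sum_pow2_Suc:
  fixes h :: "bool list \<Rightarrow> 'a::comm_monoid_add"
  shows "(\<Sum>y\<in>pow2 (Suc n). h y) = (\<Sum>y\<in>pow2 n. h (True # y)) + (\<Sum>y\<in>pow2 n. h (False # y))"
proof -
  have "pow2 (Suc n) = (#) True ` pow2 n \<union> (#) False ` pow2 n" (is "_ = ?A \<union> ?B")
    by (auto simp: pow2_def length_Suc_conv image_iff)
  moreover have "?A \<inter> ?B = {}" by auto
  ultimately show ?thesis
    by (simp add: sum.union_disjoint sum.reindex)
qed

lemma sum_pow2_add:
  fixes h :: "bool list \<Rightarrow> bool list \<Rightarrow> 'a::comm_monoid_add"
  shows "(\<Sum>w\<in>pow2 (n + k). h (take n w) (drop n w)) = (\<Sum>y\<in>pow2 n. \<Sum>z\<in>pow2 k. h y z)"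
proof -
  have "(\<Sum>y\<in>pow2 n. \<Sum>z\<in>pow2 k. h y z) = (\<Sum>(y, z)\<in>pow2 n \<times> pow2 k. h y z)"
    by (simp add: sum.cartesian_product)
  also have "\<dots> = (\<Sum>w\<in>pow2 (n + k). h (take n w) (drop n w))"
    by (rule sum.reindex_bij_witness[where i = "\<lambda>w. (take n w, drop n w)" and j = "\<lambda>(y, z). y @ z"])
      (auto simp: pow2_def)
  finally show ?thesis by simp
qed

lemma pow2_append_iff [simp]: "y \<in> pow2 n \<Longrightarrow> y @ z \<in> pow2 (n + k) \<longleftrightarrow> z \<in> pow2 k"
  by (auto simp: pow2_def)

lemma take_drop_pow2 [simp]: "w \<in> pow2 (n + k) \<Longrightarrow> take n w \<in> pow2 n"
  "w \<in> pow2 (n + k) \<Longrightarrow> drop n w \<in> pow2 k"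
  by (auto simp: pow2_def)

lemma take_drop_append_pow2 [simp]: "y \<in> pow2 n \<Longrightarrow> take n (y @ z) = y"
  "y \<in> pow2 n \<Longrightarrow> drop n (y @ z) = z"
  by (auto simp: pow2_def)

lemma not_pow2_add: "w \<notin> pow2 (n + k) \<Longrightarrow> take n w \<notin> pow2 n \<or> drop n w \<notin> pow2 k"
  by (auto simp: pow2_def)

lemma BinStoch_HomI:
  assumes "\<And>y x. 0 \<le> f y x" "\<And>x. x \<in> pow2 m \<Longrightarrow> (\<Sum>y\<in>pow2 n. f y x) = 1"
    "\<And>y x. y \<notin> pow2 n \<or> x \<notin> pow2 m \<Longrightarrow> f y x = 0"
  shows "f \<in> Hom BinStoch m n"
  using assms by (auto simp: BinStoch_def)

lemma BinStoch_HomD: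
  assumes "f \<in> Hom BinStoch m n"
  shows "0 \<le> f y x" "x \<in> pow2 m \<Longrightarrow> (\<Sum>y\<in>pow2 n. f y x) = 1"
    "y \<notin> pow2 n \<or> x \<notin> pow2 m \<Longrightarrow> f y x = 0"
  using assms by (auto simp: BinStoch_def)

lemma BinStoch_Comp: "Comp BinStoch m n k g f = (\<lambda>z x. \<Sum>y\<in>pow2 n. g z y * f y x)"
  by (simp add: BinStoch_def)

lemma BinStoch_TensM: "TensM BinStoch m n m' n' f f' =
    (\<lambda>y x. f (take n y) (take m x) * f' (drop n y) (drop m x))"
  by (simp add: BinStoch_def)

lemma BinStoch_Idn: "Idn BinStoch n = deterministic n (\<lambda>x. x)"
  by (auto simp: BinStoch_def deterministic_def fun_eq_iff)

lemma Comp_in_Hom: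
  assumes f: "f \<in> Hom BinStoch m n" and g: "g \<in> Hom BinStoch n k"
  shows "Comp BinStoch m n k g f \<in> Hom BinStoch m k"
  unfolding BinStoch_Comp
proof (rule BinStoch_HomI)
  show "0 \<le> (\<Sum>y\<in>pow2 n. g z y * f y x)" for z x
    by (intro sum_nonneg mult_nonneg_nonneg BinStoch_HomD(1)[OF f] BinStoch_HomD(1)[OF g])
  show "(\<Sum>z\<in>pow2 k. \<Sum>y\<in>pow2 n. g z y * f y x) = 1" if "x \<in> pow2 m" for x
    by (subst sum.swap)
      (simp add: BinStoch_HomD(2)[OF f that] BinStoch_HomD(2)[OF g] flip: sum_distrib_right)
  show "(\<Sum>y\<in>pow2 n. g z y * f y x) = 0" if "z \<notin> pow2 k \<or> x \<notin> pow2 m" for z x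
    using that by (auto intro!: sum.neutral simp: BinStoch_HomD(3)[OF f] BinStoch_HomD(3)[OF g])
qed

lemma TensM_in_Hom:
  assumes f: "f \<in> Hom BinStoch m n" and f': "f' \<in> Hom BinStoch m' n'"
  shows "TensM BinStoch m n m' n' f f' \<in> Hom BinStoch (m + m') (n + n')"
  unfolding BinStoch_TensM
proof (rule BinStoch_HomI)
  show "0 \<le> f (take n y) (take m x) * f' (drop n y) (drop m x)" for y x
    by (intro mult_nonneg_nonneg BinStoch_HomD(1)[OF f] BinStoch_HomD(1)[OF f'])
  show "(\<Sum>y\<in>pow2 (n + n'). f (take n y) (take m x) * f' (drop n y) (drop m x)) = 1"
    if "x \<in> pow2 (m + m')" for x
    using that
    by (simp add: sum_pow2_add[where h = "\<lambda>y z. f y (take m x) * f' z (drop m x)"]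
      BinStoch_HomD(2)[OF f] BinStoch_HomD(2)[OF f'] flip: sum_distrib_left)
  show "f (take n y) (take m x) * f' (drop n y) (drop m x) = 0"
    if "y \<notin> pow2 (n + n') \<or> x \<notin> pow2 (m + m')" for y x
    using that not_pow2_add BinStoch_HomD(3)[OF f] BinStoch_HomD(3)[OF f'] by fastforce
qed

lemma deterministic_in_Hom:
  assumes "\<And>x. x \<in> pow2 m \<Longrightarrow> \<phi> x \<in> pow2 n"
  shows "deterministic m \<phi> \<in> Hom BinStoch m n"
  by (rule BinStoch_HomI) (use assms in \<open>auto simp: deterministic_def\<close>)

text \<open>Precomposing with a deterministic map is substitution. Circuits are built below as a stochastic
  part after a rewiring of the inputs, so this is the form in which composites are computed.\<close>

lemma Comp_deterministic_right:
  assumes "\<And>x. x \<in> pow2 m \<Longrightarrow> \<phi> x \<in> pow2 n"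
  shows "Comp BinStoch m n k f (deterministic m \<phi>) = (\<lambda>z x. if x \<in> pow2 m then f z (\<phi> x) else 0)"
  using assms by (auto simp: BinStoch_Comp deterministic_def fun_eq_iff if_distrib sum.delta cong: if_cong)

lemma Comp_deterministic:
  assumes "\<And>x. x \<in> pow2 m \<Longrightarrow> \<phi> x \<in> pow2 n"
  shows "Comp BinStoch m n k (deterministic n \<psi>) (deterministic m \<phi>) = deterministic m (\<lambda>x. \<psi> (\<phi> x))"
  by (subst Comp_deterministic_right[OF assms]) (use assms in \<open>auto simp: deterministic_def fun_eq_iff\<close>)

lemma TensM_deterministic:
  assumes "\<And>x. x \<in> pow2 m \<Longrightarrow> \<phi> x \<in> pow2 n" "\<And>x. x \<in> pow2 m' \<Longrightarrow> \<psi> x \<in> pow2 n'"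
  shows "TensM BinStoch m n m' n' (deterministic m \<phi>) (deterministic m' \<psi>) =
    deterministic (m + m') (\<lambda>x. \<phi> (take m x) @ \<psi> (drop m x))"
proof -
  have *: "w = y @ z \<longleftrightarrow> take n w = y \<and> drop n w = z" if "y \<in> pow2 n" for w y z
    using that by (metis append_take_drop_id take_drop_append_pow2)
  have "x \<in> pow2 (m + m') \<longleftrightarrow> take m x \<in> pow2 m \<and> drop m x \<in> pow2 m'" for x :: "bool list"
    using not_pow2_add take_drop_pow2 by blast
  then show ?thesis
    using assms by (auto simp: BinStoch_TensM deterministic_def fun_eq_iff * simp del: take_append drop_append)
qed


section \<open>Circuits generate all stochastic matrices\<close>

lemma causal_sig_simps [simp]:
  "ar causal_sig Del = 1" "ar causal_sig Copy = 1" "ar causal_sig And = 2" "ar causal_sig Not = 1"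
  "ar causal_sig (Prob p) = 0"
  "coar causal_sig Del = 0" "coar causal_sig Copy = 2" "coar causal_sig And = 1"
  "coar causal_sig Not = 1" "coar causal_sig (Prob p) = 1"
  "Del \<in> gens causal_sig" "Copy \<in> gens causal_sig" "And \<in> gens causal_sig" "Not \<in> gens causal_sig"
  "Prob p \<in> gens causal_sig \<longleftrightarrow> 0 \<le> p \<and> p \<le> 1"
  by (auto simp: causal_sig_def)

lemma interp_in_Hom:
  assumes "well_formed causal_sig t"
  shows "interp t \<in> Hom BinStoch (src causal_sig t) (tgt causal_sig t)"
  using assms
proof (induction t)
  case (Gen g)
  show ?case
  proof (cases g)
    case (Prob p)
    with Gen show ?thesis
      by (auto intro!: BinStoch_HomI simp: sum_pow2_Suc) (auto simp: pow2_def)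
  qed (auto intro!: deterministic_in_Hom simp: pow2_def)
next
  case Wire
  show ?case by (auto simp: BinStoch_Idn intro!: deterministic_in_Hom)
next
  case Swap
  show ?case by (auto intro!: deterministic_in_Hom simp: pow2_def)
next
  case Void
  show ?case by (auto simp: BinStoch_Idn intro!: deterministic_in_Hom)
next
  case (Seq s t)
  then show ?case by (auto intro!: Comp_in_Hom)
next
  case (Par s t)
  then show ?case by (auto intro!: TensM_in_Hom)
qed

definition definable :: "nat \<Rightarrow> nat \<Rightarrow> (bool list \<Rightarrow> bool list \<Rightarrow> real) \<Rightarrow> bool" where
  "definable m n f \<longleftrightarrow> (\<exists>t. typed causal_sig t m n \<and> interp t = f)"

lemma definableI: "well_formed causal_sig t \<Longrightarrow> src causal_sig t = m \<Longrightarrow> tgt causal_sig t = n \<Longrightarrow>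
    interp t = f \<Longrightarrow> definable m n f"
  by (auto simp: definable_def typed_def)

lemma definable_in_Hom: "definable m n f \<Longrightarrow> f \<in> Hom BinStoch m n"
  using interp_in_Hom by (auto simp: definable_def typed_def)

lemma definable_Comp: "definable m n f \<Longrightarrow> definable n k g \<Longrightarrow> definable m k (Comp BinStoch m n k g f)"
  unfolding definable_def typed_def
  by (elim exE conjE, rule_tac x = "t \<^bold>; ta" in exI) auto

lemma definable_TensM: "definable m n f \<Longrightarrow> definable m' n' f' \<Longrightarrow>
    definable (m + m') (n + n') (TensM BinStoch m n m' n' f f')"
  unfolding definable_def typed_def
  by (elim exE conjE, rule_tac x = "t \<^bold>\<otimes> ta" in exI) auto

text \<open>A deterministic map is given by a function on all lists, but only its values on lists of the right
  length matter. Bundling definability with the range condition lets maps be composed without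
  restating it.\<close>

definition definable_map :: "nat \<Rightarrow> nat \<Rightarrow> (bool list \<Rightarrow> bool list) \<Rightarrow> bool" where
  "definable_map m n \<phi> \<longleftrightarrow> definable m n (deterministic m \<phi>) \<and> (\<forall>x\<in>pow2 m. \<phi> x \<in> pow2 n)"

lemma definable_map_cong:
  assumes "definable_map m n \<phi>" "\<And>x. length x = m \<Longrightarrow> \<phi> x = \<psi> x"
  shows "definable_map m n \<psi>"
proof -
  have "deterministic m \<phi> = deterministic m \<psi>"
    using assms(2) by (auto simp: deterministic_def fun_eq_iff pow2_def)
  then show ?thesis using assms by (auto simp: definable_map_def pow2_def)
qed

lemma definable_map_comp:
  assumes "definable_map m n \<phi>" "definable_map n k \<psi>"
  shows "definable_map m k (\<lambda>x. \<psi> (\<phi> x))"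
  using assms definable_Comp[of m n "deterministic m \<phi>" k "deterministic n \<psi>"]
  by (auto simp: definable_map_def Comp_deterministic)

lemma definable_map_tens:
  assumes "definable_map m n \<phi>" "definable_map m' n' \<psi>"
  shows "definable_map (m + m') (n + n') (\<lambda>x. \<phi> (take m x) @ \<psi> (drop m x))"
  using assms definable_TensM[of m n "deterministic m \<phi>" m' n' "deterministic m' \<psi>"]
  by (auto simp: definable_map_def TensM_deterministic)

lemma definable_map_gen:
  "definable_map 1 0 (\<lambda>x. [])"
  "definable_map 1 2 (\<lambda>x. [x ! 0, x ! 0])"
  "definable_map 2 1 (\<lambda>x. [x ! 0 \<and> x ! 1])"
  "definable_map 1 1 (\<lambda>x. [\<not> x ! 0])"
  "definable_map 2 2 (\<lambda>x. [x ! 1, x ! 0])"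
  "definable_map 1 1 (\<lambda>x. x)"
  "definable_map 0 0 (\<lambda>x. x)"
  unfolding definable_map_def
  by (auto intro: definableI[of "Gen Del"] definableI[of "Gen Copy"] definableI[of "Gen And"]
      definableI[of "Gen Not"] definableI[of Swap] definableI[of Wire] definableI[of Void]
      simp: BinStoch_Idn pow2_def)

lemma definable_map_id: "definable_map n n (\<lambda>x. x)"
proof (induction n)
  case (Suc n)
  show ?case using definable_map_tens[OF definable_map_gen(6) Suc] by simp
qed (rule definable_map_gen)

lemma definable_map_delete: "definable_map n 0 (\<lambda>x. [])"
proof (induction n)
  case 0
  show ?case by (rule definable_map_cong[OF definable_map_gen(7)]) simp
next
  case (Suc n)
  show ?case using definable_map_tens[OF definable_map_gen(1) Suc] by simp
qed

lemma definable_map_rotate: "definable_map (Suc n) (Suc n) (\<lambda>x. tl x @ [hd x])"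
proof (induction n)
  case 0
  show ?case
    by (rule definable_map_cong[OF definable_map_gen(6)[simplified]]) (auto simp: length_Suc_conv)
next
  case (Suc n)
  show ?case
    using definable_map_comp[OF
      definable_map_tens[OF definable_map_gen(5) definable_map_id[of n], unfolded add_2_eq_Suc]
      definable_map_tens[OF definable_map_gen(6) Suc, unfolded plus_1_eq_Suc]]
    by (rule definable_map_cong) (auto simp: length_Suc_conv)
qed

text \<open>The generators copy a single bit. To copy \<open>n + 1\<close> bits, the first bit and the other bits are
  copied separately, and the second copy of the first bit is moved past the first copy of the others.\<close>

lemma definable_map_copy: "definable_map n (n + n) (\<lambda>x. x @ x)"
proof (induction n)
  case 0
  show ?case by simp (rule definable_map_cong[OF definable_map_gen(7)], simp)
next
  case (Suc n)
  have *: "definable_map (Suc n) (2 + (n + n)) (\<lambda>x. [hd x, hd x] @ tl x @ tl x)"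
    using definable_map_tens[OF definable_map_gen(2) Suc]
    by (auto elim!: definable_map_cong simp: length_Suc_conv)
  have "definable_map (1 + (Suc n + n)) (1 + (Suc n + n))
      (\<lambda>x. take 1 x @ (\<lambda>x. (\<lambda>x. tl x @ [hd x]) (take (Suc n) x) @ drop (Suc n) x) (drop 1 x))"
    by (intro definable_map_tens definable_map_gen definable_map_rotate definable_map_id)
  then have **: "definable_map (2 + (n + n)) (Suc n + Suc n)
      (\<lambda>x. take 1 x @ (\<lambda>x. (\<lambda>x. tl x @ [hd x]) (take (Suc n) x) @ drop (Suc n) x) (drop 1 x))"
    by (simp add: algebra_simps)
  show ?case
    using definable_map_comp[OF * **]
    by (rule definable_map_cong) (auto simp: length_Suc_conv)
qed

lemma definable_map_pair:
  assumes "definable_map m n \<phi>" "definable_map m k \<psi>"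
  shows "definable_map m (n + k) (\<lambda>x. \<phi> x @ \<psi> x)"
  using definable_map_comp[OF definable_map_copy definable_map_tens[OF assms]]
  by (rule definable_map_cong) auto

text \<open>Every rearrangement of the inputs that may repeat or drop bits is a circuit. This hides all
  bookkeeping with copies, deletions and symmetries in the constructions that follow.\<close>

lemma definable_map_wires:
  assumes "\<forall>i\<in>set is. i < m"
  shows "definable_map m (length is) (\<lambda>x. map ((!) x) is)"
  using assms
proof (induction "is")
  case Nil
  show ?case using definable_map_delete by simp
next
  case (Cons i "is")
  then obtain k where m: "m = i + (1 + k)"
    by (metis add.assoc less_iff_Suc_add list.set_intros(1) plus_1_eq_Suc add_Suc_right)
  have "definable_map m 1 (\<lambda>x. [x ! i])"
    using definable_map_tens[OF definable_map_delete[of i]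
      definable_map_tens[OF definable_map_gen(6) definable_map_delete[of k]], folded m, simplified]
    by (auto elim!: definable_map_cong simp: m take_Suc hd_drop_conv_nth)
  then show ?case
    using definable_map_pair Cons by fastforce
qed

lemma definable_precompose:
  assumes "definable_map m n \<phi>" "definable n k f"
  shows "definable m k (\<lambda>z x. if x \<in> pow2 m then f z (\<phi> x) else 0)"
  using assms definable_Comp[of m n "deterministic m \<phi>" k f]
  by (auto simp: definable_map_def Comp_deterministic_right)

lemma definable_pair:
  assumes f: "definable m n f" and g: "definable m k g"
  shows "definable m (n + k) (\<lambda>w x. f (take n w) x * g (drop n w) x)"
proof -
  have "(\<lambda>w x. if x \<in> pow2 m then TensM BinStoch m n m k f g w (x @ x) else 0) =
      (\<lambda>w x. f (take n w) x * g (drop n w) x)"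
    using BinStoch_HomD(3)[OF definable_in_Hom[OF f]] by (auto simp: fun_eq_iff BinStoch_TensM simp del: take_append drop_append)
  then show ?thesis
    using definable_precompose[OF definable_map_copy definable_TensM[OF f g]] by simp
qed

text \<open>The chain rule for conditional probabilities: draw \<open>y\<close> from \<open>f(-|x)\<close>, keep copies of \<open>x\<close> and
  \<open>y\<close>, and draw the remaining outputs from \<open>g(-|x,y)\<close>.\<close>

lemma definable_chain:
  assumes f: "definable m n f" and g: "definable (m + n) k g"
  shows "definable m (n + k) (\<lambda>w x. f (take n w) x * g (drop n w) (x @ take n w))"
proof -
  note [simp] = BinStoch_HomD(3)[OF definable_in_Hom[OF f]] BinStoch_HomD(3)[OF definable_in_Hom[OF g]]
  have id: "definable m m (deterministic m (\<lambda>x. x))" for m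
    using definable_map_id by (simp add: definable_map_def)
  let ?h = "\<lambda>u x. deterministic m (\<lambda>x. x) (take m u) x * f (drop m u) x"
  have "\<forall>i\<in>set ([m..<m + n] @ [0..<m + n]). i < m + n" by auto
  note definable_map_wires[OF this]
  moreover have "map ((!) x) ([m..<m + n] @ [0..<m + n]) = drop m x @ x" if "length x = m + n" for x :: "bool list"
    using that by (auto intro!: nth_equalityI simp: nth_append)
  ultimately have wires: "definable_map (m + n) (n + (m + n)) (\<lambda>x. drop m x @ x)"
    by (auto elim!: definable_map_cong)
  let ?g = "\<lambda>w u. if u \<in> pow2 (m + n) then
    TensM BinStoch n n (m + n) k (deterministic n (\<lambda>x. x)) g w (drop m u @ u) else 0"
  have *: "definable m (n + k) (Comp BinStoch m (m + n) (n + k) ?g ?h)"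
    by (intro definable_Comp definable_pair definable_precompose[OF wires] definable_TensM f g id)
  have "Comp BinStoch m (m + n) (n + k) ?g ?h w x = f (take n w) x * g (drop n w) (x @ take n w)" for w x
  proof (cases "x \<in> pow2 m \<and> take n w \<in> pow2 n")
    case True
    have "?g w u * ?h u x = (if u = x @ take n w then f (take n w) x * g (drop n w) (x @ take n w) else 0)"
      if "u \<in> pow2 (m + n)" for u
    proof -
      have u: "drop m u \<in> pow2 n" "take n (drop m u @ u) = drop m u" "drop n (drop m u @ u) = u"
        using that by (auto simp: pow2_def)
      have "u = x @ take n w \<longleftrightarrow> take m u = x \<and> drop m u = take n w"
        using True by (metis append_take_drop_id take_drop_append_pow2)
      then show ?thesis
        using True u(1)
        by (cases "u = x @ take n w")
          (auto simp: that BinStoch_TensM u(2,3) deterministic_def simp del: take_append drop_append)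
    qed
    then have "Comp BinStoch m (m + n) (n + k) ?g ?h w x =
        (\<Sum>u\<in>pow2 (m + n). if u = x @ take n w then f (take n w) x * g (drop n w) (x @ take n w) else 0)"
      by (simp add: BinStoch_Comp cong: sum.cong)
    also have "\<dots> = f (take n w) x * g (drop n w) (x @ take n w)"
      using True by (simp add: sum.delta)
    finally show ?thesis .
  next
    case False
    then have "?g w u * ?h u x = 0" for u
      by (auto simp: BinStoch_TensM deterministic_def)
    then have "Comp BinStoch m (m + n) (n + k) ?g ?h w x = 0"
      unfolding BinStoch_Comp by (intro sum.neutral ballI)
    with False show ?thesis by auto
  qed
  then have "Comp BinStoch m (m + n) (n + k) ?g ?h =
      (\<lambda>w x. f (take n w) x * g (drop n w) (x @ take n w))"
    by (intro ext)
  then show ?thesis using * by (simp only:)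
qed

definition bernoulli :: "nat \<Rightarrow> (bool list \<Rightarrow> real) \<Rightarrow> bool list \<Rightarrow> bool list \<Rightarrow> real" where
  "bernoulli m p y x = (if x \<in> pow2 m then
     if y = [True] then p x else if y = [False] then 1 - p x else 0 else 0)"

text \<open>The multiplexer, as \<open>\<not> (\<not> (b \<and> u) \<and> \<not> (\<not> b \<and> v))\<close>.\<close>

lemma definable_map_mux: "definable_map 3 1 (\<lambda>x. [if x ! 0 then x ! 1 else x ! 2])"
proof -
  note t = definable_map_tens and c = definable_map_comp and g = definable_map_gen
  have a: "definable_map 2 1 (\<lambda>x. [\<not> (x ! 0 \<and> x ! 1)])"
    using c[OF g(3) g(4)] by simp
  have b: "definable_map 2 1 (\<lambda>x. [\<not> (\<not> x ! 0 \<and> x ! 1)])"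
    using c[OF t[OF g(4) g(6), unfolded one_add_one] a]
    by (auto elim!: definable_map_cong simp: numeral_2_eq_2 length_Suc_conv)
  have w: "definable_map 3 4 (\<lambda>x. [x ! 0, x ! 1, x ! 0, x ! 2])"
    using definable_map_wires[of "[0, 1, 0, 2]" 3] by (simp add: numeral_eq_Suc)
  have "definable_map 4 2 (\<lambda>x. [\<not> (x ! 0 \<and> x ! 1), \<not> (\<not> x ! 2 \<and> x ! 3)])"
    using t[OF a b] by (auto elim!: definable_map_cong simp: numeral_eq_Suc length_Suc_conv)
  from c[OF c[OF w this] a] show ?thesis
    by (rule definable_map_cong) (auto simp: numeral_eq_Suc)
qed

text \<open>Induction on the number of input bits: the matrices for both values of the first bit are run on
  independent randomness, and the multiplexer passes on the output of the one that the first bit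
  selects. The marginal distribution of the selected output is the required one. The base case is the
  generator for a biased coin.\<close>

lemma definable_bernoulli:
  assumes "\<And>x. x \<in> pow2 m \<Longrightarrow> 0 \<le> p x \<and> p x \<le> 1"
  shows "definable m 1 (bernoulli m p)"
  using assms
proof (induction m arbitrary: p)
  case 0
  show ?case
    by (rule definableI[of "Gen (Prob (p []))"]) (use 0[of "[]"] in \<open>auto simp: bernoulli_def fun_eq_iff\<close>)
next
  case (Suc m)
  have head: "definable (Suc m) 1 (deterministic (Suc m) (\<lambda>x. [x ! 0]))"
    using definable_map_wires[of "[0]" "Suc m"] by (simp add: definable_map_def)
  have "definable_map (Suc m) m tl"
    using definable_map_wires[of "[1..<Suc m]" "Suc m"]
    by (auto elim!: definable_map_cong intro!: nth_equalityI simp: nth_tl simp del: upt_Suc)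
  note tail = definable_precompose[OF this Suc.IH]
  define B where "B b y x = (if x \<in> pow2 (Suc m) then bernoulli m (\<lambda>x. p (b # x)) y (tl x) else 0)" for b y x
  have branch: "definable (Suc m) 1 (B b)" for b
    unfolding B_def by (rule tail) (use Suc.prems in \<open>auto simp: pow2_def\<close>)
  define u where "u w x = deterministic (Suc m) (\<lambda>x. [x ! 0]) (take 1 w) x *
    (B True (take 1 (drop 1 w)) x * B False (drop 1 (drop 1 w)) x)" for w x
  let ?mux = "deterministic 3 (\<lambda>x. [if x ! 0 then x ! 1 else x ! 2])"
  have "definable (Suc m) (1 + (1 + 1)) u"
    unfolding u_def by (rule definable_pair[OF head definable_pair[OF branch branch]])
  then have u: "definable (Suc m) 3 u" by (simp add: numeral_eq_Suc)
  have mux: "definable 3 1 ?mux"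
    using definable_map_mux unfolding definable_map_def by blast
  have "Comp BinStoch (Suc m) 3 1 ?mux u = bernoulli (Suc m) p"
  proof (intro ext)
    fix y x
    show "Comp BinStoch (Suc m) 3 1 ?mux u y x = bernoulli (Suc m) p y x"
    proof (cases "x \<in> pow2 (Suc m)")
      case True
      then obtain b x' where x: "x = b # x'" and x': "x' \<in> pow2 m"
        by (auto simp: pow2_def length_Suc_conv)
      have B: "B c [d] x = (if d then p (c # x') else 1 - p (c # x'))" for c d
        using True x' by (simp add: B_def bernoulli_def x)
      have u: "u [c, d, e] x = (if c = b then B True [d] x * B False [e] x else 0)" for c d e
        using True by (auto simp: u_def deterministic_def x)
      have px: "p x = p (b # x')" by (simp add: x)
      have "Comp BinStoch (Suc m) 3 1 ?mux u y x =
          (\<Sum>w\<in>pow2 3. (if y = [if w ! 0 then w ! 1 else w ! 2] then 1 else 0) * u w x)"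
        by (simp add: BinStoch_Comp deterministic_def cong: sum.cong)
      also have "\<dots> = (\<Sum>d\<in>UNIV. \<Sum>e\<in>UNIV. if y = [if b then d else e] then B True [d] x * B False [e] x else 0)"
        by (cases b) (simp_all add: numeral_3_eq_3 sum_pow2_Suc u UNIV_bool)
      also have "\<dots> = bernoulli (Suc m) p y x"
        using True px by (cases b) (auto simp: B bernoulli_def UNIV_bool algebra_simps)
      finally show ?thesis .
    next
      case False
      then show ?thesis by (simp add: BinStoch_Comp bernoulli_def u_def B_def)
    qed
  qed
  with definable_Comp[OF u mux] show ?case by simp
qed

text \<open>Induction on the number of output bits, splitting off the last one by the chain rule.\<close>

theorem BinStoch_definable:
  assumes "f \<in> Hom BinStoch m n"
  shows "definable m n f"
  using assms
proof (induction n arbitrary: f)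
  case 0
  have "f = deterministic m (\<lambda>x. [])"
    using BinStoch_HomD(2,3)[OF 0] by (fastforce simp: deterministic_def fun_eq_iff)
  then show ?case using definable_map_delete by (simp add: definable_map_def)
next
  case (Suc n)
  note f = BinStoch_HomD[OF Suc.prems]
  \<comment> \<open>The marginal on the first \<open>n\<close> outputs. In the conditional probability \<open>?p\<close> of the last
    output, the value \<open>0\<close> of a division by \<open>0\<close> does no harm: there the marginal, and so \<open>f\<close>, vanishes.\<close>
  define f' where "f' y x = f (y @ [True]) x + f (y @ [False]) x" for y x
  let ?p = "\<lambda>u. f (drop m u @ [True]) (take m u) / f' (drop m u) (take m u)"
  have snoc: "y @ [b] \<in> pow2 (Suc n) \<longleftrightarrow> y \<in> pow2 n" for y b by (auto simp: pow2_def)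
  have "f' \<in> Hom BinStoch m n"
  proof (rule BinStoch_HomI)
    show "0 \<le> f' y x" for y x using f(1) by (auto simp: f'_def)
    show "f' y x = 0" if "y \<notin> pow2 n \<or> x \<notin> pow2 m" for y x
      using that f(3) snoc unfolding f'_def by (metis add_0)
    show "(\<Sum>y\<in>pow2 n. f' y x) = 1" if "x \<in> pow2 m" for x
    proof -
      have "(\<Sum>y\<in>pow2 n. f' y x) = (\<Sum>y\<in>pow2 n. \<Sum>z\<in>pow2 1. f (y @ z) x)"
        by (simp add: f'_def sum_pow2_Suc)
      also have "\<dots> = 1"
        using f(2)[OF that] by (simp flip: sum_pow2_add[where h = "\<lambda>y z. f (y @ z) x"])
      finally show ?thesis .
    qed
  qed
  then have "definable m n f'" by (rule Suc.IH)
  moreover have "definable (m + n) 1 (bernoulli (m + n) ?p)"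
    by (rule definable_bernoulli) (use f(1) in \<open>auto simp: f'_def divide_le_eq_1 add_nonneg_nonneg add_pos_nonneg less_le\<close>)
  ultimately have "definable m (n + 1)
      (\<lambda>w x. f' (take n w) x * bernoulli (m + n) ?p (drop n w) (x @ take n w))"
    by (rule definable_chain)
  moreover have "f' (take n w) x * bernoulli (m + n) ?p (drop n w) (x @ take n w) = f w x" for w x
  proof (cases "x \<in> pow2 m \<and> w \<in> pow2 (Suc n)")
    case True
    then obtain y b where w: "w = y @ [b]" and y: "y \<in> pow2 n"
      by (cases w rule: rev_cases) (auto simp: pow2_def)
    have "f (y @ [c]) x = 0" if "f' y x = 0" for c
      using that f(1)[of "y @ [True]" x] f(1)[of "y @ [False]" x] by (cases c) (auto simp: f'_def)
    note zero = this
    have xy: "x @ y \<in> pow2 (m + n)" "take n w = y" "drop n w = [b]" "drop m (x @ y) = y" "take m (x @ y) = x"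
      using True y by (auto simp: w pow2_def)
    have fw: "f w x = f (y @ [b]) x" by (simp add: w)
    show ?thesis
    proof (cases "f' y x = 0")
      case True
      then show ?thesis using zero[OF True] by (simp add: xy fw)
    next
      case False
      have "f' y x - f (y @ [True]) x = f (y @ [False]) x" by (simp add: f'_def)
      then show ?thesis
        using False by (cases b) (simp_all add: xy fw bernoulli_def right_diff_distrib del: take_append drop_append)
    qed
  next
    case False
    then have "f w x = 0" using f(3) by blast
    moreover have "f' (take n w) x = 0 \<or> bernoulli (m + n) ?p (drop n w) (x @ take n w) = 0"
    proof (cases "x \<in> pow2 m \<and> take n w \<in> pow2 n")
      case True
      then have "drop n w \<notin> pow2 1" using False not_pow2_add[of w n 1] by auto
      then have "drop n w \<noteq> [True]" "drop n w \<noteq> [False]"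
        by (auto simp: pow2_def dest: arg_cong[where f = length])
      then show ?thesis by (simp add: bernoulli_def)
    next
      case False
      then show ?thesis using BinStoch_HomD(3)[OF \<open>f' \<in> _\<close>] by blast
    qed
    ultimately show ?thesis by auto
  qed
  ultimately show ?case by simp
qed


section \<open>The free category of causal circuits is BinStoch\<close>

lemma typed_unique: "typed S t m n \<Longrightarrow> typed S t m' n' \<Longrightarrow> m' = m \<and> n' = n"
  by (auto simp: typed_def)

lemma typed_term [simp]:
  "typed S (s \<^bold>; t) m k \<longleftrightarrow> (\<exists>n. typed S s m n \<and> typed S t n k)"
  "typed S (s \<^bold>\<otimes> t) a b \<longleftrightarrow>
    (\<exists>m m' n n'. a = m + m' \<and> b = n + n' \<and> typed S s m n \<and> typed S t m' n')"
  "typed S Wire m n \<longleftrightarrow> m = 1 \<and> n = 1"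
  "typed S Swap m n \<longleftrightarrow> m = 2 \<and> n = 2"
  "typed S Void m n \<longleftrightarrow> m = 0 \<and> n = 0"
  by (auto simp: typed_def)

lemma typed_id_term: "typed S (id_term n) n n"
  by (induction n) auto

lemma typed_swap1_term: "typed S (swap1_term n) (Suc n) (Suc n)"
proof (induction n)
  case (Suc n)
  have "typed S (Swap \<^bold>\<otimes> id_term n) (2 + n) (2 + n)" "typed S (Wire \<^bold>\<otimes> swap1_term n) (1 + Suc n) (1 + Suc n)"
    using typed_id_term Suc unfolding typed_term by blast+
  then show ?case by (auto simp del: typed_term(2) simp: typed_term(1))
qed auto

lemma typed_swap_term: "typed S (swap_term m n) (m + n) (n + m)"
proof (induction m)
  case 0
  show ?case using typed_id_term by simp
next
  case (Suc m)
  have "typed S (Wire \<^bold>\<otimes> swap_term m n) (1 + (m + n)) (1 + (n + m))"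
    "typed S (swap1_term n \<^bold>\<otimes> id_term m) (Suc n + m) (Suc n + m)"
    using typed_id_term typed_swap1_term Suc unfolding typed_term by blast+
  then show ?case by (auto simp del: typed_term(2) simp: typed_term(1))
qed

text \<open>The completeness assumption compares terms of the same type, so it applies to provably equal
  terms only once they are known to have the same type.\<close>

lemma smt_eq_typed:
  assumes "smt_eq S E s t" "symmetric_monoidal_theory S E"
  shows "\<exists>m n. typed S s m n \<and> typed S t m n"
  using assms
proof (induction rule: smt_eq.induct)
  case (axiom s t)
  then show ?case by (auto simp: symmetric_monoidal_theory_def)
next
  case (trans s t u)
  then show ?case by (metis typed_unique)
next
  case (seq_cong s s' t t' m n k)
  then have "typed S s' m n" "typed S t' n k" by (metis typed_unique)+
  with seq_cong show ?case by auto
next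
  case (par_cong s s' t t')
  then show ?case by simp blast
next
  case (seq_assoc s m n t k u l)
  then show ?case by auto
next
  case (par_assoc s m n t m' n' u m'' n'')
  then have "typed S ((s \<^bold>\<otimes> t) \<^bold>\<otimes> u) ((m + m') + m'') ((n + n') + n'')"
    "typed S (s \<^bold>\<otimes> (t \<^bold>\<otimes> u)) (m + (m' + m'')) (n + (n' + n''))"
    unfolding typed_term by blast+
  then show ?case by (metis add.assoc)
next
  case (interchange s m n t k s' m' n' t' k')
  then have "typed S ((s \<^bold>; t) \<^bold>\<otimes> (s' \<^bold>; t')) (m + m') (k + k')"
    "typed S ((s \<^bold>\<otimes> s') \<^bold>; (t \<^bold>\<otimes> t')) (m + m') (k + k')"
    unfolding typed_term by blast+
  then show ?case by blast
next
  case (swap_natural s m n t m' n')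
  then have "typed S (s \<^bold>\<otimes> t) (m + m') (n + n')" "typed S (t \<^bold>\<otimes> s) (m' + m) (n' + n)"
    unfolding typed_term by blast+
  then show ?case unfolding typed_term(1) using typed_swap_term by blast
next
  case (swap_involutive m n)
  show ?case unfolding typed_term(1) using typed_swap_term typed_id_term by blast
next
  case (swap_hexagon m m' n)
  have "typed S (id_term m \<^bold>\<otimes> swap_term m' n) (m + (m' + n)) (m + (n + m'))"
    "typed S (swap_term m n \<^bold>\<otimes> id_term m') ((m + n) + m') ((n + m) + m')"
    unfolding typed_term using typed_swap_term typed_id_term by blast+
  moreover have "typed S (swap_term (m + m') n) ((m + m') + n) (n + (m + m'))"
    by (rule typed_swap_term)
  ultimately show ?case unfolding typed_term(1) by (metis add.assoc)
next
  case (seq_id_left t m n)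
  then show ?case unfolding typed_term(1) using typed_id_term by blast
next
  case (seq_id_right t m n)
  then show ?case unfolding typed_term(1) using typed_id_term by blast
next
  case (par_void_left t m n)
  then have "typed S (Void \<^bold>\<otimes> t) (0 + m) (0 + n)" unfolding typed_term by blast
  with par_void_left show ?case by (metis add_0)
next
  case (par_void_right t m n)
  then have "typed S (t \<^bold>\<otimes> Void) (m + 0) (n + 0)" unfolding typed_term by blast
  with par_void_right show ?case by (metis add_0_right)
qed blast+

text \<open>The matrix of a class of terms. The choice of a representative does not matter, as all terms in
  a class have the same interpretation.\<close>

definition sem :: "causal_gen smterm set \<Rightarrow> bool list \<Rightarrow> bool list \<Rightarrow> real" where
  "sem c = interp (SOME t. t \<in> c)"

lemma interp_typed_in_Hom: "typed causal_sig t m n \<Longrightarrow> interp t \<in> Hom BinStoch m n"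
  using interp_in_Hom by (auto simp: typed_def)

lemma interp_id_term: "interp (id_term n) = Idn BinStoch n"
proof (induction n)
  case (Suc n)
  have "src causal_sig (id_term n :: causal_gen smterm) = n" "tgt causal_sig (id_term n :: causal_gen smterm) = n"
    using typed_id_term by (auto simp: typed_def)
  with Suc show ?case
    using TensM_deterministic[of 1 "\<lambda>x. x" 1 n "\<lambda>x. x" n] by (simp add: BinStoch_Idn)
qed auto

lemma UN_class_const:
  assumes "\<And>x y. x \<in> A \<Longrightarrow> y \<in> B \<Longrightarrow> h x y = C" "a \<in> A" "b \<in> B"
  shows "(\<Union>x\<in>A. \<Union>y\<in>B. h x y) = C"
  using assms by blast

locale causal_presentation =
  fixes E :: "(causal_gen smterm \<times> causal_gen smterm) set"
  assumes axioms: "causal_circuit_axioms E"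
begin

abbreviation "\<F> \<equiv> Free causal_sig E"

text \<open>The one place where soundness and completeness of \<open>E\<close> enter: from here on classes of terms are
  handled through their matrices.\<close>

lemma class_iff:
  assumes "typed causal_sig t m n"
  shows "u \<in> term_class causal_sig E t \<longleftrightarrow> typed causal_sig u m n \<and> interp u = interp t"
proof -
  have "typed causal_sig u m n" if "smt_eq causal_sig E t u"
    using smt_eq_typed[OF that] axioms typed_unique[OF assms] unfolding causal_circuit_axioms_def by blast
  moreover have "smt_eq causal_sig E t u \<longleftrightarrow> interp u = interp t" if "typed causal_sig u m n"
    using axioms assms that unfolding causal_circuit_axioms_def by metis
  ultimately show ?thesis unfolding term_class_def by blast
qed

lemma sem_class:
  assumes "typed causal_sig t m n"
  shows "sem (term_class causal_sig E t) = interp t"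
  unfolding sem_def by (rule someI2[of _ t]) (simp_all add: class_iff[OF assms] assms)

lemma class_eq:
  assumes "typed causal_sig s m n" "typed causal_sig t m n" "interp s = interp t"
  shows "term_class causal_sig E s = term_class causal_sig E t"
  by (intro set_eqI) (simp add: class_iff[OF assms(1)] class_iff[OF assms(2)] assms(3))

lemma Free_Hom: "Hom \<F> m n = term_class causal_sig E ` {t. typed causal_sig t m n}"
  by (simp add: Free_def)

lemma sem_in_Hom: "f \<in> Hom \<F> m n \<Longrightarrow> sem f \<in> Hom BinStoch m n"
  by (auto simp: Free_Hom sem_class interp_typed_in_Hom)

lemma sem_inject: "f \<in> Hom \<F> m n \<Longrightarrow> g \<in> Hom \<F> m n \<Longrightarrow> sem f = sem g \<Longrightarrow> f = g"
  unfolding Free_Hom using class_eq sem_class by (elim imageE) (metis mem_Collect_eq)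

lemma sem_surject:
  assumes "f \<in> Hom BinStoch m n"
  obtains c where "c \<in> Hom \<F> m n" "sem c = f"
proof -
  obtain t where "typed causal_sig t m n" "interp t = f"
    using BinStoch_definable[OF assms] unfolding definable_def by blast
  then show ?thesis
    by (intro that[of "term_class causal_sig E t"]) (simp_all add: Free_Hom sem_class)
qed

lemma sem_Idn: "Idn \<F> n \<in> Hom \<F> n n" "sem (Idn \<F> n) = deterministic n (\<lambda>x. x)"
  using sem_class[OF typed_id_term] typed_id_term
  by (auto simp: Free_def interp_id_term BinStoch_Idn)

lemma
  assumes f: "f \<in> Hom \<F> m n" and g: "g \<in> Hom \<F> n k"
  shows Free_Comp_in_Hom: "Comp \<F> m n k g f \<in> Hom \<F> m k" (is ?A)
    and sem_Comp: "sem (Comp \<F> m n k g f) = Comp BinStoch m n k (sem g) (sem f)" (is ?B)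
proof -
  obtain s where s: "typed causal_sig s m n" "f = term_class causal_sig E s"
    using f by (auto simp: Free_Hom)
  obtain t where t: "typed causal_sig t n k" "g = term_class causal_sig E t"
    using g by (auto simp: Free_Hom)
  have st: "typed causal_sig (s \<^bold>; t) m k" using s t by auto
  have eq: "term_class causal_sig E (s' \<^bold>; t') = term_class causal_sig E (s \<^bold>; t)" if "s' \<in> f" "t' \<in> g" for s' t'
    using that s t by (intro class_eq[OF _ st]) (auto simp: class_iff typed_def)
  have "s \<in> f" "t \<in> g" using s t by (auto simp: class_iff)
  then have *: "Comp \<F> m n k g f = term_class causal_sig E (s \<^bold>; t)"
    using UN_class_const[OF eq] by (simp add: Free_def)
  show ?A unfolding * Free_Hom by (rule imageI) (rule CollectI, rule st)
  show ?B
    unfolding * unfolding sem_class[OF st] s(2) t(2) sem_class[OF s(1)] sem_class[OF t(1)]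
    using s(1) t(1) by (simp add: typed_def)
qed

lemma
  assumes f: "f \<in> Hom \<F> m n" and g: "g \<in> Hom \<F> m' n'"
  shows Free_TensM_in_Hom: "TensM \<F> m n m' n' f g \<in> Hom \<F> (m + m') (n + n')" (is ?A)
    and sem_TensM: "sem (TensM \<F> m n m' n' f g) = TensM BinStoch m n m' n' (sem f) (sem g)" (is ?B)
proof -
  obtain s where s: "typed causal_sig s m n" "f = term_class causal_sig E s"
    using f by (auto simp: Free_Hom)
  obtain t where t: "typed causal_sig t m' n'" "g = term_class causal_sig E t"
    using g by (auto simp: Free_Hom)
  have st: "typed causal_sig (s \<^bold>\<otimes> t) (m + m') (n + n')" using s t by auto
  have eq: "term_class causal_sig E (s' \<^bold>\<otimes> t') = term_class causal_sig E (s \<^bold>\<otimes> t)" if "s' \<in> f" "t' \<in> g" for s' t'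
    using that s t by (intro class_eq[OF _ st]) (auto simp: class_iff typed_def)
  have "s \<in> f" "t \<in> g" using s t by (auto simp: class_iff)
  then have *: "TensM \<F> m n m' n' f g = term_class causal_sig E (s \<^bold>\<otimes> t)"
    using UN_class_const[OF eq] by (simp add: Free_def)
  show ?A unfolding * Free_Hom by (rule imageI) (rule CollectI, rule st)
  show ?B
    unfolding * unfolding sem_class[OF st] s(2) t(2) sem_class[OF s(1)] sem_class[OF t(1)]
    using s(1) t(1) by (simp add: typed_def)
qed

lemma del_Free: "del \<F> n \<in> Hom \<F> n 0" "sem (del \<F> n) = deterministic n (\<lambda>x. [])"
proof -
  have unique: "f = deterministic n (\<lambda>x. [])" if "f \<in> Hom BinStoch n 0" for f
    using BinStoch_HomD(2,3)[OF that] by (fastforce simp: deterministic_def fun_eq_iff)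
  have "deterministic n (\<lambda>x. []) \<in> Hom BinStoch n 0" by (rule deterministic_in_Hom) simp
  then obtain c where c: "c \<in> Hom \<F> n 0" "sem c = deterministic n (\<lambda>x. [])"
    by (rule sem_surject)
  have "del \<F> n = c"
    unfolding del_def
  proof (rule the_equality)
    have unit: "Unt \<F> = 0" by (simp add: Free_def)
    show "c \<in> Hom \<F> n (Unt \<F>)" unfolding unit by (rule c(1))
    show "f = c" if "f \<in> Hom \<F> n (Unt \<F>)" for f
    proof -
      have f: "f \<in> Hom \<F> n 0" using that unfolding unit .
      show ?thesis
        by (rule sem_inject[OF f c(1)]) (simp only: unique[OF sem_in_Hom[OF f]] c(2))
    qed
  qed
  with c show "del \<F> n \<in> Hom \<F> n 0" "sem (del \<F> n) = deterministic n (\<lambda>x. [])" by auto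
qed

end


section \<open>Locally constant functions and clopen sets\<close>

lemma locally_constantD:
  assumes "locally_constant X h" "x \<in> topspace X"
  obtains V where "openin X V" "x \<in> V" "\<And>x'. x' \<in> V \<Longrightarrow> h x = h x'"
proof -
  have "\<exists>V. openin X V \<and> x \<in> V \<and> (\<forall>x'\<in>V. h x' = h x)"
    using assms unfolding locally_constant_def by (rule bspec)
  then show ?thesis by (elim exE conjE) (rule that, assumption+, metis)
qed

lemma locally_constant_const: "locally_constant X (\<lambda>_. c)"
  unfolding locally_constant_def by (metis openin_topspace)

lemma locally_constant_compose:
  assumes "locally_constant X h"
  shows "locally_constant X (\<lambda>x. F (h x))"
  unfolding locally_constant_def
proof
  fix x assume "x \<in> topspace X"
  then obtain V where V: "openin X V" "x \<in> V" "\<And>x'. x' \<in> V \<Longrightarrow> h x = h x'"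
    by (rule locally_constantD[OF assms]) (rule that)
  then show "\<exists>V. openin X V \<and> x \<in> V \<and> (\<forall>x'\<in>V. F (h x') = F (h x))"
    by (metis (no_types))
qed

lemma locally_constant_cong:
  assumes "locally_constant X h" "\<And>x. x \<in> topspace X \<Longrightarrow> h' x = h x"
  shows "locally_constant X h'"
  unfolding locally_constant_def
proof
  fix x assume x: "x \<in> topspace X"
  obtain V where V: "openin X V" "x \<in> V" "\<And>x'. x' \<in> V \<Longrightarrow> h x = h x'"
    by (rule locally_constantD[OF assms(1) x]) (rule that)
  have "h' x' = h' x" if "x' \<in> V" for x'
    using that x assms(2)[of x] assms(2)[of x'] openin_subset[OF V(1)] V(3)[OF that] by auto
  with V show "\<exists>V. openin X V \<and> x \<in> V \<and> (\<forall>x'\<in>V. h' x' = h' x)" by blast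
qed

lemma locally_constant_Pair:
  assumes "locally_constant X h" "locally_constant X k"
  shows "locally_constant X (\<lambda>x. (h x, k x))"
  unfolding locally_constant_def
proof
  fix x assume x: "x \<in> topspace X"
  obtain V where V: "openin X V" "x \<in> V" "\<And>x'. x' \<in> V \<Longrightarrow> h x = h x'"
    by (rule locally_constantD[OF assms(1) x]) (rule that)
  obtain W where W: "openin X W" "x \<in> W" "\<And>x'. x' \<in> W \<Longrightarrow> k x = k x'"
    by (rule locally_constantD[OF assms(2) x]) (rule that)
  show "\<exists>V. openin X V \<and> x \<in> V \<and> (\<forall>x'\<in>V. (h x', k x') = (h x, k x))"
  proof (intro exI[of _ "V \<inter> W"] conjI ballI)
    show "(h x', k x') = (h x, k x)" if "x' \<in> V \<inter> W" for x'
      using that V(3)[of x'] W(3)[of x'] by simp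
  qed (use V W in auto)
qed

text \<open>A finite family of locally constant functions is one locally constant function into a function
  space. Its level sets give a partition on which all members are constant at once.\<close>

lemma locally_constant_family:
  assumes "finite I" "\<And>i. i \<in> I \<Longrightarrow> locally_constant X (h i)"
  shows "locally_constant X (\<lambda>x. \<lambda>i\<in>I. h i x)"
  using assms
proof (induction I rule: finite_induct)
  case empty
  show ?case by (rule locally_constant_cong[OF locally_constant_const]) auto
next
  case (insert j I)
  let ?F = "\<lambda>(v, w). \<lambda>i\<in>insert j I. if i = j then v else w i"
  have "locally_constant X (\<lambda>x. (h j x, \<lambda>i\<in>I. h i x))"
    by (rule locally_constant_Pair[OF insert.prems insert.IH[OF insert.prems]]) simp_all
  from locally_constant_compose[OF this, of ?F] show ?case
    by (rule locally_constant_cong) (use insert.hyps in \<open>auto simp: restrict_def fun_eq_iff\<close>)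
qed

lemma locally_constant_openin:
  assumes "locally_constant X h"
  shows "openin X {x \<in> topspace X. h x \<in> B}"
proof (subst openin_subopen, intro ballI)
  fix x assume x: "x \<in> {x \<in> topspace X. h x \<in> B}"
  then have "x \<in> topspace X" by simp
  then obtain V where V: "openin X V" "x \<in> V" "\<And>x'. x' \<in> V \<Longrightarrow> h x = h x'"
    by (rule locally_constantD[OF assms]) (rule that)
  then show "\<exists>T. openin X T \<and> x \<in> T \<and> T \<subseteq> {x \<in> topspace X. h x \<in> B}"
  proof (intro exI[of _ V] conjI subsetI)
    show "x' \<in> {x \<in> topspace X. h x \<in> B}" if "x' \<in> V" for x'
      using that x V(3)[OF that] openin_subset[OF V(1)] by auto
  qed
qed

lemma locally_constant_Clopen:
  assumes "locally_constant X h"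
  shows "{x \<in> topspace X. h x \<in> B} \<in> Clopen X"
proof -
  have "topspace X - {x \<in> topspace X. h x \<in> B} = {x \<in> topspace X. h x \<in> - B}" by auto
  then show ?thesis
    using locally_constant_openin[OF assms, of B] locally_constant_openin[OF assms, of "- B"]
    by (auto simp: Clopen_def closedin_def)
qed

lemma locally_constant_level_Clopen:
  "locally_constant X h \<Longrightarrow> {x \<in> topspace X. h x = b} \<in> Clopen X"
  using locally_constant_Clopen[of X h "{b}"] by simp

lemma Clopen_iff_locally_constant:
  "U \<in> Clopen X \<longleftrightarrow> U \<subseteq> topspace X \<and> locally_constant X (\<lambda>x. x \<in> U)"
proof (intro iffI conjI)
  assume U: "U \<in> Clopen X"
  then show "U \<subseteq> topspace X" by (auto simp: Clopen_def dest: openin_subset)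
  have "openin X U" "openin X (topspace X - U)" using U by (auto simp: Clopen_def)
  then show "locally_constant X (\<lambda>x. x \<in> U)"
    unfolding locally_constant_def
  proof (intro ballI)
    fix x assume "x \<in> topspace X"
    with \<open>openin X U\<close> \<open>openin X (topspace X - U)\<close>
    show "\<exists>V. openin X V \<and> x \<in> V \<and> (\<forall>x'\<in>V. (x' \<in> U) = (x \<in> U))"
      by (cases "x \<in> U") (auto intro: exI[of _ U] exI[of _ "topspace X - U"])
  qed
next
  assume "U \<subseteq> topspace X \<and> locally_constant X (\<lambda>x. x \<in> U)"
  then show "U \<in> Clopen X"
    using locally_constant_level_Clopen[of X "\<lambda>x. x \<in> U" True] by (simp add: Collect_conj_eq Int_absorb1)
qed

text \<open>The level sets are open and disjoint, so a finite subcover uses all nonempty ones.\<close>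

lemma locally_constant_finite_range:
  assumes "compact_space X" "locally_constant X h"
  shows "finite (h ` topspace X)"
proof -
  let ?L = "\<lambda>b. {x \<in> topspace X. h x = b}"
  have "openin X U" if "U \<in> ?L ` h ` topspace X" for U
    using that locally_constant_level_Clopen[OF assms(2)] by (auto simp: Clopen_def)
  then have "(\<forall>U\<in>?L ` h ` topspace X. openin X U) \<and> topspace X \<subseteq> \<Union>(?L ` h ` topspace X)"
    by blast
  from mp[OF spec[OF assms(1)[unfolded compact_space_alt]] this]
  obtain \<F> where F: "finite \<F>" "\<F> \<subseteq> ?L ` h ` topspace X" "topspace X \<subseteq> \<Union>\<F>"
    by (elim exE conjE)
  from finite_subset_image[OF F(1,2)] obtain B where B: "finite B" "\<F> = ?L ` B"
    by (elim exE conjE)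
  have "h ` topspace X \<subseteq> B" using F(3) by (auto simp: B(2))
  with B(1) show ?thesis by (rule finite_subset[rotated])
qed

lemma Clopen_subset: "U \<in> Clopen X \<Longrightarrow> U \<subseteq> topspace X"
  by (auto simp: Clopen_def dest: openin_subset)

lemma Clopen_empty [simp]: "{} \<in> Clopen X"
  by (simp add: Clopen_def)

lemma Clopen_topspace [simp]: "topspace X \<in> Clopen X"
  by (simp add: Clopen_def)

lemma Clopen_Un: "U \<in> Clopen X \<Longrightarrow> V \<in> Clopen X \<Longrightarrow> U \<union> V \<in> Clopen X"
  by (auto simp: Clopen_def)

lemma Clopen_Int: "U \<in> Clopen X \<Longrightarrow> V \<in> Clopen X \<Longrightarrow> U \<inter> V \<in> Clopen X"
  by (auto simp: Clopen_def)

lemma Clopen_UN: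
  "finite I \<Longrightarrow> (\<And>i. i \<in> I \<Longrightarrow> A i \<in> Clopen X) \<Longrightarrow> (\<Union>i\<in>I. A i) \<in> Clopen X"
  by (induction I rule: finite_induct) (auto intro: Clopen_Un)

lemma additive_Clopen_empty:
  fixes \<mu> :: "'a set \<Rightarrow> real"
  assumes "additive (Clopen X) \<mu>"
  shows "\<mu> {} = 0"
proof -
  have "\<mu> ({} \<union> {}) = \<mu> {} + \<mu> {}"
    using assms unfolding additive_def by (elim ballE[of _ _ "{}"]) auto
  then show ?thesis by simp
qed

lemma additive_Clopen_UN:
  fixes \<mu> :: "'a set \<Rightarrow> real"
  assumes "additive (Clopen X) \<mu>" "finite I" "\<And>i. i \<in> I \<Longrightarrow> A i \<in> Clopen X"
    "\<And>i j. i \<in> I \<Longrightarrow> j \<in> I \<Longrightarrow> i \<noteq> j \<Longrightarrow> A i \<inter> A j = {}"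
  shows "\<mu> (\<Union>i\<in>I. A i) = (\<Sum>i\<in>I. \<mu> (A i))"
  using assms(2-)
proof (induction I rule: finite_induct)
  case empty
  show ?case using additive_Clopen_empty[OF assms(1)] by simp
next
  case (insert i I)
  have "A i \<inter> (\<Union>j\<in>I. A j) = {}"
    using insert.prems(2) insert.hyps(2) by blast
  moreover have "A i \<in> Clopen X" "(\<Union>j\<in>I. A j) \<in> Clopen X"
    using insert by (auto intro: Clopen_UN)
  ultimately have "\<mu> (A i \<union> (\<Union>j\<in>I. A j)) = \<mu> (A i) + \<mu> (\<Union>j\<in>I. A j)"
    using assms(1) unfolding additive_def by blast
  then show ?case using insert by simp
qed


section \<open>The category of locally constant Markov kernels\<close>

lemma lc_kernelsD:
  assumes "f \<in> lc_kernels X Y"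
  shows "f \<in> extensional (Clopen Y \<times> topspace X)"
    "U \<in> Clopen Y \<Longrightarrow> x \<in> topspace X \<Longrightarrow> 0 \<le> f (U, x)"
    "U \<in> Clopen Y \<Longrightarrow> x \<in> topspace X \<Longrightarrow> f (U, x) \<le> 1"
    "U \<in> Clopen Y \<Longrightarrow> locally_constant X (\<lambda>x. f (U, x))"
    "x \<in> topspace X \<Longrightarrow> additive (Clopen Y) (\<lambda>U. f (U, x))"
    "x \<in> topspace X \<Longrightarrow> f (topspace Y, x) = 1"
  using assms by (auto simp: lc_kernels_def PiE_iff)

lemma partition_refine_sum:
  fixes \<mu> :: "'a set \<Rightarrow> real"
  assumes "additive (Clopen Y) \<mu>" "finite P" "partition_on (topspace Y) P" "P \<subseteq> Clopen Y" "U \<in> Clopen Y"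
  shows "\<mu> U = (\<Sum>V\<in>P. \<mu> (U \<inter> V))"
proof -
  have U: "U = (\<Union>V\<in>P. U \<inter> V)"
    using assms(3) Clopen_subset[OF assms(5)] by (auto simp: partition_on_def)
  have disjoint: "V \<inter> W = {}" if "V \<in> P" "W \<in> P" "V \<noteq> W" for V W
    using disjointD[OF partition_onD2[OF assms(3)] that] .
  have "\<mu> U = \<mu> (\<Union>V\<in>P. U \<inter> V)" using U by simp
  also have "\<dots> = (\<Sum>V\<in>P. \<mu> (U \<inter> V))"
  proof (rule additive_Clopen_UN[OF assms(1,2)])
    show "U \<inter> V \<in> Clopen Y" if "V \<in> P" for V
      using assms(4,5) that by (auto intro: Clopen_Int)
    show "(U \<inter> V) \<inter> (U \<inter> W) = {}" if "V \<in> P" "W \<in> P" "V \<noteq> W" for V W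
      using disjoint[OF that] by blast
  qed
  finally show ?thesis .
qed

text \<open>The integral of a function that is constant on the members of a partition does not depend on the
  partition: both sides equal the sum over the common refinement.\<close>

lemma partition_integral_unique:
  fixes \<mu> :: "'a set \<Rightarrow> real"
  assumes \<mu>: "additive (Clopen Y) \<mu>"
    and P: "finite P" "partition_on (topspace Y) P" "P \<subseteq> Clopen Y" "\<forall>U\<in>P. \<forall>y\<in>U. h y = c U"
    and Q: "finite Q" "partition_on (topspace Y) Q" "Q \<subseteq> Clopen Y" "\<forall>U\<in>Q. \<forall>y\<in>U. h y = d U"
  shows "(\<Sum>U\<in>P. c U * \<mu> U) = (\<Sum>V\<in>Q. d V * \<mu> V)"
proof -
  have "(\<Sum>U\<in>P. c U * \<mu> U) = (\<Sum>U\<in>P. \<Sum>V\<in>Q. c U * \<mu> (U \<inter> V))"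
    using partition_refine_sum[OF \<mu> Q(1-3)] P(3) by (auto simp: sum_distrib_left intro!: sum.cong)
  also have "\<dots> = (\<Sum>U\<in>P. \<Sum>V\<in>Q. d V * \<mu> (V \<inter> U))"
  proof (intro sum.cong[OF HOL.refl])
    fix U V assume UV: "U \<in> P" "V \<in> Q"
    show "c U * \<mu> (U \<inter> V) = d V * \<mu> (V \<inter> U)"
    proof (cases "U \<inter> V = {}")
      case True
      then show ?thesis using additive_Clopen_empty[OF \<mu>] by (simp add: Int_commute)
    next
      case False
      then show ?thesis using P(4) Q(4) UV by (metis IntE Int_commute ex_in_conv)
    qed
  qed
  also have "\<dots> = (\<Sum>V\<in>Q. \<Sum>U\<in>P. d V * \<mu> (V \<inter> U))" by (rule sum.swap)
  also have "\<dots> = (\<Sum>V\<in>Q. d V * \<mu> V)"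
    using partition_refine_sum[OF \<mu> P(1-3)] Q(3) by (auto simp: sum_distrib_left intro!: sum.cong)
  finally show ?thesis .
qed

lemma StoneStoch_Comp_partition:
  assumes f: "f \<in> lc_kernels X Y" and "V \<in> Clopen Z" "x \<in> topspace X"
    and P: "finite P" "partition_on (topspace Y) P" "P \<subseteq> Clopen Y" "\<forall>U\<in>P. \<forall>y\<in>U. g (V, y) = c U"
  shows "Comp StoneStoch_lc X Y Z g f (V, x) = (\<Sum>U\<in>P. c U * f (U, x))"
proof -
  have "(THE r. \<exists>P c. finite P \<and> partition_on (topspace Y) P \<and> P \<subseteq> Clopen Y \<and>
          (\<forall>U\<in>P. \<forall>y\<in>U. g (V, y) = c U) \<and> r = (\<Sum>U\<in>P. c U * f (U, x))) = (\<Sum>U\<in>P. c U * f (U, x))"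
  proof (rule the_equality)
    show "\<exists>P' c'. finite P' \<and> partition_on (topspace Y) P' \<and> P' \<subseteq> Clopen Y \<and>
        (\<forall>U\<in>P'. \<forall>y\<in>U. g (V, y) = c' U) \<and> (\<Sum>U\<in>P. c U * f (U, x)) = (\<Sum>U\<in>P'. c' U * f (U, x))"
      using P by blast
  next
    fix r
    assume "\<exists>P c. finite P \<and> partition_on (topspace Y) P \<and> P \<subseteq> Clopen Y \<and>
          (\<forall>U\<in>P. \<forall>y\<in>U. g (V, y) = c U) \<and> r = (\<Sum>U\<in>P. c U * f (U, x))"
    then obtain Q d where Q: "finite Q" "partition_on (topspace Y) Q" "Q \<subseteq> Clopen Y"
        "\<forall>U\<in>Q. \<forall>y\<in>U. g (V, y) = d U" and r: "r = (\<Sum>U\<in>Q. d U * f (U, x))"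
      by blast
    show "r = (\<Sum>U\<in>P. c U * f (U, x))"
      unfolding r
      by (rule partition_integral_unique[OF lc_kernelsD(5)[OF f \<open>x \<in> topspace X\<close>] Q P])
  qed
  then show ?thesis using assms(2,3) by (simp add: StoneStoch_lc_def)
qed

lemma level_partition:
  "partition_on (topspace Y) ((\<lambda>b. {y \<in> topspace Y. H y = b}) ` H ` topspace Y)"
  by (auto simp: partition_on_def disjoint_def)

lemma level_inj_on: "inj_on (\<lambda>b. {y \<in> topspace Y. H y = b}) (H ` topspace Y)"
  by (auto simp: inj_on_def)

text \<open>Composition computed over the level sets of any locally constant \<open>H\<close> through which \<open>g(V|-)\<close>
  factors. Different integrals can be compared term by term by taking one \<open>H\<close> for all of them.\<close>

lemma StoneStoch_Comp_levels:
  assumes Y: "compact_space Y" and f: "f \<in> lc_kernels X Y" and V: "V \<in> Clopen Z" and x: "x \<in> topspace X"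
    and H: "locally_constant Y H" and g: "\<And>y. y \<in> topspace Y \<Longrightarrow> g (V, y) = c (H y)"
  shows "Comp StoneStoch_lc X Y Z g f (V, x) =
    (\<Sum>b\<in>H ` topspace Y. c b * f ({y \<in> topspace Y. H y = b}, x))"
proof -
  let ?L = "\<lambda>b. {y \<in> topspace Y. H y = b}"
  let ?d = "\<lambda>U. c (the_inv_into (H ` topspace Y) ?L U)"
  have inv: "the_inv_into (H ` topspace Y) ?L (?L b) = b" if "b \<in> H ` topspace Y" for b
    using the_inv_into_f_f[OF level_inj_on that] .
  have "Comp StoneStoch_lc X Y Z g f (V, x) = (\<Sum>U\<in>?L ` H ` topspace Y. ?d U * f (U, x))"
  proof (rule StoneStoch_Comp_partition[OF f V x])
    show "finite (?L ` H ` topspace Y)" using locally_constant_finite_range[OF Y H] by simp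
    show "partition_on (topspace Y) (?L ` H ` topspace Y)" by (rule level_partition)
    show "?L ` H ` topspace Y \<subseteq> Clopen Y" using locally_constant_level_Clopen[OF H] by blast
    show "\<forall>U\<in>?L ` H ` topspace Y. \<forall>y\<in>U. g (V, y) = ?d U"
    proof (intro ballI)
      fix U y assume "U \<in> ?L ` H ` topspace Y" "y \<in> U"
      then have "y \<in> topspace Y" "U = ?L (H y)" by auto
      then show "g (V, y) = ?d U" using g inv[of "H y"] by simp
    qed
  qed
  also have "\<dots> = (\<Sum>b\<in>H ` topspace Y. ?d (?L b) * f (?L b, x))"
    by (simp only: sum.reindex[OF level_inj_on] o_def)
  also have "\<dots> = (\<Sum>b\<in>H ` topspace Y. c b * f (?L b, x))"
  proof (rule sum.cong[OF HOL.refl])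
    show "?d (?L b) * f (?L b, x) = c b * f (?L b, x)" if "b \<in> H ` topspace Y" for b
      using inv[OF that] by (simp only:)
  qed
  finally show ?thesis .
qed

lemma lc_kernel_level_sum:
  assumes Y: "compact_space Y" and f: "f \<in> lc_kernels X Y" and x: "x \<in> topspace X"
    and H: "locally_constant Y H"
  shows "(\<Sum>b\<in>H ` topspace Y. f ({y \<in> topspace Y. H y = b}, x)) = 1"
proof -
  have "f (\<Union>b\<in>H ` topspace Y. {y \<in> topspace Y. H y = b}, x) =
      (\<Sum>b\<in>H ` topspace Y. f ({y \<in> topspace Y. H y = b}, x))"
  proof (rule additive_Clopen_UN[OF lc_kernelsD(5)[OF f x] locally_constant_finite_range[OF Y H]])
    show "{y \<in> topspace Y. H y = b} \<in> Clopen Y" for b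
      by (rule locally_constant_level_Clopen[OF H])
  qed blast
  moreover have "(\<Union>b\<in>H ` topspace Y. {y \<in> topspace Y. H y = b}) = topspace Y" by auto
  ultimately show ?thesis using lc_kernelsD(6)[OF f x] by simp
qed

lemma StoneStoch_Comp_in_lc_kernels:
  assumes Y: "compact_space Y" and f: "f \<in> lc_kernels X Y" and g: "g \<in> lc_kernels Y Z"
  shows "Comp StoneStoch_lc X Y Z g f \<in> lc_kernels X Z"
proof -
  let ?C = "Comp StoneStoch_lc X Y Z g f"
  have levels: "?C (V, x) = (\<Sum>b\<in>(\<lambda>y. g (V, y)) ` topspace Y. b * f ({y \<in> topspace Y. g (V, y) = b}, x))"
    if "V \<in> Clopen Z" "x \<in> topspace X" for V x
    by (rule StoneStoch_Comp_levels[OF Y f that lc_kernelsD(4)[OF g that(1)]]) simp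
  have level_Clopen: "{y \<in> topspace Y. g (V, y) = b} \<in> Clopen Y" if "V \<in> Clopen Z" for V b
    by (rule locally_constant_level_Clopen[OF lc_kernelsD(4)[OF g that]])
  have "?C (V, x) \<in> {0..1}" if V: "V \<in> Clopen Z" and x: "x \<in> topspace X" for V x
  proof -
    let ?R = "(\<lambda>y. g (V, y)) ` topspace Y"
    have "0 \<le> ?C (V, x)"
      unfolding levels[OF V x]
      using lc_kernelsD(2)[OF g V] lc_kernelsD(2)[OF f level_Clopen[OF V] x]
      by (intro sum_nonneg mult_nonneg_nonneg) auto
    moreover have "?C (V, x) \<le> (\<Sum>b\<in>?R. f ({y \<in> topspace Y. g (V, y) = b}, x))"
      unfolding levels[OF V x]
      using lc_kernelsD(3)[OF g V] lc_kernelsD(2)[OF f level_Clopen[OF V] x]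
      by (intro sum_mono mult_left_le_one_le) (auto intro: mult_left_le_one_le lc_kernelsD(2)[OF g V])
    ultimately show ?thesis
      using lc_kernel_level_sum[OF Y f x lc_kernelsD(4)[OF g V]] by simp
  qed
  then have "?C \<in> Clopen Z \<times> topspace X \<rightarrow>\<^sub>E {0..1}"
    by (auto simp: PiE_iff extensional_def StoneStoch_lc_def)
  moreover have "locally_constant X (\<lambda>x. ?C (V, x))" if V: "V \<in> Clopen Z" for V
  proof -
    let ?R = "(\<lambda>y. g (V, y)) ` topspace Y" and ?L = "\<lambda>b. {y \<in> topspace Y. g (V, y) = b}"
    have "locally_constant X (\<lambda>x. \<lambda>b\<in>?R. f (?L b, x))"
      by (intro locally_constant_family
          locally_constant_finite_range[OF Y lc_kernelsD(4)[OF g V]] lc_kernelsD(4)[OF f] level_Clopen V)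
    from locally_constant_compose[OF this, of "\<lambda>w. \<Sum>b\<in>?R. b * w b"] show ?thesis
      by (rule locally_constant_cong) (simp add: levels[OF V])
  qed
  moreover have "additive (Clopen Z) (\<lambda>V. ?C (V, x))" if x: "x \<in> topspace X" for x
    unfolding additive_def
  proof (intro ballI impI)
    fix V W assume V: "V \<in> Clopen Z" and W: "W \<in> Clopen Z" and "V \<inter> W = {}"
    then have add: "g (V \<union> W, y) = g (V, y) + g (W, y)" if "y \<in> topspace Y" for y
      using lc_kernelsD(5)[OF g that] by (auto simp: additive_def)
    let ?H = "\<lambda>y. (g (V, y), g (W, y))"
    have H: "locally_constant Y ?H"
      by (intro locally_constant_Pair lc_kernelsD(4)[OF g] V W)
    have "?C (V \<union> W, x) = (\<Sum>b\<in>?H ` topspace Y. (fst b + snd b) * f ({y \<in> topspace Y. ?H y = b}, x))"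
      by (rule StoneStoch_Comp_levels[OF Y f Clopen_Un[OF V W] x H]) (simp add: add)
    moreover have "?C (V, x) = (\<Sum>b\<in>?H ` topspace Y. fst b * f ({y \<in> topspace Y. ?H y = b}, x))"
      by (rule StoneStoch_Comp_levels[OF Y f V x H]) simp
    moreover have "?C (W, x) = (\<Sum>b\<in>?H ` topspace Y. snd b * f ({y \<in> topspace Y. ?H y = b}, x))"
      by (rule StoneStoch_Comp_levels[OF Y f W x H]) simp
    ultimately show "?C (V \<union> W, x) = ?C (V, x) + ?C (W, x)"
      by (simp add: distrib_right sum.distrib)
  qed
  moreover have "?C (topspace Z, x) = 1" if x: "x \<in> topspace X" for x
  proof -
    have "?C (topspace Z, x) = (\<Sum>b\<in>(\<lambda>_. ()) ` topspace Y. 1 * f ({y \<in> topspace Y. () = b}, x))"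
      by (rule StoneStoch_Comp_levels[OF Y f Clopen_topspace x locally_constant_const])
        (rule lc_kernelsD(6)[OF g])
    also have "\<dots> = 1"
      using lc_kernel_level_sum[OF Y f x locally_constant_const[of Y "()"]] by simp
    finally show ?thesis .
  qed
  ultimately show ?thesis by (simp add: lc_kernels_def)
qed

lemma lc_kernels_eqI:
  assumes "f \<in> lc_kernels X Y" "g \<in> lc_kernels X Y"
    "\<And>U x. U \<in> Clopen Y \<Longrightarrow> x \<in> topspace X \<Longrightarrow> f (U, x) = g (U, x)"
  shows "f = g"
  by (rule extensionalityI[OF lc_kernelsD(1)[OF assms(1)] lc_kernelsD(1)[OF assms(2)]])
    (use assms(3) in auto)

lemma StoneStoch_Idn_in_lc_kernels: "Idn StoneStoch_lc X \<in> lc_kernels X X"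
proof -
  have "locally_constant X (\<lambda>x. if x \<in> U then 1 else 0 :: real)" if "U \<in> Clopen X" for U
    using that locally_constant_compose[of X "\<lambda>x. x \<in> U" "\<lambda>b. if b then 1 else 0"]
    by (auto simp: Clopen_iff_locally_constant)
  then have "locally_constant X (\<lambda>x. Idn StoneStoch_lc X (U, x))" if "U \<in> Clopen X" for U
    by (rule locally_constant_cong) (use that in \<open>auto simp: StoneStoch_lc_def\<close>)
  moreover have "additive (Clopen X) (\<lambda>U. Idn StoneStoch_lc X (U, x))" if "x \<in> topspace X" for x
    using that unfolding additive_def by (auto simp: StoneStoch_lc_def Clopen_Un)
  moreover have "Idn StoneStoch_lc X \<in> Clopen X \<times> topspace X \<rightarrow>\<^sub>E {0..1}"
    by (auto simp: StoneStoch_lc_def PiE_iff extensional_def)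
  ultimately show ?thesis
    by (simp add: lc_kernels_def) (simp add: StoneStoch_lc_def)
qed

lemma StoneStoch_Idn_right:
  assumes X: "compact_space X" and f: "f \<in> lc_kernels X Y"
  shows "Comp StoneStoch_lc X X Y f (Idn StoneStoch_lc X) = f"
proof (rule lc_kernels_eqI[OF StoneStoch_Comp_in_lc_kernels[OF X StoneStoch_Idn_in_lc_kernels f] f])
  fix U x assume U: "U \<in> Clopen Y" and x: "x \<in> topspace X"
  let ?H = "\<lambda>x. f (U, x)"
  have "Comp StoneStoch_lc X X Y f (Idn StoneStoch_lc X) (U, x) =
      (\<Sum>b\<in>?H ` topspace X. b * Idn StoneStoch_lc X ({y \<in> topspace X. ?H y = b}, x))"
    by (rule StoneStoch_Comp_levels[OF X StoneStoch_Idn_in_lc_kernels U x lc_kernelsD(4)[OF f U]]) simp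
  also have "\<dots> = (\<Sum>b\<in>?H ` topspace X. if b = ?H x then b else 0)"
    using x locally_constant_level_Clopen[OF lc_kernelsD(4)[OF f U]]
    by (intro sum.cong HOL.refl) (auto simp: StoneStoch_lc_def)
  also have "\<dots> = f (U, x)"
    using x locally_constant_finite_range[OF X lc_kernelsD(4)[OF f U]] by (simp add: sum.delta)
  finally show "Comp StoneStoch_lc X X Y f (Idn StoneStoch_lc X) (U, x) = f (U, x)" .
qed

lemma StoneStoch_Idn_left:
  assumes Y: "compact_space Y" and f: "f \<in> lc_kernels X Y"
  shows "Comp StoneStoch_lc X Y Y (Idn StoneStoch_lc Y) f = f"
proof (rule lc_kernels_eqI[OF StoneStoch_Comp_in_lc_kernels[OF Y f StoneStoch_Idn_in_lc_kernels] f])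
  fix U x assume U: "U \<in> Clopen Y" and x: "x \<in> topspace X"
  let ?H = "\<lambda>y. y \<in> U"
  have H: "locally_constant Y ?H" using U by (simp add: Clopen_iff_locally_constant)
  have level: "{y \<in> topspace Y. y \<in> U} = U" using Clopen_subset[OF U] by auto
  have "Comp StoneStoch_lc X Y Y (Idn StoneStoch_lc Y) f (U, x) =
      (\<Sum>b\<in>?H ` topspace Y. (if b then 1 else 0) * f ({y \<in> topspace Y. ?H y = b}, x))"
    by (rule StoneStoch_Comp_levels[OF Y f U x H]) (use U in \<open>simp add: StoneStoch_lc_def\<close>)
  also have "\<dots> = (\<Sum>b\<in>?H ` topspace Y. if b = True then f (U, x) else 0)"
  proof (rule sum.cong[OF HOL.refl])
    show "(if b then 1 else 0) * f ({y \<in> topspace Y. ?H y = b}, x) = (if b = True then f (U, x) else 0)" for b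
      by (cases b) (simp_all add: level)
  qed
  also have "\<dots> = (if True \<in> ?H ` topspace Y then f (U, x) else 0)"
    by (rule sum.delta[OF locally_constant_finite_range[OF Y H]])
  also have "\<dots> = f (U, x)"
  proof (cases "U = {}")
    case True
    then show ?thesis using additive_Clopen_empty[OF lc_kernelsD(5)[OF f x]] by simp
  next
    case False
    then have "True \<in> ?H ` topspace Y" using Clopen_subset[OF U] by (auto simp: image_iff)
    then show ?thesis by simp
  qed
  finally show "Comp StoneStoch_lc X Y Y (Idn StoneStoch_lc Y) f (U, x) = f (U, x)" .
qed

text \<open>For \<open>V\<close> fixed, \<open>h(V|-)\<close> has finitely many level sets. With \<open>H\<close> the joint values of \<open>g\<close> on these
  sets, both composites become the same double sum over the levels of \<open>h(V|-)\<close> and of \<open>H\<close>.\<close>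

lemma StoneStoch_assoc:
  assumes Y: "compact_space Y" and Z: "compact_space Z"
    and f: "f \<in> lc_kernels X Y" and g: "g \<in> lc_kernels Y Z" and h: "h \<in> lc_kernels Z W"
  shows "Comp StoneStoch_lc X Y W (Comp StoneStoch_lc Y Z W h g) f =
    Comp StoneStoch_lc X Z W h (Comp StoneStoch_lc X Y Z g f)"
proof (rule lc_kernels_eqI)
  note gf = StoneStoch_Comp_in_lc_kernels[OF Y f g] and hg = StoneStoch_Comp_in_lc_kernels[OF Z g h]
  show "Comp StoneStoch_lc X Y W (Comp StoneStoch_lc Y Z W h g) f \<in> lc_kernels X W"
    by (rule StoneStoch_Comp_in_lc_kernels[OF Y f hg])
  show "Comp StoneStoch_lc X Z W h (Comp StoneStoch_lc X Y Z g f) \<in> lc_kernels X W"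
    by (rule StoneStoch_Comp_in_lc_kernels[OF Z gf h])
  fix V x assume V: "V \<in> Clopen W" and x: "x \<in> topspace X"
  let ?R = "(\<lambda>z. h (V, z)) ` topspace Z" and ?L = "\<lambda>r. {z \<in> topspace Z. h (V, z) = r}"
  have hV: "locally_constant Z (\<lambda>z. h (V, z))" by (rule lc_kernelsD(4)[OF h V])
  note L = locally_constant_level_Clopen[OF hV]
  define H where "H y = (\<lambda>r\<in>?R. g (?L r, y))" for y
  have H: "locally_constant Y H"
    unfolding H_def
    by (intro locally_constant_family locally_constant_finite_range[OF Z hV] lc_kernelsD(4)[OF g] L)
  let ?f = "\<lambda>b. f ({y \<in> topspace Y. H y = b}, x)"
  have "Comp StoneStoch_lc X Y W (Comp StoneStoch_lc Y Z W h g) f (V, x) =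
      (\<Sum>b\<in>H ` topspace Y. (\<Sum>r\<in>?R. r * b r) * ?f b)"
  proof (rule StoneStoch_Comp_levels[OF Y f V x H])
    fix y assume y: "y \<in> topspace Y"
    have "Comp StoneStoch_lc Y Z W h g (V, y) = (\<Sum>r\<in>?R. r * g (?L r, y))"
      by (rule StoneStoch_Comp_levels[OF Z g V y hV]) simp
    then show "Comp StoneStoch_lc Y Z W h g (V, y) = (\<Sum>r\<in>?R. r * H y r)"
      by (simp add: H_def)
  qed
  also have "\<dots> = (\<Sum>r\<in>?R. \<Sum>b\<in>H ` topspace Y. r * (b r * ?f b))"
    by (subst sum.swap) (simp add: sum_distrib_right mult.assoc)
  also have "\<dots> = (\<Sum>r\<in>?R. r * Comp StoneStoch_lc X Y Z g f (?L r, x))"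
  proof (rule sum.cong[OF HOL.refl])
    fix r assume r: "r \<in> ?R"
    have "Comp StoneStoch_lc X Y Z g f (?L r, x) = (\<Sum>b\<in>H ` topspace Y. b r * ?f b)"
      by (rule StoneStoch_Comp_levels[OF Y f L x H]) (use r in \<open>simp add: H_def\<close>)
    then show "(\<Sum>b\<in>H ` topspace Y. r * (b r * ?f b)) = r * Comp StoneStoch_lc X Y Z g f (?L r, x)"
      by (simp add: sum_distrib_left)
  qed
  also have "\<dots> = Comp StoneStoch_lc X Z W h (Comp StoneStoch_lc X Y Z g f) (V, x)"
    by (rule StoneStoch_Comp_levels[OF Z gf V x hV, symmetric]) simp
  finally show "Comp StoneStoch_lc X Y W (Comp StoneStoch_lc Y Z W h g) f (V, x) =
      Comp StoneStoch_lc X Z W h (Comp StoneStoch_lc X Y Z g f) (V, x)" .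
qed

lemma category_StoneStoch_full_subcategory:
  assumes "\<And>X. X \<in> S \<Longrightarrow> compact_space X"
  shows "category (full_subcategory StoneStoch_lc S)"
proof -
  have [simp]: "Ob (full_subcategory StoneStoch_lc S) = S"
    "Hom (full_subcategory StoneStoch_lc S) = lc_kernels"
    "Idn (full_subcategory StoneStoch_lc S) = Idn StoneStoch_lc"
    "Comp (full_subcategory StoneStoch_lc S) = Comp StoneStoch_lc"
    by (simp_all add: full_subcategory_def StoneStoch_lc_def)
  show ?thesis
    unfolding category_def
    using assms
    by (auto simp: StoneStoch_Idn_in_lc_kernels StoneStoch_Comp_in_lc_kernels StoneStoch_Idn_right
        StoneStoch_Idn_left StoneStoch_assoc)
qed


section \<open>Coordinates and cylinders of Cantor spaces\<close>

abbreviation idx :: "enat \<Rightarrow> nat set" where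
  "idx N \<equiv> {i. enat i < N}"

abbreviation points :: "enat \<Rightarrow> (nat \<Rightarrow> bool) set" where
  "points N \<equiv> topspace (two_pow N)"

lemma points_eq: "points N = (\<Pi>\<^sub>E i\<in>idx N. UNIV)"
  by (simp add: two_pow_def)

lemma compact_space_two_pow: "compact_space (two_pow N)"
  by (simp add: two_pow_def compact_space_product_topology compact_space_discrete_topology)

text \<open>The points are functions with the value \<open>undefined\<close> outside the index set, so the index set can
  be read off from them: a coordinate belongs to it iff some point has the value \<open>\<not> undefined\<close>
  there.\<close>

lemma inj_two_pow: "inj two_pow"
proof (rule injI)
  fix M N assume "two_pow M = two_pow N"
  then have eq: "(\<Pi>\<^sub>E i\<in>idx M. UNIV :: bool set) = (\<Pi>\<^sub>E i\<in>idx N. UNIV)"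
    using points_eq by metis
  have sub: "idx M \<subseteq> idx N" if eq: "(\<Pi>\<^sub>E i\<in>idx M. UNIV :: bool set) = (\<Pi>\<^sub>E i\<in>idx N. UNIV)" for M N
  proof
    fix i assume i: "i \<in> idx M"
    have "(\<lambda>i\<in>idx M. \<not> undefined) \<in> (\<Pi>\<^sub>E i\<in>idx M. UNIV :: bool set)" by auto
    then have "(\<lambda>i\<in>idx M. \<not> undefined) \<in> (\<Pi>\<^sub>E i\<in>idx N. UNIV :: bool set)" unfolding eq .
    then show "i \<in> idx N" using i by (auto simp: PiE_iff extensional_def)
  qed
  have "idx M = idx N" using sub[OF eq] sub[OF eq[symmetric]] by blast
  then have "\<And>i. enat i < M \<longleftrightarrow> enat i < N" by blast
  then show "M = N"
  proof (cases M; cases N)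
    fix m n assume "M = enat m" "N = enat n" "\<And>i. enat i < M \<longleftrightarrow> enat i < N"
    then show ?thesis by (metis enat_ord_simps(2) less_irrefl nat_neq_iff)
  qed (metis enat_ord_simps(2,4) less_irrefl)+
qed

lemma openin_cylinder:
  assumes "finite S" "S \<subseteq> idx N"
  shows "openin (two_pow N) {x' \<in> points N. \<forall>i\<in>S. x' i = x i}"
proof -
  have "{x' \<in> points N. \<forall>i\<in>S. x' i = x i} = (\<Pi>\<^sub>E i\<in>idx N. if i \<in> S then {x i} else UNIV)"
    using assms(2) by (auto simp: points_eq PiE_iff extensional_def split: if_splits)
  moreover have "finite {i \<in> idx N. (if i \<in> S then {x i} else UNIV) \<noteq> UNIV}"
    by (rule finite_subset[OF _ assms(1)]) auto
  ultimately show ?thesis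
    unfolding two_pow_def openin_PiE_gen by (simp add: openin_PiE_gen)
qed

text \<open>Coordinates are given as a list because the restriction \<open>map x L\<close> of a point is then directly an
  element of the object \<open>2\<^sup>n\<close> of BinStoch for \<open>n = length L\<close>.\<close>

definition depends_on :: "enat \<Rightarrow> nat list \<Rightarrow> ((nat \<Rightarrow> bool) \<Rightarrow> 'a) \<Rightarrow> bool" where
  "depends_on N L h \<longleftrightarrow> (\<forall>x\<in>points N. \<forall>x'\<in>points N. map x L = map x' L \<longrightarrow> h x = h x')"

lemma depends_onD:
  "depends_on N L h \<Longrightarrow> x \<in> points N \<Longrightarrow> x' \<in> points N \<Longrightarrow> map x L = map x' L \<Longrightarrow> h x = h x'"
  unfolding depends_on_def by (drule bspec, assumption, drule bspec, assumption, erule mp)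

lemma depends_on_locally_constant:
  assumes "set L \<subseteq> idx N" "depends_on N L h"
  shows "locally_constant (two_pow N) h"
  unfolding locally_constant_def
proof
  fix x assume x: "x \<in> points N"
  let ?V = "{x' \<in> points N. \<forall>i\<in>set L. x' i = x i}"
  have "openin (two_pow N) ?V" by (rule openin_cylinder) (use assms(1) in auto)
  moreover have "h x' = h x" if "x' \<in> ?V" for x'
    by (rule depends_onD[OF assms(2)]) (use x that in auto)
  ultimately show "\<exists>V. openin (two_pow N) V \<and> x \<in> V \<and> (\<forall>x'\<in>V. h x' = h x)"
    using x by (intro exI[of _ ?V]) blast
qed

lemma locally_constant_near:
  assumes "locally_constant (two_pow N) h" "x \<in> points N"
  shows "\<exists>S. finite S \<and> S \<subseteq> idx N \<and> (\<forall>x'\<in>points N. (\<forall>i\<in>S. x' i = x i) \<longrightarrow> h x = h x')"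
proof -
  obtain V where V: "openin (two_pow N) V" "x \<in> V" "\<And>x'. x' \<in> V \<Longrightarrow> h x = h x'"
    by (rule locally_constantD[OF assms]) (rule that)
  obtain U where U: "finite {i \<in> idx N. U i \<noteq> topspace (discrete_topology (UNIV :: bool set))}"
      "x \<in> Pi\<^sub>E (idx N) U" "Pi\<^sub>E (idx N) U \<subseteq> V"
    using V(1,2) unfolding two_pow_def openin_product_topology_alt by blast
  let ?S = "{i \<in> idx N. U i \<noteq> UNIV}"
  have "h x = h x'" if x': "x' \<in> points N" "\<forall>i\<in>?S. x' i = x i" for x'
  proof (rule V(3), rule subsetD[OF U(3)])
    have "x' i \<in> U i" if "i \<in> idx N" for i
      using that x'(2) U(2) by (cases "U i = UNIV") (auto simp: PiE_iff)
    with x'(1) show "x' \<in> Pi\<^sub>E (idx N) U" by (auto simp: points_eq PiE_iff)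
  qed
  with U(1) show ?thesis by (intro exI[of _ ?S]) auto
qed

text \<open>Around each point \<open>x\<close> the function is constant on the cylinder given by a finite set \<open>S x\<close> of
  coordinates. Finitely many of these cylinders cover the compact space, and the union of the
  corresponding sets of coordinates decides in which of them a point lies.\<close>

lemma locally_constant_depends_on:
  assumes h: "locally_constant (two_pow N) h"
  shows "\<exists>S. finite S \<and> S \<subseteq> idx N \<and> (\<forall>L. S \<subseteq> set L \<longrightarrow> depends_on N L h)"
proof -
  have "\<forall>x\<in>points N. \<exists>S. finite S \<and> S \<subseteq> idx N \<and> (\<forall>x'\<in>points N. (\<forall>i\<in>S. x' i = x i) \<longrightarrow> h x = h x')"
    by (intro ballI locally_constant_near[OF h])
  from bchoice[OF this] obtain S where near: "\<forall>x\<in>points N. finite (S x) \<and> S x \<subseteq> idx N \<and>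
      (\<forall>x'\<in>points N. (\<forall>i\<in>S x. x' i = x i) \<longrightarrow> h x = h x')"
    by (elim exE)
  have S: "finite (S x)" "S x \<subseteq> idx N" if "x \<in> points N" for x
    by (rule bspec[OF near that, THEN conjunct1], rule bspec[OF near that, THEN conjunct2, THEN conjunct1])
  have same: "h x = h x'" if "x \<in> points N" "x' \<in> points N" "\<forall>i\<in>S x. x' i = x i" for x x'
    using bspec[OF near that(1)] by (elim conjE) (drule bspec[OF _ that(2)], erule mp, rule that(3))
  let ?C = "\<lambda>x. {x' \<in> points N. \<forall>i\<in>S x. x' i = x i}"
  have "openin (two_pow N) (?C x)" if "x \<in> points N" for x
    by (rule openin_cylinder[OF S[OF that]])
  then have "(\<forall>U\<in>?C ` points N. openin (two_pow N) U) \<and> points N \<subseteq> \<Union>(?C ` points N)"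
    by blast
  from mp[OF spec[OF compact_space_two_pow[unfolded compact_space_alt]] this]
  obtain \<F> where F: "finite \<F>" "\<F> \<subseteq> ?C ` points N" "points N \<subseteq> \<Union>\<F>"
    by (elim exE conjE)
  from finite_subset_image[OF F(1,2)] obtain A where A: "A \<subseteq> points N" "finite A" "\<F> = ?C ` A"
    by (elim exE conjE)
  have "depends_on N L h" if L: "(\<Union>a\<in>A. S a) \<subseteq> set L" for L
    unfolding depends_on_def
  proof (intro ballI impI)
    fix x x' assume x: "x \<in> points N" "x' \<in> points N" and eq: "map x L = map x' L"
    obtain a where a: "a \<in> A" "x \<in> ?C a" using x(1) F(3) A(3) by blast
    have "x' i = a i" if "i \<in> S a" for i
      using that a L eq by (auto simp: map_eq_conv)
    then show "h x = h x'"
      using same[of a x] same[of a x'] a A(1) x by auto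
  qed
  moreover have "finite (\<Union>a\<in>A. S a)" "(\<Union>a\<in>A. S a) \<subseteq> idx N"
    using A S(1,2) by auto
  ultimately show ?thesis by blast
qed

definition cyl :: "enat \<Rightarrow> nat list \<Rightarrow> bool list \<Rightarrow> (nat \<Rightarrow> bool) set" where
  "cyl N L y = {x \<in> points N. map x L = y}"

text \<open>Some point with the given restriction. A set that depends only on \<open>L\<close> contains a
  nonempty cylinder over \<open>L\<close> iff it contains this point of the cylinder.\<close>

definition point :: "enat \<Rightarrow> nat list \<Rightarrow> bool list \<Rightarrow> nat \<Rightarrow> bool" where
  "point N L y = (SOME x. x \<in> cyl N L y)"

lemma depends_on_restriction: "depends_on N L (\<lambda>x. map x L)"
  unfolding depends_on_def by blast

lemma cyl_Clopen:
  assumes "set L \<subseteq> idx N"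
  shows "cyl N L y \<in> Clopen (two_pow N)"
  unfolding cyl_def
  by (rule locally_constant_level_Clopen[OF depends_on_locally_constant[OF assms depends_on_restriction]])

lemma depends_on_cyl: "depends_on N L (\<lambda>x. x \<in> cyl N L y)"
  unfolding depends_on_def cyl_def by (intro ballI impI) (simp only: mem_Collect_eq)

lemma depends_on_mono:
  assumes "depends_on N L h" "set L \<subseteq> set L'"
  shows "depends_on N L' h"
  unfolding depends_on_def
proof (intro ballI impI)
  fix x x' assume x: "x \<in> points N" "x' \<in> points N" and "map x L' = map x' L'"
  then have "map x L = map x' L" using assms(2) by (auto simp: map_eq_conv)
  then show "h x = h x'" by (rule depends_onD[OF assms(1) x])
qed

lemma point_in_cyl:
  assumes "distinct L" "set L \<subseteq> idx N" "y \<in> pow2 (length L)"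
  shows "point N L y \<in> cyl N L y"
proof -
  let ?x = "\<lambda>i\<in>idx N. the (map_of (zip L y) i)"
  have len: "length L = length y" using assms(3) by (simp add: pow2_def)
  have "map ?x L = y"
  proof (rule nth_equalityI)
    show "map ?x L ! i = y ! i" if "i < length (map ?x L)" for i
    proof -
      have i: "i < length L" "i < length y" using that len by simp_all
      have "L ! i \<in> idx N" using assms(2) nth_mem[OF i(1)] by blast
      then show ?thesis using i map_of_zip_nth[OF len assms(1) i(2)] by simp
    qed
  qed (simp add: len)
  moreover have "?x \<in> points N" by (simp add: points_eq)
  ultimately have "?x \<in> cyl N L y" by (simp add: cyl_def)
  then show ?thesis unfolding point_def by (rule someI[where P = "\<lambda>x. x \<in> cyl N L y"])
qed

lemma measure_by_cylinders:
  fixes \<mu> :: "(nat \<Rightarrow> bool) set \<Rightarrow> real"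
  assumes \<mu>: "additive (Clopen (two_pow N)) \<mu>" and L: "distinct L" "set L \<subseteq> idx N"
    and U: "U \<subseteq> points N" "depends_on N L (\<lambda>x. x \<in> U)"
  shows "\<mu> U = (\<Sum>y | y \<in> pow2 (length L) \<and> point N L y \<in> U. \<mu> (cyl N L y))"
proof -
  let ?Y = "{y. y \<in> pow2 (length L) \<and> point N L y \<in> U}"
  have point: "point N L y \<in> points N" "map (point N L y) L = y" if "y \<in> pow2 (length L)" for y
    using point_in_cyl[OF L that] by (auto simp: cyl_def)
  have "U = (\<Union>y\<in>?Y. cyl N L y)"
  proof (intro equalityI subsetI)
    fix x assume x: "x \<in> U"
    have y: "map x L \<in> pow2 (length L)" by (simp add: pow2_def)
    moreover have "point N L (map x L) \<in> U"
      using depends_onD[OF U(2) _ point(1)[OF y], of x] U(1) x point(2)[OF y] by auto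
    moreover have "x \<in> cyl N L (map x L)" using x U(1) by (auto simp: cyl_def)
    ultimately show "x \<in> (\<Union>y\<in>?Y. cyl N L y)" by blast
  next
    fix x assume "x \<in> (\<Union>y\<in>?Y. cyl N L y)"
    then obtain y where "y \<in> pow2 (length L)" "point N L y \<in> U" "x \<in> points N" "map x L = y"
      by (auto simp: cyl_def)
    then show "x \<in> U"
      using depends_onD[OF U(2), of x "point N L y"] point[of y] by auto
  qed
  then have "\<mu> U = \<mu> (\<Union>y\<in>?Y. cyl N L y)" by (rule arg_cong)
  also have "\<dots> = (\<Sum>y\<in>?Y. \<mu> (cyl N L y))"
  proof (rule additive_Clopen_UN[OF \<mu>])
    show "finite ?Y" by simp
    show "cyl N L y \<in> Clopen (two_pow N)" for y by (rule cyl_Clopen[OF L(2)])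
    show "cyl N L y \<inter> cyl N L y' = {}" if "y \<noteq> y'" for y y'
      using that by (auto simp: cyl_def)
  qed
  finally show ?thesis .
qed


section \<open>Finite approximations of Cantor spaces\<close>

text \<open>The object \<open>n\<close> is indexed by the single index \<open>0\<close>, which stands for all \<open>n\<close> coordinates, whereas
  an index of \<open>\<infinity>\<close> is itself a coordinate. Replacing each index by the coordinates for which
  it stands lets all objects be treated alike.\<close>

definition block :: "enat \<Rightarrow> nat \<Rightarrow> nat list" where
  "block N j = (case N of enat n \<Rightarrow> [0..<n] | \<infinity> \<Rightarrow> [j])"

definition coords :: "enat \<Rightarrow> nat list \<Rightarrow> nat list" where
  "coords N F = concat (map (block N) F)"

abbreviation approx :: "enat \<Rightarrow> nat list set" where
  "approx N \<equiv> FinLO (fst (free_object N))"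

lemma coords_simps [simp]: "coords N [] = []" "coords N (j # F) = block N j @ coords N F"
  by (simp_all add: coords_def)

lemma coords_infinity: "coords \<infinity> F = F"
  by (induction F) (simp_all add: block_def)

lemma approx_enat: "F \<in> approx (enat n) \<longleftrightarrow> F = [] \<or> F = [0]"
proof
  assume F: "F \<in> approx (enat n)"
  then have "set F \<subseteq> set [0]" "sorted_wrt (<) F" by (auto simp: FinLO_def free_object_def)
  then show "F = [] \<or> F = [0]"
    by (cases F; cases "tl F") auto
qed (auto simp: FinLO_def free_object_def)

lemma approx_infinity: "F \<in> approx \<infinity> \<longleftrightarrow> sorted_wrt (<) F"
  by (simp add: FinLO_def free_object_def)

lemma
  assumes "F \<in> approx N"
  shows distinct_coords: "distinct (coords N F)" and set_coords: "set (coords N F) \<subseteq> idx N"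
proof -
  have "distinct (coords N F) \<and> set (coords N F) \<subseteq> idx N"
  proof (cases N)
    case (enat n)
    with assms have "F = [] \<or> F = [0]" by (simp add: approx_enat)
    with enat show ?thesis by (auto simp: block_def)
  next
    case infinity
    with assms show ?thesis by (auto simp: coords_infinity approx_infinity strict_sorted_iff)
  qed
  then show "distinct (coords N F)" "set (coords N F) \<subseteq> idx N" by auto
qed

text \<open>This turns statements about finitely many coordinates into statements about the indices of
  families.\<close>

lemma approx_cofinal:
  assumes "finite S" "S \<subseteq> idx N"
  shows "\<exists>F\<in>approx N. S \<subseteq> set (coords N F)"
proof (cases N)
  case (enat n)
  with assms show ?thesis by (intro bexI[of _ "[0]"]) (auto simp: approx_enat block_def)
next
  case infinity
  with assms show ?thesis
    by (intro bexI[of _ "sorted_list_of_set S"]) (auto simp: approx_infinity coords_infinity)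
qed

lemma FinLO_filter:
  assumes "F \<in> FinLO J" "F' \<in> FinLO J" "set F \<subseteq> set F'"
  shows "filter (\<lambda>i. i \<in> set F) F' = F"
  by (rule strict_sorted_equal) (use assms in \<open>auto simp: FinLO_def sorted_wrt_filter\<close>)

lemma FinLO_subseq:
  assumes "F \<in> FinLO J" "F' \<in> FinLO J" "set F \<subseteq> set F'"
  shows "subseq F F'"
  using FinLO_filter[OF assms] by (metis subseq_filter_left)

lemma FinLO_directed:
  assumes "F \<in> FinLO J" "F' \<in> FinLO J"
  shows "\<exists>F''\<in>FinLO J. subseq F F'' \<and> subseq F' F''"
proof -
  let ?F = "sorted_list_of_set (set F \<union> set F')"
  have "?F \<in> FinLO J" using assms by (auto simp: FinLO_def)
  with assms show ?thesis by (intro bexI[of _ ?F] conjI FinLO_subseq) auto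
qed

lemma subseq_set: "subseq F F' \<Longrightarrow> set F \<subseteq> set F'"
  by (induction rule: list_emb.induct) auto

lemma set_coords_mono: "subseq F F' \<Longrightarrow> set (coords N F) \<subseteq> set (coords N F')"
  using subseq_set by (auto simp: coords_def)


section \<open>Families represent kernels\<close>

lemma length_block: "j \<in> fst (free_object N) \<Longrightarrow> length (block N j) = snd (free_object N) j"
  by (cases N) (auto simp: free_object_def block_def)

lemma map_coords_pow2 [simp]: "map x (coords N F) \<in> pow2 (length (coords N F))"
  by (simp add: pow2_def)

lemma point_coords:
  assumes "F \<in> approx N" "y \<in> pow2 (length (coords N F))"
  shows "point N (coords N F) y \<in> points N" "map (point N (coords N F) y) (coords N F) = y"
  using point_in_cyl[OF distinct_coords[OF assms(1)] set_coords[OF assms(1)] assms(2)]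
  by (simp_all add: cyl_def)

lemma pow2_coordsE:
  assumes "F \<in> approx N" "y \<in> pow2 (length (coords N F))"
  obtains x where "x \<in> points N" "y = map x (coords N F)"
  using point_coords[OF assms] by (metis)

text \<open>The relation behind the isomorphism: each component of the family is the restriction of the
  kernel to finitely many input and output coordinates.\<close>

definition represents ::
  "enat \<Rightarrow> enat \<Rightarrow> ((nat \<Rightarrow> bool) set \<times> (nat \<Rightarrow> bool) \<Rightarrow> real) \<Rightarrow>
   causal_gen smterm set approx_family \<Rightarrow> bool" where
  "represents M N k = (\<lambda>(\<Lambda>, f). \<forall>F G. (F, G) \<in> \<Lambda> \<longrightarrow>
     (\<forall>x\<in>points M. \<forall>y\<in>pow2 (length (coords N G)).
        sem (f F G) y (map x (coords M F)) = k (cyl N (coords N G) y, x)))"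

lemma representsD:
  assumes "represents M N k (\<Lambda>, f)" "(F, G) \<in> \<Lambda>" "x \<in> points M" "y \<in> pow2 (length (coords N G))"
  shows "sem (f F G) y (map x (coords M F)) = k (cyl N (coords N G) y, x)"
  using assms unfolding represents_def by blast

lemma representsI:
  assumes "\<And>F G x y. (F, G) \<in> \<Lambda> \<Longrightarrow> x \<in> points M \<Longrightarrow> y \<in> pow2 (length (coords N G)) \<Longrightarrow>
    sem (f F G) y (map x (coords M F)) = k (cyl N (coords N G) y, x)"
  shows "represents M N k (\<Lambda>, f)"
  using assms unfolding represents_def by blast

context causal_presentation
begin

abbreviation families :: "enat \<Rightarrow> enat \<Rightarrow> causal_gen smterm set approx_family set" where
  "families M N \<equiv> finite_approximation_families \<F> (free_object M) (free_object N)"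

abbreviation pr :: "enat \<Rightarrow> nat list \<Rightarrow> nat list \<Rightarrow> causal_gen smterm set" where
  "pr N F' F \<equiv> proj \<F> (snd (free_object N)) F' F"

lemma Free_Unt_TensO [simp]: "Unt \<F> = 0" "TensO \<F> = (+)"
  by (simp_all add: Free_def)

lemma tens_list_Free:
  "set F \<subseteq> fst (free_object N) \<Longrightarrow> tens_list \<F> (snd (free_object N)) F = length (coords N F)"
  by (induction F) (auto simp: length_block)

lemma tens_list_approx: "F \<in> approx N \<Longrightarrow> tens_list \<F> (snd (free_object N)) F = length (coords N F)"
  by (rule tens_list_Free) (simp add: FinLO_def)

text \<open>Each factor of the projection keeps or deletes the block of coordinates of one index, so their
  tensor product restricts a point to the coordinates of the indices that are kept.\<close>

lemma proj_sem:
  assumes "set F' \<subseteq> fst (free_object N)"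
  shows "pr N F' F \<in> Hom \<F> (length (coords N F')) (length (coords N (filter (\<lambda>i. i \<in> set F) F'))) \<and>
    (\<forall>x y. sem (pr N F' F) y (map x (coords N F')) =
      (if y = map x (coords N (filter (\<lambda>i. i \<in> set F) F')) then 1 else 0))"
  using assms
proof (induction F')
  case Nil
  show ?case by (auto simp: sem_Idn deterministic_def)
next
  case (Cons j F')
  let ?X = "snd (free_object N) j" and ?K = "filter (\<lambda>i. i \<in> set F) F'"
  let ?Y = "if j \<in> set F then ?X else 0"
  let ?p = "if j \<in> set F then Idn \<F> ?X else del \<F> ?X"
  have j: "j \<in> fst (free_object N)" and F': "set F' \<subseteq> fst (free_object N)" using Cons.prems by auto
  have len: "length (block N j) = ?X" by (rule length_block[OF j])
  have K: "set ?K \<subseteq> fst (free_object N)" using F' by auto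
  note IH = conjunct1[OF Cons.IH[OF F']] spec[OF spec[OF conjunct2[OF Cons.IH[OF F']]]]
  have p: "?p \<in> Hom \<F> ?X ?Y" using sem_Idn(1) del_Free(1) by simp
  have "pr N (j # F') F = TensM \<F> ?X ?Y (length (coords N F')) (length (coords N ?K)) ?p (pr N F' F)"
    by (simp add: tens_list_Free[OF F'] tens_list_Free[OF K])
  moreover have "TensM \<F> ?X ?Y (length (coords N F')) (length (coords N ?K)) ?p (pr N F' F)
      \<in> Hom \<F> (?X + length (coords N F')) (?Y + length (coords N ?K))"
    by (rule Free_TensM_in_Hom[OF p IH(1)])
  moreover have "sem (TensM \<F> ?X ?Y (length (coords N F')) (length (coords N ?K)) ?p (pr N F' F)) y
      (map x (coords N (j # F'))) =
      (if y = map x (coords N (filter (\<lambda>i. i \<in> set F) (j # F'))) then 1 else 0)" for x y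
  proof -
    have b: "map x (block N j) \<in> pow2 ?X" by (simp add: pow2_def len)
    have decompose: "y = map x (block N j) @ z \<longleftrightarrow> take ?X y = map x (block N j) \<and> drop ?X y = z" for z
      using append_take_drop_id[of ?X y] take_drop_append_pow2[OF b, of z] by metis
    show ?thesis
      unfolding sem_TensM[OF p IH(1)]
      by (cases "j \<in> set F")
        (simp_all add: BinStoch_TensM sem_Idn del_Free deterministic_def b take_drop_append_pow2[OF b]
          IH(2) decompose del: take_append drop_append)
  qed
  ultimately show ?case by (auto simp: len)
qed

lemma
  assumes "F \<in> approx N" "F' \<in> approx N" "subseq F F'"
  shows proj_in_Hom: "pr N F' F \<in> Hom \<F> (length (coords N F')) (length (coords N F))"
    and sem_proj: "sem (pr N F' F) y (map x (coords N F')) = (if y = map x (coords N F) then 1 else 0)"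
  using proj_sem[of F' N F] FinLO_filter[OF assms(1,2) subseq_set[OF assms(3)]] assms(2)
  by (simp_all add: FinLO_def)

lemma sem_Comp_proj_right:
  assumes "F \<in> approx N" "F' \<in> approx N" "subseq F F'" and f: "f \<in> Hom \<F> (length (coords N F)) n"
  shows "sem (Comp \<F> (length (coords N F')) (length (coords N F)) n f (pr N F' F)) y (map x (coords N F')) =
    sem f y (map x (coords N F))"
  unfolding sem_Comp[OF proj_in_Hom[OF assms(1-3)] f] BinStoch_Comp
  by (simp add: sem_proj[OF assms(1-3)] if_distrib sum.delta cong: if_cong)

lemma sem_Comp_proj_left:
  assumes G: "G \<in> approx N" "G' \<in> approx N" "subseq G G'" and f: "f \<in> Hom \<F> m (length (coords N G'))"
  shows "sem (Comp \<F> m (length (coords N G')) (length (coords N G)) (pr N G' G) f) y x =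
    (\<Sum>y' | y' \<in> pow2 (length (coords N G')) \<and> point N (coords N G') y' \<in> cyl N (coords N G) y. sem f y' x)"
proof -
  have "sem (Comp \<F> m (length (coords N G')) (length (coords N G)) (pr N G' G) f) y x =
      (\<Sum>y'\<in>pow2 (length (coords N G')). sem (pr N G' G) y y' * sem f y' x)"
    unfolding sem_Comp[OF f proj_in_Hom[OF G]] BinStoch_Comp ..
  also have "\<dots> = (\<Sum>y'\<in>pow2 (length (coords N G')).
      if point N (coords N G') y' \<in> cyl N (coords N G) y then sem f y' x else 0)"
  proof (rule sum.cong[OF HOL.refl])
    fix y' assume y': "y' \<in> pow2 (length (coords N G'))"
    show "sem (pr N G' G) y y' * sem f y' x =
        (if point N (coords N G') y' \<in> cyl N (coords N G) y then sem f y' x else 0)"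
      using sem_proj[OF G, of y "point N (coords N G') y'"] point_coords[OF G(2) y']
      by (auto simp: cyl_def)
  qed
  also have "\<dots> = (\<Sum>y' | y' \<in> pow2 (length (coords N G')) \<and> point N (coords N G') y' \<in> cyl N (coords N G) y. sem f y' x)"
    by (simp add: sum.inter_filter)
  finally show ?thesis .
qed

text \<open>Components of families are compared through their matrices on inputs that are restrictions of
  points. This is no loss, since each list of bits of the right length is one.\<close>

lemma Hom_eqI:
  assumes "F \<in> approx M" "f \<in> Hom \<F> (length (coords M F)) n" "g \<in> Hom \<F> (length (coords M F)) n"
    "\<And>x y. x \<in> points M \<Longrightarrow> y \<in> pow2 n \<Longrightarrow> sem f y (map x (coords M F)) = sem g y (map x (coords M F))"
  shows "f = g"
proof (rule sem_inject[OF assms(2,3)], intro ext)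
  fix y z
  show "sem f y z = sem g y z"
  proof (cases "y \<in> pow2 n \<and> z \<in> pow2 (length (coords M F))")
    case True
    then obtain x where "x \<in> points M" "z = map x (coords M F)"
      using pow2_coordsE[OF assms(1)] by blast
    then show ?thesis using assms(4) True by simp
  next
    case False
    then show ?thesis
      using BinStoch_HomD(3)[OF sem_in_Hom[OF assms(2)]] BinStoch_HomD(3)[OF sem_in_Hom[OF assms(3)]]
      by metis
  qed
qed

lemma ball_pair: "(\<forall>(x, y)\<in>A. P x y) \<longleftrightarrow> (\<forall>x y. (x, y) \<in> A \<longrightarrow> P x y)"
  by auto

lemma families_iff:
  "(\<Lambda>, f) \<in> families M N \<longleftrightarrow>
     \<Lambda> \<subseteq> approx M \<times> approx N \<and>
     (\<forall>F G. (F, G) \<in> \<Lambda> \<longrightarrow> f F G \<in> Hom \<F> (length (coords M F)) (length (coords N G))) \<and>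
     (\<forall>F G F' G'. (F, G) \<in> \<Lambda> \<longrightarrow> (F', G') \<in> \<Lambda> \<longrightarrow> subseq F F' \<longrightarrow> subseq G G' \<longrightarrow>
        Comp \<F> (length (coords M F')) (length (coords N G')) (length (coords N G)) (pr N G' G) (f F' G') =
        Comp \<F> (length (coords M F')) (length (coords M F)) (length (coords N G)) (f F G) (pr M F' F)) \<and>
     (\<forall>G\<in>approx N. \<exists>F. (F, G) \<in> \<Lambda>) \<and>
     (\<forall>F G F'. (F, G) \<in> \<Lambda> \<longrightarrow> F' \<in> approx M \<longrightarrow> subseq F F' \<longrightarrow> (F', G) \<in> \<Lambda>)"
  (is "_ \<longleftrightarrow> ?sub \<and> ?hom \<and> ?nat \<and> ?cov \<and> ?her")
proof -
  let ?X = "snd (free_object M)" and ?Y = "snd (free_object N)"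
  have 1: "(\<Lambda>, f) \<in> families M N \<longleftrightarrow> ?sub \<and>
     (\<forall>(F, G)\<in>\<Lambda>. f F G \<in> Hom \<F> (tens_list \<F> ?X F) (tens_list \<F> ?Y G)) \<and>
     (\<forall>(F, G)\<in>\<Lambda>. \<forall>(F', G')\<in>\<Lambda>. subseq F F' \<and> subseq G G' \<longrightarrow>
        Comp \<F> (tens_list \<F> ?X F') (tens_list \<F> ?Y G') (tens_list \<F> ?Y G) (pr N G' G) (f F' G') =
        Comp \<F> (tens_list \<F> ?X F') (tens_list \<F> ?X F) (tens_list \<F> ?Y G) (f F G) (pr M F' F)) \<and>
     ?cov \<and> (\<forall>(F, G)\<in>\<Lambda>. \<forall>F'\<in>approx M. subseq F F' \<longrightarrow> (F', G) \<in> \<Lambda>)"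
    unfolding finite_approximation_families_def by (simp only: case_prod_beta mem_Collect_eq fst_conv snd_conv)
  show ?thesis
  proof (cases ?sub)
    case True
    then have in_approx: "F \<in> approx M" "G \<in> approx N" if "(F, G) \<in> \<Lambda>" for F G using that by auto
    have hom: "(\<forall>(F, G)\<in>\<Lambda>. f F G \<in> Hom \<F> (tens_list \<F> ?X F) (tens_list \<F> ?Y G)) \<longleftrightarrow> ?hom"
      unfolding ball_pair
      by (intro arg_cong[where f = All] ext imp_cong HOL.refl) (simp only: tens_list_approx in_approx)
    have nat: "(\<forall>(F, G)\<in>\<Lambda>. \<forall>(F', G')\<in>\<Lambda>. subseq F F' \<and> subseq G G' \<longrightarrow>
        Comp \<F> (tens_list \<F> ?X F') (tens_list \<F> ?Y G') (tens_list \<F> ?Y G) (pr N G' G) (f F' G') =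
        Comp \<F> (tens_list \<F> ?X F') (tens_list \<F> ?X F) (tens_list \<F> ?Y G) (f F G) (pr M F' F)) \<longleftrightarrow>
      (\<forall>F G. (F, G) \<in> \<Lambda> \<longrightarrow> (\<forall>F' G'. (F', G') \<in> \<Lambda> \<longrightarrow> subseq F F' \<and> subseq G G' \<longrightarrow>
        Comp \<F> (length (coords M F')) (length (coords N G')) (length (coords N G)) (pr N G' G) (f F' G') =
        Comp \<F> (length (coords M F')) (length (coords M F)) (length (coords N G)) (f F G) (pr M F' F)))"
      unfolding ball_pair
      by (intro arg_cong[where f = All] ext imp_cong HOL.refl) (simp only: tens_list_approx in_approx)
    have her: "(\<forall>(F, G)\<in>\<Lambda>. \<forall>F'\<in>approx M. subseq F F' \<longrightarrow> (F', G) \<in> \<Lambda>) \<longleftrightarrow> ?her"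
      unfolding ball_pair by blast
    show ?thesis unfolding 1 hom nat her by blast
  next
    case False
    then show ?thesis unfolding 1 by blast
  qed
qed

lemma familiesD:
  assumes "(\<Lambda>, f) \<in> families M N"
  shows "(F, G) \<in> \<Lambda> \<Longrightarrow> F \<in> approx M" "(F, G) \<in> \<Lambda> \<Longrightarrow> G \<in> approx N"
    "(F, G) \<in> \<Lambda> \<Longrightarrow> f F G \<in> Hom \<F> (length (coords M F)) (length (coords N G))"
    "(F, G) \<in> \<Lambda> \<Longrightarrow> (F', G') \<in> \<Lambda> \<Longrightarrow> subseq F F' \<Longrightarrow> subseq G G' \<Longrightarrow>
        Comp \<F> (length (coords M F')) (length (coords N G')) (length (coords N G)) (pr N G' G) (f F' G') =
        Comp \<F> (length (coords M F')) (length (coords M F)) (length (coords N G)) (f F G) (pr M F' F)"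
    "G \<in> approx N \<Longrightarrow> \<exists>F. (F, G) \<in> \<Lambda>"
    "(F, G) \<in> \<Lambda> \<Longrightarrow> F' \<in> approx M \<Longrightarrow> subseq F F' \<Longrightarrow> (F', G) \<in> \<Lambda>"
proof -
  note * = iffD1[OF families_iff assms]
  show "(F, G) \<in> \<Lambda> \<Longrightarrow> F \<in> approx M" "(F, G) \<in> \<Lambda> \<Longrightarrow> G \<in> approx N"
    using conjunct1[OF *] by auto
  show "(F, G) \<in> \<Lambda> \<Longrightarrow> f F G \<in> Hom \<F> (length (coords M F)) (length (coords N G))"
    using conjunct1[OF conjunct2[OF *]] by blast
  show "(F, G) \<in> \<Lambda> \<Longrightarrow> (F', G') \<in> \<Lambda> \<Longrightarrow> subseq F F' \<Longrightarrow> subseq G G' \<Longrightarrow>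
        Comp \<F> (length (coords M F')) (length (coords N G')) (length (coords N G)) (pr N G' G) (f F' G') =
        Comp \<F> (length (coords M F')) (length (coords M F)) (length (coords N G)) (f F G) (pr M F' F)"
    using conjunct1[OF conjunct2[OF conjunct2[OF *]]] by blast
  show "G \<in> approx N \<Longrightarrow> \<exists>F. (F, G) \<in> \<Lambda>"
    using conjunct1[OF conjunct2[OF conjunct2[OF conjunct2[OF *]]]] by blast
  show "(F, G) \<in> \<Lambda> \<Longrightarrow> F' \<in> approx M \<Longrightarrow> subseq F F' \<Longrightarrow> (F', G) \<in> \<Lambda>"
    using conjunct2[OF conjunct2[OF conjunct2[OF conjunct2[OF *]]]] by blast
qed

text \<open>The form in which naturality is used: composing with a projection of the outputs sums over the
  coordinates that are dropped, and composing with a projection of the inputs restricts them.\<close>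

lemma families_natural:
  assumes \<Lambda>: "(\<Lambda>, f) \<in> families M N" and FG: "(F, G) \<in> \<Lambda>" "(F', G') \<in> \<Lambda>" "subseq F F'" "subseq G G'"
  shows "sem (f F G) y (map x (coords M F)) =
    (\<Sum>y' | y' \<in> pow2 (length (coords N G')) \<and> point N (coords N G') y' \<in> cyl N (coords N G) y.
       sem (f F' G') y' (map x (coords M F')))"
proof -
  have "sem (f F G) y (map x (coords M F)) = sem (Comp \<F> (length (coords M F')) (length (coords M F))
      (length (coords N G)) (f F G) (pr M F' F)) y (map x (coords M F'))"
    by (rule sem_Comp_proj_right[OF familiesD(1)[OF \<Lambda> FG(1)] familiesD(1)[OF \<Lambda> FG(2)] FG(3)
        familiesD(3)[OF \<Lambda> FG(1)], symmetric])
  also have "\<dots> = sem (Comp \<F> (length (coords M F')) (length (coords N G')) (length (coords N G))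
      (pr N G' G) (f F' G')) y (map x (coords M F'))"
    by (simp only: familiesD(4)[OF \<Lambda> FG])
  also have "\<dots> = (\<Sum>y' | y' \<in> pow2 (length (coords N G')) \<and> point N (coords N G') y' \<in> cyl N (coords N G) y.
       sem (f F' G') y' (map x (coords M F')))"
    by (rule sem_Comp_proj_left[OF familiesD(2)[OF \<Lambda> FG(1)] familiesD(2)[OF \<Lambda> FG(2)] FG(4)
        familiesD(3)[OF \<Lambda> FG(2)]])
  finally show ?thesis .
qed

lemma kernel_cylinder_refine:
  assumes k: "k \<in> lc_kernels X (two_pow N)" and x: "x \<in> topspace X"
    and G: "G \<in> approx N" "G' \<in> approx N" "subseq G G'"
  shows "k (cyl N (coords N G) y, x) =
    (\<Sum>y' | y' \<in> pow2 (length (coords N G')) \<and> point N (coords N G') y' \<in> cyl N (coords N G) y.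
       k (cyl N (coords N G') y', x))"
proof (rule measure_by_cylinders[OF lc_kernelsD(5)[OF k x] distinct_coords[OF G(2)] set_coords[OF G(2)]])
  show "cyl N (coords N G) y \<subseteq> points N" by (auto simp: cyl_def)
  show "depends_on N (coords N G') (\<lambda>x. x \<in> cyl N (coords N G) y)"
    by (rule depends_on_mono[OF depends_on_cyl set_coords_mono[OF G(3)]])
qed

text \<open>Naturality is automatic for components that are restrictions of one kernel: it is additivity of
  the kernel for the decomposition of a cylinder into smaller ones.\<close>

lemma families_of_kernelI:
  assumes k: "k \<in> lc_kernels (two_pow M) (two_pow N)" and rep: "represents M N k (\<Lambda>, f)"
    and sub: "\<Lambda> \<subseteq> approx M \<times> approx N"
    and hom: "\<And>F G. (F, G) \<in> \<Lambda> \<Longrightarrow> f F G \<in> Hom \<F> (length (coords M F)) (length (coords N G))"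
    and cov: "\<And>G. G \<in> approx N \<Longrightarrow> \<exists>F. (F, G) \<in> \<Lambda>"
    and her: "\<And>F G F'. (F, G) \<in> \<Lambda> \<Longrightarrow> F' \<in> approx M \<Longrightarrow> subseq F F' \<Longrightarrow> (F', G) \<in> \<Lambda>"
  shows "(\<Lambda>, f) \<in> families M N"
proof -
  have "Comp \<F> (length (coords M F')) (length (coords N G')) (length (coords N G)) (pr N G' G) (f F' G') =
      Comp \<F> (length (coords M F')) (length (coords M F)) (length (coords N G)) (f F G) (pr M F' F)"
    if FG: "(F, G) \<in> \<Lambda>" "(F', G') \<in> \<Lambda>" and sub': "subseq F F'" "subseq G G'" for F G F' G'
  proof -
    have F: "F \<in> approx M" "F' \<in> approx M" and G: "G \<in> approx N" "G' \<in> approx N" using FG sub by auto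
    show ?thesis
    proof (rule Hom_eqI[OF F(2)])
      show "Comp \<F> (length (coords M F')) (length (coords N G')) (length (coords N G)) (pr N G' G) (f F' G')
          \<in> Hom \<F> (length (coords M F')) (length (coords N G))"
        by (rule Free_Comp_in_Hom[OF hom[OF FG(2)] proj_in_Hom[OF G sub'(2)]])
      show "Comp \<F> (length (coords M F')) (length (coords M F)) (length (coords N G)) (f F G) (pr M F' F)
          \<in> Hom \<F> (length (coords M F')) (length (coords N G))"
        by (rule Free_Comp_in_Hom[OF proj_in_Hom[OF F sub'(1)] hom[OF FG(1)]])
      fix x y assume x: "x \<in> points M" and y: "y \<in> pow2 (length (coords N G))"
      have "sem (Comp \<F> (length (coords M F')) (length (coords N G')) (length (coords N G)) (pr N G' G) (f F' G'))
          y (map x (coords M F')) =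
          (\<Sum>y' | y' \<in> pow2 (length (coords N G')) \<and> point N (coords N G') y' \<in> cyl N (coords N G) y.
            sem (f F' G') y' (map x (coords M F')))"
        by (rule sem_Comp_proj_left[OF G sub'(2) hom[OF FG(2)]])
      also have "\<dots> = (\<Sum>y' | y' \<in> pow2 (length (coords N G')) \<and> point N (coords N G') y' \<in> cyl N (coords N G) y.
            k (cyl N (coords N G') y', x))"
        by (rule sum.cong[OF HOL.refl]) (simp add: representsD[OF rep FG(2) x])
      also have "\<dots> = k (cyl N (coords N G) y, x)"
        by (rule kernel_cylinder_refine[OF k x G sub'(2), symmetric])
      also have "\<dots> = sem (f F G) y (map x (coords M F))"
        by (rule representsD[OF rep FG(1) x y, symmetric])
      also have "\<dots> = sem (Comp \<F> (length (coords M F')) (length (coords M F)) (length (coords N G)) (f F G) (pr M F' F))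
          y (map x (coords M F'))"
        by (rule sem_Comp_proj_right[OF F sub'(1) hom[OF FG(1)], symmetric])
      finally show "sem (Comp \<F> (length (coords M F')) (length (coords N G')) (length (coords N G)) (pr N G' G) (f F' G'))
          y (map x (coords M F')) =
        sem (Comp \<F> (length (coords M F')) (length (coords M F)) (length (coords N G)) (f F G) (pr M F' F))
          y (map x (coords M F'))" .
    qed
  qed
  then show ?thesis
    using sub hom cov her unfolding families_iff by blast
qed

lemma kernel_eq_on_cylinders:
  assumes k: "k \<in> lc_kernels X (two_pow N)" and l: "l \<in> lc_kernels X (two_pow N)"
    and eq: "\<And>G y x. G \<in> approx N \<Longrightarrow> y \<in> pow2 (length (coords N G)) \<Longrightarrow> x \<in> topspace X \<Longrightarrow>
      k (cyl N (coords N G) y, x) = l (cyl N (coords N G) y, x)"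
  shows "k = l"
proof (rule lc_kernels_eqI[OF k l])
  fix U x assume U: "U \<in> Clopen (two_pow N)" and x: "x \<in> topspace X"
  obtain G where G: "G \<in> approx N" "depends_on N (coords N G) (\<lambda>x. x \<in> U)"
    using U locally_constant_depends_on approx_cofinal unfolding Clopen_iff_locally_constant by metis
  note expand = measure_by_cylinders[OF _ distinct_coords[OF G(1)] set_coords[OF G(1)] Clopen_subset[OF U] G(2)]
  show "k (U, x) = l (U, x)"
    unfolding expand[OF lc_kernelsD(5)[OF k x]] expand[OF lc_kernelsD(5)[OF l x]]
    by (rule sum.cong[OF HOL.refl]) (simp add: eq G(1) x)
qed

lemma represents_unique:
  assumes fam: "fam \<in> families M N"
    and k: "k \<in> lc_kernels (two_pow M) (two_pow N)" "represents M N k fam"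
    and l: "l \<in> lc_kernels (two_pow M) (two_pow N)" "represents M N l fam"
  shows "k = l"
proof (rule kernel_eq_on_cylinders[OF k(1) l(1)])
  obtain \<Lambda> f where f: "fam = (\<Lambda>, f)" by (cases fam)
  fix G y x assume G: "G \<in> approx N" and yx: "y \<in> pow2 (length (coords N G))" "x \<in> points M"
  obtain F where F: "(F, G) \<in> \<Lambda>" using familiesD(5)[OF fam[unfolded f] G] by blast
  show "k (cyl N (coords N G) y, x) = l (cyl N (coords N G) y, x)"
    using representsD[OF k(2)[unfolded f] F yx(2,1)] representsD[OF l(2)[unfolded f] F yx(2,1)] by simp
qed

text \<open>The index set consists of all pairs \<open>(F, G)\<close> such that the joint distribution of the outputs in
  \<open>G\<close> depends on the inputs in \<open>F\<close> only. It is covering by local constancy.\<close>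

lemma kernel_represented:
  assumes k: "k \<in> lc_kernels (two_pow M) (two_pow N)"
  obtains fam where "fam \<in> families M N" "represents M N k fam"
proof -
  let ?n = "\<lambda>G. length (coords N G)" and ?m = "\<lambda>F. length (coords M F)"
  let ?dep = "\<lambda>F G. depends_on M (coords M F) (\<lambda>x. \<lambda>y\<in>pow2 (?n G). k (cyl N (coords N G) y, x))"
  define \<Lambda> where "\<Lambda> = {(F, G). F \<in> approx M \<and> G \<in> approx N \<and> ?dep F G}"
  have cyl: "cyl N (coords N G) y \<in> Clopen (two_pow N)" if "G \<in> approx N" for G y
    by (rule cyl_Clopen[OF set_coords[OF that]])
  \<comment> \<open>On indices in \<open>\<Lambda>\<close> the choice of a point with restriction \<open>z\<close> does not matter.\<close>
  define b where "b F G y z = (if y \<in> pow2 (?n G) \<and> z \<in> pow2 (?m F)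
    then k (cyl N (coords N G) y, point M (coords M F) z) else 0)" for F G y z
  have b: "b F G \<in> Hom BinStoch (?m F) (?n G)" if FG: "F \<in> approx M" "G \<in> approx N" for F G
  proof (rule BinStoch_HomI)
    show "0 \<le> b F G y z" for y z
      using lc_kernelsD(2)[OF k cyl[OF FG(2)] point_coords(1)[OF FG(1)]] by (simp add: b_def)
    show "(\<Sum>y\<in>pow2 (?n G). b F G y z) = 1" if z: "z \<in> pow2 (?m F)" for z
    proof -
      note x = point_coords(1)[OF FG(1) z]
      have "(\<Sum>y\<in>pow2 (?n G). b F G y z) =
          (\<Sum>y | y \<in> pow2 (?n G) \<and> point N (coords N G) y \<in> points N. k (cyl N (coords N G) y, point M (coords M F) z))"
        using z point_coords(1)[OF FG(2)] by (intro sum.cong) (auto simp: b_def)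
      also have "\<dots> = k (points N, point M (coords M F) z)"
        by (rule measure_by_cylinders[OF lc_kernelsD(5)[OF k x] distinct_coords[OF FG(2)] set_coords[OF FG(2)], symmetric])
          (simp_all add: depends_on_def)
      finally show ?thesis using lc_kernelsD(6)[OF k x] by simp
    qed
    show "b F G y z = 0" if "y \<notin> pow2 (?n G) \<or> z \<notin> pow2 (?m F)" for y z
      using that by (auto simp: b_def)
  qed
  define f where "f F G = (SOME c. c \<in> Hom \<F> (?m F) (?n G) \<and> sem c = b F G)" for F G
  have f: "f F G \<in> Hom \<F> (?m F) (?n G) \<and> sem (f F G) = b F G" if FG: "F \<in> approx M" "G \<in> approx N" for F G
  proof -
    obtain c where "c \<in> Hom \<F> (?m F) (?n G)" "sem c = b F G" by (rule sem_surject[OF b[OF FG]])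
    then have "c \<in> Hom \<F> (?m F) (?n G) \<and> sem c = b F G" by (rule conjI)
    then show ?thesis
      unfolding f_def by (rule someI[where P = "\<lambda>c. c \<in> Hom \<F> (?m F) (?n G) \<and> sem c = b F G"])
  qed
  have rep: "represents M N k (\<Lambda>, f)"
  proof (rule representsI)
    fix F G x y assume FG: "(F, G) \<in> \<Lambda>" and x: "x \<in> points M" and y: "y \<in> pow2 (?n G)"
    then have F: "F \<in> approx M" and G: "G \<in> approx N" and dep: "?dep F G" by (auto simp: \<Lambda>_def)
    note p = point_coords[OF F map_coords_pow2[of x M F]]
    from depends_onD[OF dep p(1) x p(2)]
    have "(\<lambda>y\<in>pow2 (?n G). k (cyl N (coords N G) y, point M (coords M F) (map x (coords M F)))) y =
        (\<lambda>y\<in>pow2 (?n G). k (cyl N (coords N G) y, x)) y" by (rule fun_cong)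
    then show "sem (f F G) y (map x (coords M F)) = k (cyl N (coords N G) y, x)"
      using y f[OF F G] by (simp add: b_def)
  qed
  have "(\<Lambda>, f) \<in> families M N"
  proof (rule families_of_kernelI[OF k rep])
    show "\<Lambda> \<subseteq> approx M \<times> approx N" by (auto simp: \<Lambda>_def)
    show "f F G \<in> Hom \<F> (?m F) (?n G)" if "(F, G) \<in> \<Lambda>" for F G
      using that f by (simp add: \<Lambda>_def)
    show "\<exists>F. (F, G) \<in> \<Lambda>" if G: "G \<in> approx N" for G
    proof -
      have "locally_constant (two_pow M) (\<lambda>x. \<lambda>y\<in>pow2 (?n G). k (cyl N (coords N G) y, x))"
        by (intro locally_constant_family finite_pow2 lc_kernelsD(4)[OF k] cyl[OF G])
      from locally_constant_depends_on[OF this] obtain S where S: "finite S" "S \<subseteq> idx M"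
        "\<forall>L. S \<subseteq> set L \<longrightarrow> depends_on M L (\<lambda>x. \<lambda>y\<in>pow2 (?n G). k (cyl N (coords N G) y, x))"
        by (elim exE conjE)
      obtain F where "F \<in> approx M" "S \<subseteq> set (coords M F)" using approx_cofinal[OF S(1,2)] by blast
      then show ?thesis using S(3) G by (auto simp: \<Lambda>_def)
    qed
    show "(F', G) \<in> \<Lambda>" if "(F, G) \<in> \<Lambda>" "F' \<in> approx M" "subseq F F'" for F G F'
      using that depends_on_mono[OF _ set_coords_mono[OF that(3)]] by (auto simp: \<Lambda>_def)
  qed
  with rep show ?thesis by (intro that)
qed


section \<open>Every family represents a kernel\<close>

text \<open>The probability that a single component assigns to \<open>U\<close>. It is meaningful if \<open>U\<close> depends on
  the coordinates in \<open>G\<close> only: then it is the sum over the cylinders contained in \<open>U\<close>, each tested at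
  one point.\<close>

definition mass :: "enat \<Rightarrow> enat \<Rightarrow> (nat list \<Rightarrow> nat list \<Rightarrow> causal_gen smterm set) \<Rightarrow>
    nat list \<Rightarrow> nat list \<Rightarrow> (nat \<Rightarrow> bool) set \<Rightarrow> (nat \<Rightarrow> bool) \<Rightarrow> real" where
  "mass M N f F G U x = (\<Sum>y | y \<in> pow2 (length (coords N G)) \<and> point N (coords N G) y \<in> U.
     sem (f F G) y (map x (coords M F)))"

lemma mass_refine:
  assumes fam: "(\<Lambda>, f) \<in> families M N"
    and FG: "(F, G) \<in> \<Lambda>" "(F', G') \<in> \<Lambda>" "subseq F F'" "subseq G G'"
    and U: "depends_on N (coords N G) (\<lambda>x. x \<in> U)"
  shows "mass M N f F G U x = mass M N f F' G' U x"
proof -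
  let ?pt = "point N (coords N G)" and ?pt' = "point N (coords N G')"
  let ?S = "{y'. y' \<in> pow2 (length (coords N G')) \<and> ?pt' y' \<in> U}"
  let ?T = "{y. y \<in> pow2 (length (coords N G)) \<and> ?pt y \<in> U}"
  let ?g = "\<lambda>y'. map (?pt' y') (coords N G)"
  note pt = point_coords[OF familiesD(2)[OF fam FG(1)]] and pt' = point_coords[OF familiesD(2)[OF fam FG(2)]]
  have iff: "?pt y \<in> U \<longleftrightarrow> ?pt' y' \<in> U"
    if "y \<in> pow2 (length (coords N G))" "y' \<in> pow2 (length (coords N G'))" "?g y' = y" for y y'
    using depends_onD[OF U pt(1)[OF that(1)] pt'(1)[OF that(2)]] pt(2)[OF that(1)] that(3) by simp
  have "mass M N f F G U x = (\<Sum>y\<in>?T. \<Sum>y' | y' \<in> pow2 (length (coords N G')) \<and> ?pt' y' \<in> cyl N (coords N G) y.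
      sem (f F' G') y' (map x (coords M F')))"
    unfolding mass_def by (intro sum.cong[OF HOL.refl] families_natural[OF fam FG])
  also have "\<dots> = (\<Sum>y\<in>?T. \<Sum>y'\<in>{y' \<in> ?S. ?g y' = y}. sem (f F' G') y' (map x (coords M F')))"
  proof (rule sum.cong[OF HOL.refl])
    fix y assume y: "y \<in> ?T"
    have "{y'. y' \<in> pow2 (length (coords N G')) \<and> ?pt' y' \<in> cyl N (coords N G) y} = {y' \<in> ?S. ?g y' = y}"
      using y iff[of y] pt'(1) by (auto simp: cyl_def)
    then show "(\<Sum>y' | y' \<in> pow2 (length (coords N G')) \<and> ?pt' y' \<in> cyl N (coords N G) y.
        sem (f F' G') y' (map x (coords M F'))) =
      (\<Sum>y'\<in>{y' \<in> ?S. ?g y' = y}. sem (f F' G') y' (map x (coords M F')))"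
      by (rule sum.cong) (rule HOL.refl)
  qed
  also have "\<dots> = mass M N f F' G' U x"
    unfolding mass_def
  proof (rule sum.group)
    show "?g ` ?S \<subseteq> ?T"
    proof (rule image_subsetI)
      fix y' assume y': "y' \<in> ?S"
      then show "?g y' \<in> ?T" using iff[OF map_coords_pow2 _ HOL.refl, of y'] by simp
    qed
  qed simp_all
  finally show ?thesis .
qed

text \<open>An upper bound \<open>G''\<close> of the outputs is covered by some \<open>F\<^sub>0\<close>, and by hereditariness the inputs can
  then be enlarged to bound the given ones as well.\<close>

lemma families_upper_bound:
  assumes fam: "(\<Lambda>, f) \<in> families M N" and FG: "(F, G) \<in> \<Lambda>" "(F', G') \<in> \<Lambda>"
  obtains F'' G'' where "(F'', G'') \<in> \<Lambda>" "subseq F F''" "subseq F' F''" "subseq G G''" "subseq G' G''"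
proof -
  obtain G'' where G'': "G'' \<in> approx N" "subseq G G''" "subseq G' G''"
    using FinLO_directed[OF familiesD(2)[OF fam FG(1)] familiesD(2)[OF fam FG(2)]] by blast
  obtain F\<^sub>0 where F0: "(F\<^sub>0, G'') \<in> \<Lambda>" using familiesD(5)[OF fam G''(1)] by blast
  obtain F\<^sub>1 where F1: "F\<^sub>1 \<in> approx M" "subseq F F\<^sub>1" "subseq F' F\<^sub>1"
    using FinLO_directed[OF familiesD(1)[OF fam FG(1)] familiesD(1)[OF fam FG(2)]] by blast
  obtain F'' where F'': "F'' \<in> approx M" "subseq F\<^sub>0 F''" "subseq F\<^sub>1 F''"
    using FinLO_directed[OF familiesD(1)[OF fam F0] F1(1)] by blast
  show ?thesis
    using that[OF familiesD(6)[OF fam F0 F''(1,2)]] G'' F1 F''(3) subseq_order.order_trans by blast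
qed

lemma mass_unique:
  assumes fam: "(\<Lambda>, f) \<in> families M N" and FG: "(F, G) \<in> \<Lambda>" "(F', G') \<in> \<Lambda>"
    and U: "depends_on N (coords N G) (\<lambda>x. x \<in> U)" "depends_on N (coords N G') (\<lambda>x. x \<in> U)"
  shows "mass M N f F G U x = mass M N f F' G' U x"
proof -
  obtain F'' G'' where *: "(F'', G'') \<in> \<Lambda>" "subseq F F''" "subseq F' F''" "subseq G G''" "subseq G' G''"
    by (rule families_upper_bound[OF fam FG])
  show ?thesis
    using mass_refine[OF fam FG(1) *(1,2,4) U(1)] mass_refine[OF fam FG(2) *(1,3,5) U(2)] by simp
qed

lemma depends_on_family_index:
  assumes fam: "(\<Lambda>, f) \<in> families M N" and h: "locally_constant (two_pow N) h"
  shows "\<exists>p\<in>\<Lambda>. depends_on N (coords N (snd p)) h"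
proof -
  from locally_constant_depends_on[OF h] obtain S where S: "finite S" "S \<subseteq> idx N"
    "\<forall>L. S \<subseteq> set L \<longrightarrow> depends_on N L h" by (elim exE conjE)
  obtain G where G: "G \<in> approx N" "S \<subseteq> set (coords N G)" using approx_cofinal[OF S(1,2)] by blast
  obtain F where "(F, G) \<in> \<Lambda>" using familiesD(5)[OF fam G(1)] by blast
  then show ?thesis using S(3) G(2) by (intro bexI[of _ "(F, G)"]) simp_all
qed

text \<open>The kernel assigns to a clopen set its mass in any component that sees enough outputs. Since the
  mass does not depend on the component (\<open>mass_unique\<close>), each property of a kernel can be checked in a
  single component that sees all sets involved.\<close>

lemma family_represents_kernel:
  assumes fam: "(\<Lambda>, f) \<in> families M N"
  shows "\<exists>k\<in>lc_kernels (two_pow M) (two_pow N). represents M N k (\<Lambda>, f)"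
proof -
  define p where "p U = (SOME p. p \<in> \<Lambda> \<and> depends_on N (coords N (snd p)) (\<lambda>x. x \<in> U))" for U
  define k where "k = (\<lambda>(U, x)\<in>Clopen (two_pow N) \<times> points M. mass M N f (fst (p U)) (snd (p U)) U x)"
  have p: "(fst (p U), snd (p U)) \<in> \<Lambda>" "depends_on N (coords N (snd (p U))) (\<lambda>x. x \<in> U)"
    if U: "U \<in> Clopen (two_pow N)" for U
  proof -
    have "\<exists>p. p \<in> \<Lambda> \<and> depends_on N (coords N (snd p)) (\<lambda>x. x \<in> U)"
      using depends_on_family_index[OF fam conjunct2[OF iffD1[OF Clopen_iff_locally_constant U]]]
      by (simp only: Bex_def)
    from someI_ex[OF this] show "(fst (p U), snd (p U)) \<in> \<Lambda>" "depends_on N (coords N (snd (p U))) (\<lambda>x. x \<in> U)"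
      by (simp_all add: p_def)
  qed
  have k: "k (U, x) = mass M N f F G U x"
    if "U \<in> Clopen (two_pow N)" "x \<in> points M" "(F, G) \<in> \<Lambda>" "depends_on N (coords N G) (\<lambda>x. x \<in> U)" for U x F G
    using mass_unique[OF fam p(1)[OF that(1)] that(3) p(2)[OF that(1)] that(4)] that(1,2) by (simp add: k_def)
  have nonneg: "0 \<le> sem (f F G) y z" if "(F, G) \<in> \<Lambda>" for F G y z
    by (rule BinStoch_HomD(1)[OF sem_in_Hom[OF familiesD(3)[OF fam that]]])
  have total: "mass M N f F G (points N) x = 1" if FG: "(F, G) \<in> \<Lambda>" for F G x
  proof -
    have "mass M N f F G (points N) x = (\<Sum>y\<in>pow2 (length (coords N G)). sem (f F G) y (map x (coords M F)))"
      unfolding mass_def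
      using point_coords(1)[OF familiesD(2)[OF fam FG]] by (intro sum.cong) auto
    then show ?thesis
      using BinStoch_HomD(2)[OF sem_in_Hom[OF familiesD(3)[OF fam FG]] map_coords_pow2] by simp
  qed
  have bounds: "0 \<le> mass M N f F G U x" "mass M N f F G U x \<le> 1"
    if FG: "(F, G) \<in> \<Lambda>" and U: "U \<subseteq> points N" for F G U x
  proof -
    show "0 \<le> mass M N f F G U x" unfolding mass_def by (intro sum_nonneg nonneg[OF FG])
    have "mass M N f F G U x \<le> mass M N f F G (points N) x"
      unfolding mass_def using U by (intro sum_mono2 nonneg[OF FG]) auto
    then show "mass M N f F G U x \<le> 1" by (simp only: total[OF FG])
  qed
  have "k \<in> Clopen (two_pow N) \<times> points M \<rightarrow>\<^sub>E {0..1}"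
    using bounds[OF p(1) Clopen_subset] by (auto simp: k_def PiE_iff extensional_def)
  moreover have "locally_constant (two_pow M) (\<lambda>x. k (U, x))" if U: "U \<in> Clopen (two_pow N)" for U
  proof (rule locally_constant_cong)
    show "k (U, x) = mass M N f (fst (p U)) (snd (p U)) U x" if "x \<in> points M" for x
      using that U by (simp add: k_def)
    show "locally_constant (two_pow M) (\<lambda>x. mass M N f (fst (p U)) (snd (p U)) U x)"
    proof (rule depends_on_locally_constant)
      show "set (coords M (fst (p U))) \<subseteq> idx M"
        by (rule set_coords[OF familiesD(1)[OF fam p(1)[OF U]]])
      show "depends_on M (coords M (fst (p U))) (\<lambda>x. mass M N f (fst (p U)) (snd (p U)) U x)"
        unfolding depends_on_def mass_def by (intro ballI impI) (simp only:)
    qed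
  qed
  moreover have "additive (Clopen (two_pow N)) (\<lambda>U. k (U, x))" if x: "x \<in> points M" for x
    unfolding additive_def
  proof (intro ballI impI)
    fix U V assume U: "U \<in> Clopen (two_pow N)" and V: "V \<in> Clopen (two_pow N)" and disjoint: "U \<inter> V = {}"
    have "locally_constant (two_pow N) (\<lambda>x. (x \<in> U, x \<in> V))"
      using U V by (intro locally_constant_Pair) (simp_all add: Clopen_iff_locally_constant)
    from depends_on_family_index[OF fam this] obtain F G where FG: "(F, G) \<in> \<Lambda>"
      and dep: "depends_on N (coords N G) (\<lambda>x. (x \<in> U, x \<in> V))" by auto
    have depUV: "depends_on N (coords N G) (\<lambda>x. x \<in> U)" "depends_on N (coords N G) (\<lambda>x. x \<in> V)"
      "depends_on N (coords N G) (\<lambda>x. x \<in> U \<union> V)"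
      using depends_onD[OF dep] unfolding depends_on_def by blast+
    have "mass M N f F G (U \<union> V) x = mass M N f F G U x + mass M N f F G V x"
    proof -
      let ?P = "\<lambda>U. {y. y \<in> pow2 (length (coords N G)) \<and> point N (coords N G) y \<in> U}"
      have "?P (U \<union> V) = ?P U \<union> ?P V" "?P U \<inter> ?P V = {}" using disjoint by auto
      then show ?thesis unfolding mass_def by (simp add: sum.union_disjoint)
    qed
    then show "k (U \<union> V, x) = k (U, x) + k (V, x)"
      using k[OF U x FG depUV(1)] k[OF V x FG depUV(2)] k[OF Clopen_Un[OF U V] x FG depUV(3)] by simp
  qed
  moreover have "k (points N, x) = 1" if x: "x \<in> points M" for x
    using x total[OF p(1)[OF Clopen_topspace]] by (simp add: k_def)
  ultimately have "k \<in> lc_kernels (two_pow M) (two_pow N)" by (simp add: lc_kernels_def)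
  moreover have "represents M N k (\<Lambda>, f)"
  proof (rule representsI)
    fix F G x y assume FG: "(F, G) \<in> \<Lambda>" and x: "x \<in> points M" and y: "y \<in> pow2 (length (coords N G))"
    note G = familiesD(2)[OF fam FG]
    have "k (cyl N (coords N G) y, x) = mass M N f F G (cyl N (coords N G) y) x"
      by (rule k[OF cyl_Clopen[OF set_coords[OF G]] x FG depends_on_cyl])
    also have "{y'. y' \<in> pow2 (length (coords N G)) \<and> point N (coords N G) y' \<in> cyl N (coords N G) y} = {y}"
      using point_coords[OF G] y by (auto simp: cyl_def)
    then have "mass M N f F G (cyl N (coords N G) y) x = sem (f F G) y (map x (coords M F))"
      by (simp add: mass_def)
    finally show "sem (f F G) y (map x (coords M F)) = k (cyl N (coords N G) y, x)" ..
  qed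
  ultimately show ?thesis by blast
qed

section \<open>Equivalence, identities and composition of families\<close>

text \<open>From left to right, agreement is known only on the common indices. But each component of the
  second family is determined by its component with the same outputs and more inputs, and for enough
  inputs that index is common.\<close>

lemma family_equiv_iff_represents:
  assumes fam: "(\<Lambda>, f) \<in> families M N" and rep: "represents M N k (\<Lambda>, f)"
    and fam': "(\<Lambda>', f') \<in> families M N"
  shows "family_equiv (\<Lambda>, f) (\<Lambda>', f') \<longleftrightarrow> represents M N k (\<Lambda>', f')"
proof
  assume "family_equiv (\<Lambda>, f) (\<Lambda>', f')"
  then have agree: "f F G = f' F G" if "(F, G) \<in> \<Lambda>" "(F, G) \<in> \<Lambda>'" for F G
    using that unfolding family_equiv_def by blast
  show "represents M N k (\<Lambda>', f')"
  proof (rule representsI)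
    fix F G x y assume FG: "(F, G) \<in> \<Lambda>'" and x: "x \<in> points M" and y: "y \<in> pow2 (length (coords N G))"
    note F = familiesD(1)[OF fam' FG] and G = familiesD(2)[OF fam' FG]
    obtain F\<^sub>0 where F0: "(F\<^sub>0, G) \<in> \<Lambda>" using familiesD(5)[OF fam G] by blast
    obtain F' where F': "F' \<in> approx M" "subseq F F'" "subseq F\<^sub>0 F'"
      using FinLO_directed[OF F familiesD(1)[OF fam F0]] by blast
    note L = familiesD(6)[OF fam F0 F'(1,3)] and L' = familiesD(6)[OF fam' FG F'(1,2)]
    have "{y'. y' \<in> pow2 (length (coords N G)) \<and> point N (coords N G) y' \<in> cyl N (coords N G) y} = {y}"
      using point_coords[OF G] y by (auto simp: cyl_def)
    then have "sem (f' F G) y (map x (coords M F)) = sem (f' F' G) y (map x (coords M F'))"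
      by (simp add: families_natural[OF fam' FG L' F'(2) subseq_order.order_refl])
    also have "\<dots> = k (cyl N (coords N G) y, x)"
      unfolding agree[OF L L', symmetric] by (rule representsD[OF rep L x y])
    finally show "sem (f' F G) y (map x (coords M F)) = k (cyl N (coords N G) y, x)" .
  qed
next
  assume rep': "represents M N k (\<Lambda>', f')"
  have "f F G = f' F G" if FG: "(F, G) \<in> \<Lambda>" "(F, G) \<in> \<Lambda>'" for F G
    by (rule Hom_eqI[OF familiesD(1)[OF fam FG(1)] familiesD(3)[OF fam FG(1)] familiesD(3)[OF fam' FG(2)]])
      (simp only: representsD[OF rep FG(1)] representsD[OF rep' FG(2)])
  then show "family_equiv (\<Lambda>, f) (\<Lambda>', f')" unfolding family_equiv_def by auto
qed

definition representatives ::
  "enat \<Rightarrow> enat \<Rightarrow> ((nat \<Rightarrow> bool) set \<times> (nat \<Rightarrow> bool) \<Rightarrow> real) \<Rightarrow> causal_gen smterm set approx_family set" where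
  "representatives M N k = {fam \<in> families M N. represents M N k fam}"

lemma family_class_eq_representatives:
  assumes "fam \<in> families M N" "represents M N k fam"
  shows "family_class \<F> (free_object M) (free_object N) fam = representatives M N k"
proof -
  have "family_equiv fam fam' \<longleftrightarrow> represents M N k fam'" if "fam' \<in> families M N" for fam'
    using family_equiv_iff_represents[of "fst fam" "snd fam" M N k "fst fam'" "snd fam'"] assms that
    unfolding prod.collapse by blast
  then show ?thesis unfolding family_class_def representatives_def by blast
qed

text \<open>Injective, as each kernel is represented by a family and a family represents only one kernel;
  surjective, as each family represents a kernel and its class consists of all families doing so.\<close>

lemma representatives_bij:
  "bij_betw (representatives M N) (lc_kernels (two_pow M) (two_pow N)) (Hom (Free_infinity causal_sig E) M N)"
proof -
  have Hom: "Hom (Free_infinity causal_sig E) M N =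
      family_class \<F> (free_object M) (free_object N) ` families M N"
    by (simp add: Free_infinity_def)
  show ?thesis
    unfolding bij_betw_def Hom
  proof (intro conjI equalityI subsetI)
    show "inj_on (representatives M N) (lc_kernels (two_pow M) (two_pow N))"
    proof (rule inj_onI)
      fix k l assume k: "k \<in> lc_kernels (two_pow M) (two_pow N)" and l: "l \<in> lc_kernels (two_pow M) (two_pow N)"
        and eq: "representatives M N k = representatives M N l"
      obtain fam where "fam \<in> families M N" "represents M N k fam" by (rule kernel_represented[OF k])
      moreover from this have "represents M N l fam" using eq by (auto simp: representatives_def)
      ultimately show "k = l" using represents_unique k l by blast
    qed
  next
    fix c assume "c \<in> representatives M N ` lc_kernels (two_pow M) (two_pow N)"
    then obtain k where k: "k \<in> lc_kernels (two_pow M) (two_pow N)" and c: "c = representatives M N k" by blast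
    obtain fam where fam: "fam \<in> families M N" "represents M N k fam" by (rule kernel_represented[OF k])
    then show "c \<in> family_class \<F> (free_object M) (free_object N) ` families M N"
      unfolding c using family_class_eq_representatives[OF fam] by (intro image_eqI[OF _ fam(1)]) simp
  next
    fix c assume "c \<in> family_class \<F> (free_object M) (free_object N) ` families M N"
    then obtain fam where fam: "fam \<in> families M N" and c: "c = family_class \<F> (free_object M) (free_object N) fam"
      by blast
    obtain k where k: "k \<in> lc_kernels (two_pow M) (two_pow N)" "represents M N k fam"
      using family_represents_kernel[of "fst fam" "snd fam" M N] fam unfolding prod.collapse by blast
    show "c \<in> representatives M N ` lc_kernels (two_pow M) (two_pow N)"
      unfolding c family_class_eq_representatives[OF fam k(2)] by (rule imageI[OF k(1)])
  qed
qed

lemma family_id_represents: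
  "family_id \<F> (free_object N) \<in> families N N"
  "represents N N (Idn StoneStoch_lc (two_pow N)) (family_id \<F> (free_object N))"
proof -
  let ?\<Lambda> = "{(F, G). F \<in> approx N \<and> G \<in> approx N \<and> subseq G F}"
  have eq: "family_id \<F> (free_object N) = (?\<Lambda>, proj \<F> (snd (free_object N)))"
    by (simp add: family_id_def case_prod_beta)
  have rep: "represents N N (Idn StoneStoch_lc (two_pow N)) (?\<Lambda>, proj \<F> (snd (free_object N)))"
  proof (rule representsI)
    fix F G x y assume FG: "(F, G) \<in> ?\<Lambda>" and x: "x \<in> points N" and y: "y \<in> pow2 (length (coords N G))"
    then have *: "G \<in> approx N" "F \<in> approx N" "subseq G F" by auto
    show "sem (pr N F G) y (map x (coords N F)) = Idn StoneStoch_lc (two_pow N) (cyl N (coords N G) y, x)"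
      using x cyl_Clopen[OF set_coords[OF *(1)], of y]
      by (auto simp: sem_proj[OF *] StoneStoch_lc_def cyl_def)
  qed
  then show "represents N N (Idn StoneStoch_lc (two_pow N)) (family_id \<F> (free_object N))" unfolding eq .
  show "family_id \<F> (free_object N) \<in> families N N"
    unfolding eq
  proof (rule families_of_kernelI[OF StoneStoch_Idn_in_lc_kernels rep])
    show "pr N F G \<in> Hom \<F> (length (coords N F)) (length (coords N G))" if "(F, G) \<in> ?\<Lambda>" for F G
      using that by (auto intro: proj_in_Hom)
    show "\<exists>F. (F, G) \<in> ?\<Lambda>" if "G \<in> approx N" for G using that by auto
    show "(F', G) \<in> ?\<Lambda>" if "(F, G) \<in> ?\<Lambda>" "F' \<in> approx N" "subseq F F'" for F G F'
      using that subseq_order.order_trans by auto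
  qed auto
qed

text \<open>The integral that defines the composite kernel, taken over the partition of the middle space into
  the cylinders over \<open>coords N G\<close>, is the product of the matrices of the two components.\<close>

lemma sem_Comp_represents:
  assumes fam: "(\<Lambda>f, f) \<in> families M N" "(\<Lambda>g, g) \<in> families N K"
    and k: "k \<in> lc_kernels (two_pow M) (two_pow N)" "represents M N k (\<Lambda>f, f)"
    and l: "represents N K l (\<Lambda>g, g)"
    and FGH: "(F, G) \<in> \<Lambda>f" "(G, H) \<in> \<Lambda>g" and x: "x \<in> points M" and z: "z \<in> pow2 (length (coords K H))"
  shows "sem (Comp \<F> (length (coords M F)) (length (coords N G)) (length (coords K H)) (g G H) (f F G))
      z (map x (coords M F)) =
    Comp StoneStoch_lc (two_pow M) (two_pow N) (two_pow K) l k (cyl K (coords K H) z, x)"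
proof -
  let ?r = "\<lambda>y. map y (coords N G)"
  note G = familiesD(2)[OF fam(1) FGH(1)] and H = familiesD(2)[OF fam(2) FGH(2)]
  have "Comp StoneStoch_lc (two_pow M) (two_pow N) (two_pow K) l k (cyl K (coords K H) z, x) =
      (\<Sum>b\<in>?r ` points N. sem (g G H) z b * k ({y \<in> points N. ?r y = b}, x))"
  proof (rule StoneStoch_Comp_levels[OF compact_space_two_pow k(1) cyl_Clopen[OF set_coords[OF H]] x])
    show "locally_constant (two_pow N) ?r"
      by (rule depends_on_locally_constant[OF set_coords[OF G] depends_on_restriction])
    show "l (cyl K (coords K H) z, y) = sem (g G H) z (?r y)" if "y \<in> points N" for y
      by (rule representsD[OF l FGH(2) that z, symmetric])
  qed
  also have "?r ` points N = pow2 (length (coords N G))"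
  proof (intro equalityI subsetI)
    fix y assume y: "y \<in> pow2 (length (coords N G))"
    show "y \<in> ?r ` points N" using pow2_coordsE[OF G y] by blast
  qed auto
  also have "(\<Sum>b\<in>pow2 (length (coords N G)). sem (g G H) z b * k ({y \<in> points N. ?r y = b}, x)) =
      (\<Sum>b\<in>pow2 (length (coords N G)). sem (g G H) z b * sem (f F G) b (map x (coords M F)))"
    by (rule sum.cong[OF HOL.refl]) (simp only: representsD[OF k(2) FGH(1) x] cyl_def)
  also have "\<dots> = sem (Comp \<F> (length (coords M F)) (length (coords N G)) (length (coords K H)) (g G H) (f F G))
      z (map x (coords M F))"
    unfolding sem_Comp[OF familiesD(3)[OF fam(1) FGH(1)] familiesD(3)[OF fam(2) FGH(2)]] BinStoch_Comp ..
  finally show ?thesis ..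
qed

text \<open>The component of the composite at \<open>(F, H)\<close> is defined through an intermediate \<open>G\<close>. Its matrix is
  a restriction of the composite kernel, which does not mention \<open>G\<close>; so it is the same for all \<open>G\<close>.\<close>

lemma family_comp_represents:
  assumes fam: "fam \<in> families M N" "fam' \<in> families N K"
    and k: "k \<in> lc_kernels (two_pow M) (two_pow N)" "represents M N k fam"
    and l: "l \<in> lc_kernels (two_pow N) (two_pow K)" "represents N K l fam'"
  defines "kl \<equiv> Comp StoneStoch_lc (two_pow M) (two_pow N) (two_pow K) l k"
    and "gf \<equiv> family_comp \<F> (free_object M) (free_object N) (free_object K) fam' fam"
  shows "gf \<in> families M K" "represents M K kl gf"
proof -
  obtain \<Lambda>f f where f: "fam = (\<Lambda>f, f)" by (cases fam)
  obtain \<Lambda>g g where g: "fam' = (\<Lambda>g, g)" by (cases fam')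
  note famf = fam(1)[unfolded f] and famg = fam(2)[unfolded g]
  let ?\<Lambda> = "{(F, H). \<exists>G. (F, G) \<in> \<Lambda>f \<and> (G, H) \<in> \<Lambda>g}"
  let ?gf = "\<lambda>F G H. Comp \<F> (length (coords M F)) (length (coords N G)) (length (coords K H)) (g G H) (f F G)"
  define c where "c F H = snd gf F H" for F H
  have gf: "gf = (?\<Lambda>, c)"
    unfolding gf_def c_def f g family_comp_def by (simp add: case_prod_beta)
  have hom: "?gf F G H \<in> Hom \<F> (length (coords M F)) (length (coords K H))"
    if "(F, G) \<in> \<Lambda>f" "(G, H) \<in> \<Lambda>g" for F G H
    by (rule Free_Comp_in_Hom[OF familiesD(3)[OF famf that(1)] familiesD(3)[OF famg that(2)]])
  note sem = sem_Comp_represents[OF famf famg k(1) k(2)[unfolded f] l(2)[unfolded g], folded kl_def]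
  have c: "c F H = ?gf F G H" if G: "(F, G) \<in> \<Lambda>f" "(G, H) \<in> \<Lambda>g" for F G H
  proof -
    have tens: "tens_list \<F> (snd (free_object M)) F = length (coords M F)"
      "tens_list \<F> (snd (free_object N)) G' = length (coords N G')"
      "tens_list \<F> (snd (free_object K)) H = length (coords K H)" if "(F, G') \<in> \<Lambda>f" "(G', H) \<in> \<Lambda>g" for G'
      using that familiesD(1,2)[OF famf] familiesD(2)[OF famg] by (simp_all add: tens_list_approx)
    have "c F H = (THE h. \<exists>G. (F, G) \<in> \<Lambda>f \<and> (G, H) \<in> \<Lambda>g \<and>
        h = Comp \<F> (tens_list \<F> (snd (free_object M)) F) (tens_list \<F> (snd (free_object N)) G)
          (tens_list \<F> (snd (free_object K)) H) (g G H) (f F G))"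
      unfolding c_def gf_def f g family_comp_def by (simp add: case_prod_beta)
    also have "\<dots> = ?gf F G H"
    proof (rule the_equality)
      show "\<exists>G'. (F, G') \<in> \<Lambda>f \<and> (G', H) \<in> \<Lambda>g \<and>
          ?gf F G H = Comp \<F> (tens_list \<F> (snd (free_object M)) F) (tens_list \<F> (snd (free_object N)) G')
          (tens_list \<F> (snd (free_object K)) H) (g G' H) (f F G')"
        using G by (intro exI[of _ G] conjI) (simp_all only: tens)
      fix h assume "\<exists>G'. (F, G') \<in> \<Lambda>f \<and> (G', H) \<in> \<Lambda>g \<and>
          h = Comp \<F> (tens_list \<F> (snd (free_object M)) F) (tens_list \<F> (snd (free_object N)) G')
          (tens_list \<F> (snd (free_object K)) H) (g G' H) (f F G')"
      then obtain G' where G': "(F, G') \<in> \<Lambda>f" "(G', H) \<in> \<Lambda>g" and h: "h = ?gf F G' H"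
        by (auto simp only: tens)
      show "h = ?gf F G H"
        unfolding h
        by (rule Hom_eqI[OF familiesD(1)[OF famf G(1)] hom[OF G'] hom[OF G]]) (simp only: sem[OF G'] sem[OF G])
    qed
    finally show ?thesis .
  qed
  have rep: "represents M K kl (?\<Lambda>, c)"
  proof (rule representsI)
    fix F H x z assume "(F, H) \<in> ?\<Lambda>" and xz: "x \<in> points M" "z \<in> pow2 (length (coords K H))"
    then obtain G where G: "(F, G) \<in> \<Lambda>f" "(G, H) \<in> \<Lambda>g" by blast
    show "sem (c F H) z (map x (coords M F)) = kl (cyl K (coords K H) z, x)"
      unfolding c[OF G] by (rule sem[OF G xz])
  qed
  then show "represents M K kl gf" unfolding gf .
  have kl: "kl \<in> lc_kernels (two_pow M) (two_pow K)"
    unfolding kl_def by (rule StoneStoch_Comp_in_lc_kernels[OF compact_space_two_pow k(1) l(1)])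
  show "gf \<in> families M K"
    unfolding gf
  proof (rule families_of_kernelI[OF kl rep])
    show "?\<Lambda> \<subseteq> approx M \<times> approx K" using familiesD(1)[OF famf] familiesD(2)[OF famg] by blast
    show "c F H \<in> Hom \<F> (length (coords M F)) (length (coords K H))" if FH: "(F, H) \<in> ?\<Lambda>" for F H
    proof -
      obtain G where G: "(F, G) \<in> \<Lambda>f" "(G, H) \<in> \<Lambda>g" using FH by blast
      show ?thesis unfolding c[OF G] by (rule hom[OF G])
    qed
    show "\<exists>F. (F, H) \<in> ?\<Lambda>" if H: "H \<in> approx K" for H
    proof -
      obtain G where G: "(G, H) \<in> \<Lambda>g" using familiesD(5)[OF famg H] by blast
      obtain F where "(F, G) \<in> \<Lambda>f" using familiesD(5)[OF famf familiesD(1)[OF famg G]] by blast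
      with G show ?thesis by blast
    qed
    show "(F', H) \<in> ?\<Lambda>" if "(F, H) \<in> ?\<Lambda>" "F' \<in> approx M" "subseq F F'" for F H F'
      using that familiesD(6)[OF famf] by blast
  qed
qed

lemma representatives_Idn:
  "representatives N N (Idn StoneStoch_lc (two_pow N)) = Idn (Free_infinity causal_sig E) N"
  using family_class_eq_representatives[OF family_id_represents] by (simp add: Free_infinity_def)

lemma representatives_Comp:
  assumes k: "k \<in> lc_kernels (two_pow M) (two_pow N)" and l: "l \<in> lc_kernels (two_pow N) (two_pow K)"
  shows "representatives M K (Comp StoneStoch_lc (two_pow M) (two_pow N) (two_pow K) l k) =
    Comp (Free_infinity causal_sig E) M N K (representatives N K l) (representatives M N k)"
proof -
  obtain fam where fam: "fam \<in> families M N" "represents M N k fam" by (rule kernel_represented[OF k])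
  obtain fam' where fam': "fam' \<in> families N K" "represents N K l fam'" by (rule kernel_represented[OF l])
  have "(\<Union>g\<in>representatives N K l. \<Union>f\<in>representatives M N k.
      family_class \<F> (free_object M) (free_object K)
        (family_comp \<F> (free_object M) (free_object N) (free_object K) g f)) =
    representatives M K (Comp StoneStoch_lc (two_pow M) (two_pow N) (two_pow K) l k)"
  proof (rule UN_class_const)
    show "fam' \<in> representatives N K l" "fam \<in> representatives M N k"
      using fam fam' by (simp_all add: representatives_def)
    fix g f assume "g \<in> representatives N K l" "f \<in> representatives M N k"
    then have g: "g \<in> families N K" "represents N K l g" and f: "f \<in> families M N" "represents M N k f"
      by (simp_all add: representatives_def)
    show "family_class \<F> (free_object M) (free_object K)
        (family_comp \<F> (free_object M) (free_object N) (free_object K) g f) =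
      representatives M K (Comp StoneStoch_lc (two_pow M) (two_pow N) (two_pow K) l k)"
      by (rule family_class_eq_representatives[OF family_comp_represents[OF f(1) g(1) k f(2) l g(2)]])
  qed
  then show ?thesis by (simp add: Free_infinity_def)
qed

end


section \<open>The isomorphism\<close>

lemma category_isomorphismD:
  assumes "category_isomorphism C D \<Phi> \<phi>"
  shows "Ob D = \<Phi> ` Ob C"
    "X \<in> Ob C \<Longrightarrow> Y \<in> Ob C \<Longrightarrow> Hom D (\<Phi> X) (\<Phi> Y) = \<phi> X Y ` Hom C X Y"
    "X \<in> Ob C \<Longrightarrow> Idn D (\<Phi> X) = \<phi> X X (Idn C X)"
    "X \<in> Ob C \<Longrightarrow> Y \<in> Ob C \<Longrightarrow> Z \<in> Ob C \<Longrightarrow> f \<in> Hom C X Y \<Longrightarrow> g \<in> Hom C Y Z \<Longrightarrow>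
      Comp D (\<Phi> X) (\<Phi> Y) (\<Phi> Z) (\<phi> Y Z g) (\<phi> X Y f) = \<phi> X Z (Comp C X Y Z g f)"
  using assms by (simp_all add: category_isomorphism_def bij_betw_def)

text \<open>Every object and every morphism of \<open>D\<close> is the image of one of \<open>C\<close>, so \<open>D\<close> inherits the laws
  of \<open>C\<close>.\<close>

lemma category_transport:
  assumes C: "category C" and iso: "category_isomorphism C D \<Phi> \<phi>"
  shows "category D"
proof -
  note iso = category_isomorphismD[OF iso]
  have id: "\<And>X. X \<in> Ob C \<Longrightarrow> Idn C X \<in> Hom C X X"
    and comp_in: "\<And>X Y Z f g. X \<in> Ob C \<Longrightarrow> Y \<in> Ob C \<Longrightarrow> Z \<in> Ob C \<Longrightarrow> f \<in> Hom C X Y \<Longrightarrow> g \<in> Hom C Y Z \<Longrightarrow>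
      Comp C X Y Z g f \<in> Hom C X Z"
    and unit: "\<And>X Y f. X \<in> Ob C \<Longrightarrow> Y \<in> Ob C \<Longrightarrow> f \<in> Hom C X Y \<Longrightarrow>
      Comp C X X Y f (Idn C X) = f \<and> Comp C X Y Y (Idn C Y) f = f"
    and assoc: "\<And>W X Y Z f g h. W \<in> Ob C \<Longrightarrow> X \<in> Ob C \<Longrightarrow> Y \<in> Ob C \<Longrightarrow> Z \<in> Ob C \<Longrightarrow>
      f \<in> Hom C W X \<Longrightarrow> g \<in> Hom C X Y \<Longrightarrow> h \<in> Hom C Y Z \<Longrightarrow>
      Comp C W X Z (Comp C X Y Z h g) f = Comp C W Y Z h (Comp C W X Y g f)"
    using C unfolding category_def by blast+
  show ?thesis
    unfolding category_def iso(1) ball_simps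
  proof (intro conjI ballI)
    fix X assume X: "X \<in> Ob C"
    show "Idn D (\<Phi> X) \<in> Hom D (\<Phi> X) (\<Phi> X)"
      unfolding iso(2)[OF X X] iso(3)[OF X] by (rule imageI[OF id[OF X]])
    fix Y assume Y: "Y \<in> Ob C"
    {
      fix f' assume "f' \<in> Hom D (\<Phi> X) (\<Phi> Y)"
      then obtain f where f: "f \<in> Hom C X Y" "f' = \<phi> X Y f" unfolding iso(2)[OF X Y] by blast
      show "Comp D (\<Phi> X) (\<Phi> X) (\<Phi> Y) f' (Idn D (\<Phi> X)) = f'"
        unfolding f(2) iso(3)[OF X] iso(4)[OF X X Y id[OF X] f(1)] using unit[OF X Y f(1)] by simp
      show "Comp D (\<Phi> X) (\<Phi> Y) (\<Phi> Y) (Idn D (\<Phi> Y)) f' = f'"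
        unfolding f(2) iso(3)[OF Y] iso(4)[OF X Y Y f(1) id[OF Y]] using unit[OF X Y f(1)] by simp
    }
    fix Z assume Z: "Z \<in> Ob C"
    {
      fix f' g' assume "f' \<in> Hom D (\<Phi> X) (\<Phi> Y)" "g' \<in> Hom D (\<Phi> Y) (\<Phi> Z)"
      then obtain f g where f: "f \<in> Hom C X Y" "f' = \<phi> X Y f" and g: "g \<in> Hom C Y Z" "g' = \<phi> Y Z g"
        unfolding iso(2)[OF X Y] iso(2)[OF Y Z] by blast
      show "Comp D (\<Phi> X) (\<Phi> Y) (\<Phi> Z) g' f' \<in> Hom D (\<Phi> X) (\<Phi> Z)"
        unfolding f(2) g(2) iso(4)[OF X Y Z f(1) g(1)] iso(2)[OF X Z]
        by (rule imageI[OF comp_in[OF X Y Z f(1) g(1)]])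
    }
    fix W f' g' h' assume W: "W \<in> Ob C"
      and "f' \<in> Hom D (\<Phi> X) (\<Phi> Y)" "g' \<in> Hom D (\<Phi> Y) (\<Phi> Z)" "h' \<in> Hom D (\<Phi> Z) (\<Phi> W)"
    then obtain f g h where f: "f \<in> Hom C X Y" "f' = \<phi> X Y f" and g: "g \<in> Hom C Y Z" "g' = \<phi> Y Z g"
      and h: "h \<in> Hom C Z W" "h' = \<phi> Z W h"
      unfolding iso(2)[OF X Y] iso(2)[OF Y Z] iso(2)[OF Z W] by blast
    show "Comp D (\<Phi> X) (\<Phi> Y) (\<Phi> W) (Comp D (\<Phi> Y) (\<Phi> Z) (\<Phi> W) h' g') f' =
        Comp D (\<Phi> X) (\<Phi> Z) (\<Phi> W) h' (Comp D (\<Phi> X) (\<Phi> Y) (\<Phi> Z) g' f')"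
      unfolding f(2) g(2) h(2) iso(4)[OF Y Z W g(1) h(1)] iso(4)[OF X Y Z f(1) g(1)]
        iso(4)[OF X Y W f(1) comp_in[OF Y Z W g(1) h(1)]] iso(4)[OF X Z W comp_in[OF X Y Z f(1) g(1)] h(1)]
        assoc[OF X Y Z W f(1) g(1) h(1)] ..
  qed
qed

theorem corollary7p9:
  fixes E :: "(causal_gen smterm \<times> causal_gen smterm) set"
  assumes "causal_circuit_axioms E"
  shows "isomorphic_categories CantorStoch_lc (Free_infinity causal_sig E)"
proof -
  interpret causal_presentation E by unfold_locales (rule assms)
  have C [simp]: "Ob CantorStoch_lc = range two_pow" "Hom CantorStoch_lc = lc_kernels"
    "Idn CantorStoch_lc = Idn StoneStoch_lc" "Comp CantorStoch_lc = Comp StoneStoch_lc"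
    by (simp_all add: CantorStoch_lc_def full_subcategory_def StoneStoch_lc_def)
  have D: "Ob (Free_infinity causal_sig E) = UNIV" by (simp add: Free_infinity_def)
  \<comment> \<open>The spaces are distinct for distinct exponents, so an object of the source determines its exponent.\<close>
  let ?\<Phi> = "the_inv two_pow"
  let ?\<phi> = "\<lambda>X Y. representatives (?\<Phi> X) (?\<Phi> Y)"
  have \<Phi>: "?\<Phi> (two_pow N) = N" for N by (rule the_inv_f_f[OF inj_two_pow])
  have "category CantorStoch_lc"
    unfolding CantorStoch_lc_def
    by (rule category_StoneStoch_full_subcategory) (auto simp: compact_space_two_pow)
  moreover have "category_isomorphism CantorStoch_lc (Free_infinity causal_sig E) ?\<Phi> ?\<phi>"
    unfolding category_isomorphism_def C D ball_simps
  proof (intro conjI ballI)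
    show "bij_betw ?\<Phi> (range two_pow) UNIV"
      by (rule bij_betw_the_inv_into) (simp add: bij_betw_def inj_two_pow)
  qed (simp_all add: \<Phi> representatives_bij representatives_Idn representatives_Comp)
  ultimately show ?thesis
    unfolding isomorphic_categories_def using category_transport by blast
qed

end
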